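(* In the setting described in the context, let $\alpha\in(0,1)$, suppose $x^f_{\alpha T}(T)\simeq\xi T$ and that $f$ satisfies the Wall Assumption for $(\alpha,\xi)$ with parameters $\alpha_0<\dots<\alpha_n$ and $\varepsilon$. Then $$\rho^f_r(\xi)=\sqrt{\frac{\alpha}{\alpha_0}}\qquad\text{and}\qquad\rho^f_l(\xi)\le\sqrt{\frac{\alpha}{\alpha_n}}.$$ In the definition of $\rho^f_r(\xi)$, the limit for $\eta\downarrow0$ exists (not only the $\liminf$). If moreover $x^f_{\alpha T}(T)$ is in the interior of the region affected by the wall and the Wall Assumption is satisfied with $\varepsilon\le\alpha_n$, then also the limit for $\eta\downarrow0$ in the definition of $\rho^f_l(\xi)$ exists, and $\rho^f_l(\xi)=\sqrt{\alpha/\alpha_n}$.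
   Context: TASEP (continuous time, on $\mathbb{Z}$): each site holds at most one particle; each particle attempts to jump one step to the right at the events of independent rate-one Poisson clocks; a jump succeeds only if the target site is empty. Particles are labelled from right to left, and $x_n(t)$ is the position of the particle with label $n$ at time $t$. $\mathbb{N}=\{1,2,\dots\}$. Wall: $f:\mathbb{R}_{\ge0}\to\mathbb{R}_{\ge0}$ is non-decreasing and càdlàg with $f(0)=0$; $f$ may depend on the observation time $T$. In a TASEP with wall $f$, a jump at time $t$ to a site strictly larger than $f(t)$ is additionally suppressed, so $x^f_1(t)\le f(t)$. Initial condition: a deterministic strictly decreasing integer sequence $\{x^f_n,n\in\mathbb{N}\}$ with $x^f_1\le 0$ and $x^f_n\ge -d_0n-C_0$ for all $n$, for some constants $d_0\ge1$, $C_0$. $(x^f(t))$ is the TASEP with wall $f$ and $x^f_n(0)=x^f_n$; $(\tilde x(t))$ is the TASEP with $\tilde x_n(0)=x^f_n$ without wall; $(x(t))$ is the TASEP with step initial condition $x_n(0)=-(n-1)$, $n\in\mathbb{N}$, without wall. $Y_T\simeq aT$ means $Y_T/T\to a$ in probability as $T\to\infty$. Non-integer labels are understood with integer parts. Write $\tilde x_{\beta T}(T)\simeq g_\beta T$ and $x^f_{\beta T}(T)\simeq\xi_\beta T$ for the macroscopic scalings. Wall Assumption for $(\alpha,\xi)$: $n\in\mathbb{N}_0$ and $\alpha_0<\dots<\alpha_n$ lie in $(\alpha,1]$, and: (a) For some fixed $\varepsilon\in(0,\alpha_0-\alpha)$ and all $t\in[0,T]$ with $|t-\alpha_iT|>\varepsilon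 T$ for $i=0,\dots,n$, one has $f(T-t)\ge f_0((T-t)/T)T+K(\varepsilon)T$ (for all large $T$), where $K(\varepsilon)>0$ is a constant independent of $t$ and $T$, and $f_0(\beta)=\xi-\sqrt{1-\beta}(\sqrt{1-\beta}-2\sqrt\alpha)$ for $\beta\in[0,1-\alpha)$, $f_0(\beta)=\xi+\alpha$ for $\beta\in[1-\alpha,1]$. (b) For $i\in\{0,\dots,n\}$ let $c_1^i=\alpha^{-1/6}\alpha_i^{1/6}(\sqrt{\alpha_i}-\sqrt\alpha)^{2/3}$, $c_2^i=2\alpha^{-1/3}\alpha_i^{5/6}(\sqrt{\alpha_i}-\sqrt\alpha)^{1/3}$ and $\mu^i(\tau,T)=\sqrt{\alpha_i}(\sqrt{\alpha_i}-2\sqrt\alpha)T-2\tau\alpha^{-1/3}\alpha_i^{1/3}(\sqrt{\alpha_i}-\sqrt\alpha)^{4/3}T^{2/3}$. With $T-t=(1-\alpha_i)T+c_2^i\tau T^{2/3}$, define $g_T^i$ by $f(T-t)=\xi T-\mu^i(\tau,T)-c_1^i(\tau^2-g_T^i(\tau))T^{1/3}$, $\tau\in\mathbb{R}$. For each $i$, $g_T^i$ converges as $T\to\infty$, uniformly on compact sets, to a piecewise continuous càdlàg function $g_i$, and there is a constant $M\in\mathbb{R}$ such that for all $T$ large enough $g_T^i(\tau)\ge -M+\tfrac12\tau^2$ for $|\tau|\le\varepsilon(c_2^i)^{-1}T^{1/3}$. If $\alpha_n=1$, then $\xi=1-2\sqrt\alpha$ and for $i=n$ (b) is required only for $\tau\ge0$.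 Affected particles: the particle with label $\beta T$ is affected by the wall if $f$ satisfies the Wall Assumption for $(\beta,\xi_\beta)$ for some choice of parameters; it is not affected if the wall has no asymptotic influence on it, i.e. $\mathbb{P}(x_{\beta T}(t)>\xi_\beta T-f(T-t)-ST^{1/3}\ \forall t\in[0,T])\to1$ for all $S\in\mathbb{R}$ and $\xi_\beta=g_\beta$. Standing assumption: each particle with label $\beta T$ ($\beta$ near $\alpha$) is either affected or not affected in this sense, and $\xi_\beta$ exists. $x^f_{\alpha T}(T)$ is in the interior of the region affected by the wall if the particles with label $\beta T$ are affected for all $\beta\ge\alpha$ sufficiently close to $\alpha$. Asymptotic densities at $\xi$ (where $x^f_{\alpha T}(T)\simeq\xi T$): $$\rho^f_r(\xi)=\liminf_{\eta\downarrow0}\lim_{T\to\infty}\frac{\eta T}{x^f_{(\alpha-\eta)T}(T)-x^f_{\alpha T}(T)},\qquad\rho^f_l(\xi)=\limsup_{\eta\downarrow0}\lim_{T\to\infty}\frac{\eta T}{x^f_{\alpha T}(T)-x^f_{(\alpha+\eta)T}(T)},$$ where the limits in $T$ are limits in probability, which are constants. *)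

theory Defs
  imports "HOL-Probability.Probability"
begin

subsection \<open>Convergence in probability\<close>

definition tendsto_in_prob :: "'w measure \<Rightarrow> (real \<Rightarrow> 'w \<Rightarrow> real) \<Rightarrow> real \<Rightarrow> bool" where
  "tendsto_in_prob M Y c \<longleftrightarrow>
     (\<forall>e>0. ((\<lambda>T. measure M {\<omega> \<in> space M. \<bar>Y T \<omega> - c\<bar> > e}) \<longlongrightarrow> 0) at_top)"

definition lim_in_prob :: "'w measure \<Rightarrow> (real \<Rightarrow> 'w \<Rightarrow> real) \<Rightarrow> real" where
  "lim_in_prob M Y = (THE c. tendsto_in_prob M Y c)"

definition scales_like :: "'w measure \<Rightarrow> (real \<Rightarrow> 'w \<Rightarrow> real) \<Rightarrow> real \<Rightarrow> bool" where
  "scales_like M Y a \<longleftrightarrow> tendsto_in_prob M (\<lambda>T \<omega>. Y T \<omega> / T) a"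

subsection \<open>TASEP with a wall\<close>

text \<open>
  \<open>W n j\<close> is the waiting time before the \<open>j\<close>-th ring (counted from \<open>0\<close>) of the clock of the
  particle with label \<open>n \<ge> 1\<close>. As usual for Poisson point processes, a realisation is a locally
  finite set of times for every outcome, not only for almost every one.
\<close>

definition poisson_clocks :: "'w measure \<Rightarrow> (nat \<Rightarrow> nat \<Rightarrow> 'w \<Rightarrow> real) \<Rightarrow> bool" where
  "poisson_clocks M W \<longleftrightarrow>
     prob_space M \<and>
     prob_space.indep_vars M (\<lambda>_. borel) (\<lambda>(n, j). W n j) ({1..} \<times> UNIV) \<and>
     (\<forall>n\<ge>1. \<forall>j. distributed M lborel (W n j) (\<lambda>s. ennreal (exponential_density 1 s))) \<and>
     (\<forall>\<omega>\<in>space M. \<forall>n\<ge>1. (\<forall>j. W n j \<omega> > 0) \<and>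
        filterlim (\<lambda>k. \<Sum>j\<le>k. W n j \<omega>) at_top sequentially)"

definition ring_time :: "(nat \<Rightarrow> nat \<Rightarrow> 'w \<Rightarrow> real) \<Rightarrow> 'w \<Rightarrow> nat \<Rightarrow> nat \<Rightarrow> real" where
  "ring_time W \<omega> n k = (\<Sum>j\<le>k. W n j \<omega>)"

text \<open>
  Position of a particle started at \<open>y\<close> after the first \<open>k\<close> rings of its clock, which rings at the
  times \<open>\<sigma> 0 < \<sigma> 1 < \<dots>\<close>; \<open>ok s z\<close> says that a jump to \<open>z\<close> at time \<open>s\<close> is not suppressed.
\<close>

primrec after_rings :: "(nat \<Rightarrow> real) \<Rightarrow> (real \<Rightarrow> int \<Rightarrow> bool) \<Rightarrow> int \<Rightarrow> nat \<Rightarrow> int" where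
  "after_rings \<sigma> ok y 0 = y"
| "after_rings \<sigma> ok y (Suc k) =
     (if ok (\<sigma> k) (after_rings \<sigma> ok y k + 1) then after_rings \<sigma> ok y k + 1
      else after_rings \<sigma> ok y k)"

text \<open>
  \<open>tasep \<sigma> w x0 n t\<close> is the position at time \<open>t\<close> of the particle with label \<open>n\<close>. Particles are
  labelled \<open>1, 2, \<dots>\<close> from right to left, so the trajectory of a particle depends only on its own
  clock, on the wall \<open>w\<close> (\<open>\<infinity>\<close> when there is none) and on the trajectory of the particle with the
  preceding label; label \<open>0\<close> carries a dummy value that blocks nobody. Almost surely no two clocks
  ring simultaneously, so it is immaterial that the position of the preceding particle is read off
  at, rather than just before, the ring.
\<close>

primrec tasep :: "(nat \<Rightarrow> nat \<Rightarrow> real) \<Rightarrow> (real \<Rightarrow> ereal) \<Rightarrow> (nat \<Rightarrow> int) \<Rightarrow> nat \<Rightarrow> real \<Rightarrow> int" where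
  "tasep \<sigma> w x0 0 = (\<lambda>t. 0)"
| "tasep \<sigma> w x0 (Suc n) =
     (\<lambda>t. after_rings (\<sigma> (Suc n))
        (\<lambda>s z. (n = 0 \<or> z < tasep \<sigma> w x0 n s) \<and> ereal (real_of_int z) \<le> w s)
        (x0 (Suc n)) (card {k. \<sigma> (Suc n) k \<le> t}))"

definition position ::
  "(nat \<Rightarrow> nat \<Rightarrow> 'w \<Rightarrow> real) \<Rightarrow> (real \<Rightarrow> ereal) \<Rightarrow> (nat \<Rightarrow> int) \<Rightarrow> nat \<Rightarrow> real \<Rightarrow> 'w \<Rightarrow> real" where
  "position W w x0 n t \<omega> = real_of_int (tasep (ring_time W \<omega>) w x0 n t)"

definition no_wall :: "real \<Rightarrow> ereal" where
  "no_wall = (\<lambda>_. \<infinity>)"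

definition step_initial :: "nat \<Rightarrow> int" where
  "step_initial n = - (int n - 1)"

definition label :: "real \<Rightarrow> real \<Rightarrow> nat" where
  "label \<beta> T = nat \<lfloor>\<beta> * T\<rfloor>"

text \<open>
  The wall may depend on the observation time: \<open>f T\<close> is the wall used when observing at time \<open>T\<close>.
  \<open>wall_position\<close> gives the position at the observation time.
\<close>

definition wall_position ::
  "(nat \<Rightarrow> nat \<Rightarrow> 'w \<Rightarrow> real) \<Rightarrow> (real \<Rightarrow> real \<Rightarrow> real) \<Rightarrow> (nat \<Rightarrow> int) \<Rightarrow> real \<Rightarrow> real \<Rightarrow> 'w \<Rightarrow> real" where
  "wall_position W f x0 \<beta> T = position W (\<lambda>t. ereal (f T t)) x0 (label \<beta> T) T"

definition free_position ::
  "(nat \<Rightarrow> nat \<Rightarrow> 'w \<Rightarrow> real) \<Rightarrow> (nat \<Rightarrow> int) \<Rightarrow> real \<Rightarrow> real \<Rightarrow> 'w \<Rightarrow> real" where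
  "free_position W x0 \<beta> T = position W no_wall x0 (label \<beta> T) T"

definition admissible_initial :: "(nat \<Rightarrow> int) \<Rightarrow> bool" where
  "admissible_initial x0 \<longleftrightarrow>
     strict_antimono_on {1..} x0 \<and> x0 1 \<le> 0 \<and>
     (\<exists>d0::real. \<exists>C0::real. d0 \<ge> 1 \<and> (\<forall>n\<ge>1. real_of_int (x0 n) \<ge> - d0 * real n - C0))"

subsection \<open>The wall and the Wall Assumption\<close>

text \<open>At an endpoint of \<open>S\<close> the one-sided filter is trivial and the corresponding condition void.\<close>

definition cadlag_on :: "real set \<Rightarrow> (real \<Rightarrow> real) \<Rightarrow> bool" where
  "cadlag_on S g \<longleftrightarrow>
     (\<forall>t\<in>S. (g \<longlongrightarrow> g t) (at t within (S \<inter> {t<..})) \<and>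
            (\<exists>l. (g \<longlongrightarrow> l) (at t within (S \<inter> {..<t}))))"

definition piecewise_continuous_on_reals :: "real set \<Rightarrow> (real \<Rightarrow> real) \<Rightarrow> bool" where
  "piecewise_continuous_on_reals S g \<longleftrightarrow>
     (\<forall>a b. finite {t \<in> S \<inter> {a..b}. \<not> continuous (at t within S) g})"

definition is_wall :: "(real \<Rightarrow> real) \<Rightarrow> bool" where
  "is_wall f \<longleftrightarrow> (\<forall>t\<ge>0. f t \<ge> 0) \<and> mono_on {0..} f \<and> cadlag_on {0..} f \<and> f 0 = 0"

definition f0 :: "real \<Rightarrow> real \<Rightarrow> real \<Rightarrow> real" where
  "f0 \<alpha> \<xi> \<beta> =
     (if \<beta> < 1 - \<alpha> then \<xi> - sqrt (1 - \<beta>) * (sqrt (1 - \<beta>) - 2 * sqrt \<alpha>) else \<xi> + \<alpha>)"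

definition c1 :: "real \<Rightarrow> real \<Rightarrow> real" where
  "c1 \<alpha> a = \<alpha> powr (- 1/6) * a powr (1/6) * (sqrt a - sqrt \<alpha>) powr (2/3)"

definition c2 :: "real \<Rightarrow> real \<Rightarrow> real" where
  "c2 \<alpha> a = 2 * \<alpha> powr (- 1/3) * a powr (5/6) * (sqrt a - sqrt \<alpha>) powr (1/3)"

definition mu :: "real \<Rightarrow> real \<Rightarrow> real \<Rightarrow> real \<Rightarrow> real" where
  "mu \<alpha> a \<tau> T =
     sqrt a * (sqrt a - 2 * sqrt \<alpha>) * T
     - 2 * \<tau> * \<alpha> powr (- 1/3) * a powr (1/3) * (sqrt a - sqrt \<alpha>) powr (4/3) * T powr (2/3)"

text \<open>The time \<open>T - t\<close> at which the wall is inspected, as a function of \<open>\<tau>\<close>.\<close>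

definition wall_time :: "real \<Rightarrow> real \<Rightarrow> real \<Rightarrow> real \<Rightarrow> real" where
  "wall_time \<alpha> a \<tau> T = (1 - a) * T + c2 \<alpha> a * \<tau> * T powr (2/3)"

text \<open>The function \<open>g\<^sub>T\<close>, obtained by solving its defining equation (next lemma).\<close>

definition g_resc :: "(real \<Rightarrow> real \<Rightarrow> real) \<Rightarrow> real \<Rightarrow> real \<Rightarrow> real \<Rightarrow> real \<Rightarrow> real \<Rightarrow> real" where
  "g_resc f \<alpha> \<xi> a T \<tau> =
     \<tau>\<^sup>2 + (f T (wall_time \<alpha> a \<tau> T) - \<xi> * T + mu \<alpha> a \<tau> T) / (c1 \<alpha> a * T powr (1/3))"

lemma g_resc_iff:
  assumes "0 < \<alpha>" "\<alpha> < a" "0 < T"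
  shows "f T (wall_time \<alpha> a \<tau> T) = \<xi> * T - mu \<alpha> a \<tau> T - c1 \<alpha> a * (\<tau>\<^sup>2 - g) * T powr (1/3)
         \<longleftrightarrow> g = g_resc f \<alpha> \<xi> a T \<tau>"
proof -
  have "c1 \<alpha> a > 0" using assms by (simp add: c1_def)
  moreover have "T powr (1/3) > 0" using assms by simp
  ultimately have "c1 \<alpha> a * T powr (1/3) \<noteq> 0" by simp
  then show ?thesis unfolding g_resc_def by (auto simp: field_simps)
qed

text \<open>
  The range of \<open>\<tau>\<close> is \<open>D\<close> below. Since \<open>f\<close> is a function on the nonnegative reals, the lower bound
  on \<open>g\<^sub>T\<close> is only asked for those \<open>\<tau>\<close> at which the wall is inspected at a nonnegative time. On a
  compact subset of \<open>D\<close> this is automatic for large \<open>T\<close>.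
\<close>

definition wall_assumption ::
  "(real \<Rightarrow> real \<Rightarrow> real) \<Rightarrow> real \<Rightarrow> real \<Rightarrow> nat \<Rightarrow> (nat \<Rightarrow> real) \<Rightarrow> real \<Rightarrow> bool" where
  "wall_assumption f \<alpha> \<xi> n a \<epsilon> \<longleftrightarrow>
     strict_mono_on {..n} a \<and> (\<forall>i\<le>n. \<alpha> < a i \<and> a i \<le> 1) \<and>
     0 < \<epsilon> \<and> \<epsilon> < a 0 - \<alpha> \<and>
     (\<exists>K>0. \<forall>\<^sub>F T in at_top. \<forall>t\<in>{0..T}. (\<forall>i\<le>n. \<bar>t - a i * T\<bar> > \<epsilon> * T) \<longrightarrow>
        f T (T - t) \<ge> f0 \<alpha> \<xi> ((T - t) / T) * T + K * T) \<and>
     (\<forall>i\<le>n. let D = (if i = n \<and> a n = 1 then {0..} else UNIV) in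
        (\<exists>g. piecewise_continuous_on_reals D g \<and> cadlag_on D g \<and>
             (\<forall>C. compact C \<and> C \<subseteq> D \<longrightarrow>
                uniform_limit C (\<lambda>T. g_resc f \<alpha> \<xi> (a i) T) g at_top)) \<and>
        (\<exists>B. \<forall>\<^sub>F T in at_top. \<forall>\<tau>\<in>D.
           \<bar>\<tau>\<bar> \<le> \<epsilon> * inverse (c2 \<alpha> (a i)) * T powr (1/3) \<and> wall_time \<alpha> (a i) \<tau> T \<ge> 0 \<longrightarrow>
           g_resc f \<alpha> \<xi> (a i) T \<tau> \<ge> - B + \<tau>\<^sup>2 / 2)) \<and>
     (a n = 1 \<longrightarrow> \<xi> = 1 - 2 * sqrt \<alpha>)"

subsection \<open>Affected particles\<close>

definition affected :: "(real \<Rightarrow> real \<Rightarrow> real) \<Rightarrow> real \<Rightarrow> real \<Rightarrow> bool" where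
  "affected f \<beta> \<xi> \<longleftrightarrow> (\<exists>n a \<epsilon>. wall_assumption f \<beta> \<xi> n a \<epsilon>)"

definition not_affected ::
  "'w measure \<Rightarrow> (nat \<Rightarrow> nat \<Rightarrow> 'w \<Rightarrow> real) \<Rightarrow> (real \<Rightarrow> real \<Rightarrow> real) \<Rightarrow> (nat \<Rightarrow> int) \<Rightarrow> real \<Rightarrow> real \<Rightarrow> bool" where
  "not_affected M W f x0 \<beta> \<xi> \<longleftrightarrow>
     (\<forall>S::real. ((\<lambda>T. measure M {\<omega> \<in> space M. \<forall>t\<in>{0..T}.
          position W no_wall step_initial (label \<beta> T) t \<omega> > \<xi> * T - f T (T - t) - S * T powr (1/3)})
        \<longlongrightarrow> 1) at_top) \<and>
     (\<exists>g. scales_like M (free_position W x0 \<beta>) g \<and> \<xi> = g)"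

definition interior_affected :: "(real \<Rightarrow> real \<Rightarrow> real) \<Rightarrow> (real \<Rightarrow> real) \<Rightarrow> real \<Rightarrow> bool" where
  "interior_affected f xi \<alpha> \<longleftrightarrow> (\<exists>\<delta>>0. \<forall>\<beta>. \<alpha> \<le> \<beta> \<and> \<beta> < \<alpha> + \<delta> \<longrightarrow> affected f \<beta> (xi \<beta>))"

subsection \<open>Asymptotic densities\<close>

definition ratio_r ::
  "(nat \<Rightarrow> nat \<Rightarrow> 'w \<Rightarrow> real) \<Rightarrow> (real \<Rightarrow> real \<Rightarrow> real) \<Rightarrow> (nat \<Rightarrow> int) \<Rightarrow> real \<Rightarrow> real \<Rightarrow> real \<Rightarrow> 'w \<Rightarrow> real" where
  "ratio_r W f x0 \<alpha> \<eta> T \<omega> =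
     \<eta> * T / (wall_position W f x0 (\<alpha> - \<eta>) T \<omega> - wall_position W f x0 \<alpha> T \<omega>)"

definition ratio_l ::
  "(nat \<Rightarrow> nat \<Rightarrow> 'w \<Rightarrow> real) \<Rightarrow> (real \<Rightarrow> real \<Rightarrow> real) \<Rightarrow> (nat \<Rightarrow> int) \<Rightarrow> real \<Rightarrow> real \<Rightarrow> real \<Rightarrow> 'w \<Rightarrow> real" where
  "ratio_l W f x0 \<alpha> \<eta> T \<omega> =
     \<eta> * T / (wall_position W f x0 \<alpha> T \<omega> - wall_position W f x0 (\<alpha> + \<eta>) T \<omega>)"

definition rho_r ::
  "'w measure \<Rightarrow> (nat \<Rightarrow> nat \<Rightarrow> 'w \<Rightarrow> real) \<Rightarrow> (real \<Rightarrow> real \<Rightarrow> real) \<Rightarrow> (nat \<Rightarrow> int) \<Rightarrow> real \<Rightarrow> ereal" where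
  "rho_r M W f x0 \<alpha> = Liminf (at_right 0) (\<lambda>\<eta>. ereal (lim_in_prob M (ratio_r W f x0 \<alpha> \<eta>)))"

definition rho_l ::
  "'w measure \<Rightarrow> (nat \<Rightarrow> nat \<Rightarrow> 'w \<Rightarrow> real) \<Rightarrow> (real \<Rightarrow> real \<Rightarrow> real) \<Rightarrow> (nat \<Rightarrow> int) \<Rightarrow> real \<Rightarrow> ereal" where
  "rho_l M W f x0 \<alpha> = Limsup (at_right 0) (\<lambda>\<eta>. ereal (lim_in_prob M (ratio_l W f x0 \<alpha> \<eta>)))"

end

theory Submission
  imports Defs "HOL-Real_Asymp.Real_Asymp"
begin

text \<open>
  Write \<open>h(\<beta>, a) = a - 2 * sqrt (a * \<beta>)\<close> for the macroscopic position, at time \<open>a * T\<close>, of the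
  particle with label \<open>\<beta> * T\<close> under the step initial condition. If a particle \<open>\<beta>\<close> is affected, the Wall
  Assumption says that \<open>\<xi>\<^sub>\<beta> \<le> F(b) + h(\<beta>, b)\<close> for every macroscopic wall value \<open>F(b)\<close>, with equality at its
  own contact times and a quadratic gain away from them. Comparing these relations for \<open>\<alpha>\<close> and for a
  nearby \<open>\<beta>\<close> locates the contact times of \<open>\<beta>\<close> within \<open>O(sqrt \<bar>\<alpha> - \<beta>\<bar>)\<close> of those of \<open>\<alpha>\<close> and yields
  \<open>\<xi>\<^sub>\<beta> - \<xi> \<approx> 2 * sqrt a * (sqrt \<alpha> - sqrt \<beta>)\<close> with \<open>a\<close> the smallest (\<open>\<beta> < \<alpha>\<close>) or largest (\<open>\<beta> > \<alpha>\<close>) of them.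

  For a particle that is not affected, the inequality follows from the law of large numbers for the
  step initial condition. In the other direction, for \<open>\<beta> < \<alpha>\<close>, the gaps between free particles dominate
  the gaps in the process started from the step initial condition, by attractiveness of the
  zero-range process of gaps, and \<open>a \<le> 1\<close>.

  The law of large numbers is proved by last passage percolation: by the memoryless property the jump
  times are passage times with independent exponential weights, Burke's theorem gives stationary
  percolation models with explicit limits, and the model without boundary is compared with these.
\<close>

subsection \<open>Particle trajectories\<close>

text \<open>The wall changes with T, and f(T, (1 - b) T) / T need not converge for a general time b.
  It does converge when b is a contact time, because the rescaled wall converges at \<tau> = 0.
  Hence two affected particles are always compared at a contact time of one of them: its own Wall
  Assumption gives the value of the wall, that of the other particle a lower bound. Contact times of
  \<alpha> bound \<xi>_\<beta> - \<xi> from above, those of \<beta> bound it from below. The error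
  of order sqrt |\<alpha> - \<beta>| in the location of contact times is much larger than |\<alpha>
  - \<beta>|, but it enters only in the factor sqrt a of sqrt \<alpha> - sqrt \<beta>, so it
  disappears in the limit of the difference quotient. Gap domination bounds gaps from below only.
  This suits an unaffected \<beta> < \<alpha>, but gives nothing for \<beta> > \<alpha>, where an
  upper bound on the gap would be required; therefore the left density is in general only bounded,
  and being in the interior of the affected region enters there.\<close>

definition clock_times :: "(nat \<Rightarrow> real) \<Rightarrow> bool" where
  "clock_times \<sigma> \<longleftrightarrow> strict_mono \<sigma> \<and> \<sigma> 0 > 0 \<and> filterlim \<sigma> at_top sequentially"

lemma clock_times_le_iff: "clock_times \<sigma> \<Longrightarrow> \<sigma> i \<le> \<sigma> j \<longleftrightarrow> i \<le> j"
  by (simp add: clock_times_def strict_mono_less_eq)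

lemma clock_times_pos: "clock_times \<sigma> \<Longrightarrow> \<sigma> k > 0"
  using clock_times_le_iff[of \<sigma> 0 k] by (auto simp: clock_times_def)

text \<open>Divergence of the ring times makes the set finite and an initial segment of the
  naturals. Without it \<open>card\<close> in \<open>tasep\<close> would return its default 0 on an
  infinite set.\<close>

lemma clock_times_rings_eq:
  assumes "clock_times \<sigma>"
  shows "{k. \<sigma> k \<le> t} = {..<card {k. \<sigma> k \<le> t}}"
proof -
  have "eventually (\<lambda>k. \<sigma> k \<ge> t + 1) sequentially"
    using assms by (auto simp: clock_times_def filterlim_at_top)
  then obtain K where K: "\<sigma> K > t"
    by (metis eventually_sequentially le_refl less_add_one order_less_le_trans)
  define L where "L = (LEAST k. \<sigma> k > t)"
  have "\<sigma> L > t" unfolding L_def by (rule LeastI[of _ K]) (rule K)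
  moreover have "\<sigma> k \<le> t" if "k < L" for k
    using not_less_Least[of k "\<lambda>k. \<sigma> k > t"] that by (auto simp: L_def)
  ultimately have "{k. \<sigma> k \<le> t} = {..<L}"
    using clock_times_le_iff[OF assms]
    by auto (meson linorder_not_le order_trans)
  then show ?thesis by simp
qed

lemma less_card_rings_iff:
  assumes "clock_times \<sigma>"
  shows "k < card {k. \<sigma> k \<le> t} \<longleftrightarrow> \<sigma> k \<le> t"
  using clock_times_rings_eq[OF assms, of t] by blast

lemma card_rings_at_ring:
  assumes "clock_times \<sigma>"
  shows "card {j. \<sigma> j \<le> \<sigma> k} = Suc k"
  by (simp add: clock_times_le_iff[OF assms] flip: atMost_def)

lemma card_rings_nonpos:
  assumes "clock_times \<sigma>" "t \<le> 0"
  shows "card {k. \<sigma> k \<le> t} = 0"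
proof -
  have "\<not> \<sigma> k \<le> t" for k using clock_times_pos[OF assms(1), of k] assms(2) by linarith
  then have "{k. \<sigma> k \<le> t} = {}" by blast
  then show ?thesis by simp
qed

lemma card_rings_mono:
  assumes "clock_times \<sigma>" "t \<le> t'"
  shows "card {k. \<sigma> k \<le> t} \<le> card {k. \<sigma> k \<le> t'}"
  by (rule card_mono, subst clock_times_rings_eq[OF assms(1)], simp) (use assms(2) in auto)

lemma after_rings_mono: "k \<le> k' \<Longrightarrow> after_rings \<sigma> ok y k \<le> after_rings \<sigma> ok y k'"
  by (induction k' rule: dec_induct) auto

lemma tasep_mono:
  assumes "\<forall>n\<ge>1. clock_times (\<sigma> n)" "t \<le> t'"
  shows "tasep \<sigma> w y n t \<le> tasep \<sigma> w y n t'"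
  using assms by (cases n) (auto intro!: after_rings_mono card_rings_mono)

lemma tasep_nonpos_time:
  assumes "\<forall>n\<ge>1. clock_times (\<sigma> n)" "t \<le> 0" "n \<ge> 1"
  shows "tasep \<sigma> w y n t = y n"
  using assms by (cases n) (auto simp: card_rings_nonpos simp del: card_eq_0_iff card_0_eq)

text \<open>Induction over labels, then over rings. A walled particle could overtake its free copy
  only by jumping from the same site; there the free one is not blocked either, since its
  predecessor is at least as far ahead.\<close>

lemma tasep_wall_le_free:
  assumes \<sigma>: "\<forall>n\<ge>1. clock_times (\<sigma> n)"
  shows "tasep \<sigma> w y n t \<le> tasep \<sigma> no_wall y n t"
proof (induction n arbitrary: t)
  case (Suc n)
  define ok where "ok = (\<lambda>w s z. (n = 0 \<or> z < tasep \<sigma> w y n s) \<and> ereal (real_of_int z) \<le> w s)"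
  have "after_rings (\<sigma> (Suc n)) (ok w) (y (Suc n)) k \<le> after_rings (\<sigma> (Suc n)) (ok no_wall) (y (Suc n)) k" for k
  proof (induction k)
    case (Suc k)
    then show ?case using Suc.IH \<open>\<And>t. tasep \<sigma> w y n t \<le> tasep \<sigma> no_wall y n t\<close>[of "\<sigma> (Suc n) k"]
      by (auto simp: ok_def no_wall_def)
  qed simp
  then show ?case by (simp add: ok_def)
qed simp

text \<open>
  Attractiveness of the zero-range process of gaps: with the same clocks, wider initial gaps stay
  wider. The difference of two free particles with the same label can only decrease at a ring at
  which the particle of the wider system is blocked and the other one is not, which the comparison
  with the preceding label excludes; so the two claims below are proved together.
\<close>

lemma tasep_free_gap_mono_aux:
  fixes x s :: "nat \<Rightarrow> real \<Rightarrow> int"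
  assumes \<sigma>: "\<forall>n\<ge>1. clock_times (\<sigma> n)"
    and init: "\<And>n. n \<ge> 1 \<Longrightarrow> y n - y (Suc n) \<ge> z n - z (Suc n)"
  defines "x \<equiv> tasep \<sigma> no_wall y" and "s \<equiv> tasep \<sigma> no_wall z"
  shows "(\<forall>t t'. t \<le> t' \<longrightarrow> x (Suc n) t - s (Suc n) t \<le> x (Suc n) t' - s (Suc n) t')
       \<and> (n \<ge> 1 \<longrightarrow> (\<forall>t. x (Suc n) t - s (Suc n) t \<le> x n t - s n t))"
proof (induction n)
  case 0
  have *: "after_rings \<sigma>' (\<lambda>s z. True) a k = a + int k" for \<sigma>' a k by (induction k) auto
  show ?case by (simp add: x_def s_def no_wall_def *)
next
  case (Suc n)
  define m where "m = Suc n"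
  have mono: "x m t - s m t \<le> x m t' - s m t'" if "t \<le> t'" for t t'
    using Suc that by (auto simp: m_def)
  define \<tau> where "\<tau> = \<sigma> (Suc m)"
  have \<tau>: "clock_times \<tau>" using \<sigma> by (simp add: \<tau>_def)
  define X where "X = after_rings \<tau> (\<lambda>u v. v < x m u) (y (Suc m))"
  define S where "S = after_rings \<tau> (\<lambda>u v. v < s m u) (z (Suc m))"
  have X: "x (Suc m) t = X (card {k. \<tau> k \<le> t})" for t
    by (simp add: x_def X_def \<tau>_def m_def no_wall_def del: card_eq_0_iff)
  have S: "s (Suc m) t = S (card {k. \<tau> k \<le> t})" for t
    by (simp add: s_def S_def \<tau>_def m_def no_wall_def)
  have le: "X k - S k \<le> x m t - s m t" if "k \<le> card {k. \<tau> k \<le> t}" for k t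
    using that
  proof (induction k)
    case 0
    \<comment> \<open>At the time \<open>min t 0\<close> nothing has moved yet; taking it instead of
      0 covers negative t.\<close>
    have "y m - z m = x m (min t 0) - s m (min t 0)"
      unfolding x_def s_def using tasep_nonpos_time[OF \<sigma>, of "min t 0" m] by (simp add: m_def del: tasep.simps)
    also have "\<dots> \<le> x m t - s m t" by (rule mono) simp
    finally show ?case using init[of m] by (simp add: X_def S_def m_def)
  next
    case (Suc k)
    have "\<tau> k \<le> t" using less_card_rings_iff[OF \<tau>] Suc.prems by (metis Suc_le_lessD)
    then have "x m (\<tau> k) - s m (\<tau> k) \<le> x m t - s m t" by (rule mono)
    with Suc show ?case by (auto simp: X_def S_def)
  qed
  \<comment> \<open>Only a ring that moves S but not X could lower the difference. Then S k + 1 < s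
    m and X k + 1 >= x m at the ring time, which contradicts \<open>le\<close> there.\<close>
  have inc: "X k - S k \<le> X (Suc k) - S (Suc k)" for k
    using le[of k "\<tau> k"] by (auto simp: card_rings_at_ring[OF \<tau>] X_def S_def)
  have inc': "X k - S k \<le> X k' - S k'" if "k \<le> k'" for k k'
    using lift_Suc_mono_le[of "\<lambda>k. X k - S k"] inc that by blast
  have "x (Suc m) t - s (Suc m) t \<le> x (Suc m) t' - s (Suc m) t'" if "t \<le> t'" for t t'
    unfolding X S by (intro inc' card_rings_mono \<tau> that)
  moreover have "x (Suc m) t - s (Suc m) t \<le> x m t - s m t" for t
    unfolding X S by (rule le) simp
  ultimately show ?case by (simp add: m_def)
qed

lemma tasep_free_gap_mono:
  assumes \<sigma>: "\<forall>n\<ge>1. clock_times (\<sigma> n)"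
    and init: "\<And>n. n \<ge> 1 \<Longrightarrow> y n - y (Suc n) \<ge> z n - z (Suc n)"
    and n: "1 \<le> n" "n \<le> n'"
  shows "tasep \<sigma> no_wall z n t - tasep \<sigma> no_wall z n' t \<le> tasep \<sigma> no_wall y n t - tasep \<sigma> no_wall y n' t"
  using n(2)
proof (induction n' rule: dec_induct)
  case (step k)
  then show ?case using tasep_free_gap_mono_aux[where \<sigma>=\<sigma> and y=y and z=z and n=k, OF \<sigma>] init n(1) by (smt (verit) order_trans)
qed simp

subsection \<open>Events of large probability\<close>

text \<open>Events are not assumed measurable; what counts is a measurable part of large probability.\<close>

definition whp :: "'a measure \<Rightarrow> (real \<Rightarrow> 'a \<Rightarrow> bool) \<Rightarrow> bool" where
  "whp M A \<longleftrightarrow> (\<exists>E. (\<forall>T. E T \<in> sets M \<and> E T \<subseteq> {\<omega> \<in> space M. A T \<omega>}) \<and>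
     ((\<lambda>T. measure M (E T)) \<longlongrightarrow> 1) at_top)"

lemma whp_mono:
  assumes "whp M A" "\<forall>\<^sub>F T in at_top. \<forall>\<omega>\<in>space M. A T \<omega> \<longrightarrow> B T \<omega>"
  shows "whp M B"
proof -
  obtain E where E: "\<And>T. E T \<in> sets M" "\<And>T. E T \<subseteq> {\<omega> \<in> space M. A T \<omega>}"
    "((\<lambda>T. measure M (E T)) \<longlongrightarrow> 1) at_top"
    using assms(1) by (auto simp: whp_def)
  \<comment> \<open>The implication may fail for small T; there the measurable part is replaced by
    the empty set, which does not affect the limit.\<close>
  let ?E = "\<lambda>T. if \<forall>\<omega>\<in>space M. A T \<omega> \<longrightarrow> B T \<omega> then E T else {}"
  have "((\<lambda>T. measure M (?E T)) \<longlongrightarrow> 1) at_top"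
  proof (rule Lim_transform_eventually[OF E(3)])
    show "\<forall>\<^sub>F T in at_top. measure M (E T) = measure M (?E T)"
      using assms(2) by eventually_elim simp
  qed
  moreover have "?E T \<in> sets M \<and> ?E T \<subseteq> {\<omega> \<in> space M. B T \<omega>}" for T
    using E(1)[of T] E(2)[of T] by auto
  ultimately show ?thesis by (auto simp: whp_def intro!: exI[of _ ?E])
qed

lemma whp_monoI:
  assumes "whp M A" "\<And>T \<omega>. T > c \<Longrightarrow> \<omega> \<in> space M \<Longrightarrow> A T \<omega> \<Longrightarrow> B T \<omega>"
  shows "whp M B"
  using assms(1)
proof (rule whp_mono)
  show "\<forall>\<^sub>F T in at_top. \<forall>\<omega>\<in>space M. A T \<omega> \<longrightarrow> B T \<omega>"
    using eventually_gt_at_top[of c] by eventually_elim (use assms(2) in blast)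
qed

lemma (in prob_space) whp_conj:
  assumes "whp M A" "whp M B"
  shows "whp M (\<lambda>T \<omega>. A T \<omega> \<and> B T \<omega>)"
proof -
  obtain E where E: "\<And>T. E T \<in> sets M" "\<And>T. E T \<subseteq> {\<omega> \<in> space M. A T \<omega>}"
    "((\<lambda>T. measure M (E T)) \<longlongrightarrow> 1) at_top"
    using assms(1) by (auto simp: whp_def)
  obtain F where F: "\<And>T. F T \<in> sets M" "\<And>T. F T \<subseteq> {\<omega> \<in> space M. B T \<omega>}"
    "((\<lambda>T. measure M (F T)) \<longlongrightarrow> 1) at_top"
    using assms(2) by (auto simp: whp_def)
  have "prob (E T) + prob (F T) - 1 \<le> prob (E T \<inter> F T)" for T
  proof -
    have "prob (F T - E T) \<le> prob (space M - E T)"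
      using E(1)[of T] sets.sets_into_space[OF F(1)[of T]] by (intro finite_measure_mono) auto
    then show ?thesis
      using finite_measure_Diff'[OF F(1)[of T] E(1)[of T]] prob_compl[OF E(1)[of T]] by (simp add: Int_commute)
  qed
  note le = this
  have "((\<lambda>T. prob (E T \<inter> F T)) \<longlongrightarrow> 1) at_top"
  proof (rule tendsto_sandwich)
    show "\<forall>\<^sub>F T in at_top. prob (E T) + prob (F T) - 1 \<le> prob (E T \<inter> F T)"
      by (rule always_eventually) (intro allI le)
    show "\<forall>\<^sub>F T in at_top. prob (E T \<inter> F T) \<le> 1" by (rule always_eventually) simp
    show "((\<lambda>T. prob (E T) + prob (F T) - 1) \<longlongrightarrow> 1) at_top"
      using tendsto_diff[OF tendsto_add[OF E(3) F(3)] tendsto_const[of 1]] by simp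
  qed (rule tendsto_const)
  moreover have "E T \<inter> F T \<in> sets M \<and> E T \<inter> F T \<subseteq> {\<omega> \<in> space M. A T \<omega> \<and> B T \<omega>}" for T
    using E(1,2)[of T] F(1,2)[of T] by auto
  ultimately show ?thesis
    unfolding whp_def by (intro exI[of _ "\<lambda>T. E T \<inter> F T"]) auto
qed

lemma (in prob_space) whp_ex:
  assumes "whp M A"
  shows "\<forall>\<^sub>F T in at_top. \<exists>\<omega>\<in>space M. A T \<omega>"
proof -
  obtain E where E: "\<And>T. E T \<subseteq> {\<omega> \<in> space M. A T \<omega>}" "((\<lambda>T. prob (E T)) \<longlongrightarrow> 1) at_top"
    using assms by (auto simp: whp_def)
  have "\<forall>\<^sub>F T in at_top. prob (E T) > 0" using E(2) by (rule order_tendstoD) simp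
  then show ?thesis
  proof eventually_elim
    case (elim T)
    then have "E T \<noteq> {}" by auto
    then show ?case using E(1)[of T] by blast
  qed
qed

lemma (in prob_space) whp_AE:
  assumes "AE \<omega> in M. P \<omega>"
  shows "whp M (\<lambda>T. P)"
proof -
  obtain N where N: "N \<in> sets M" "emeasure M N = 0" "{\<omega> \<in> space M. \<not> P \<omega>} \<subseteq> N"
    using AE_E[OF assms] by metis
  then have "prob (space M - N) = 1" using prob_compl[OF N(1)] by (simp add: measure_def)
  with N show ?thesis unfolding whp_def by (intro exI[of _ "\<lambda>T. space M - N"]) auto
qed

lemma (in prob_space) whp_complement:
  assumes "\<And>T. {\<omega> \<in> space M. A T \<omega>} \<in> sets M" "((\<lambda>T. prob {\<omega> \<in> space M. A T \<omega>}) \<longlongrightarrow> 0) at_top"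
  shows "whp M (\<lambda>T \<omega>. \<not> A T \<omega>)"
proof -
  have "prob (space M - {\<omega> \<in> space M. A T \<omega>}) = 1 - prob {\<omega> \<in> space M. A T \<omega>}" for T
    by (rule prob_compl) (rule assms)
  then have "((\<lambda>T. prob (space M - {\<omega> \<in> space M. A T \<omega>})) \<longlongrightarrow> 1) at_top"
    using tendsto_diff[OF tendsto_const[of 1] assms(2)] by simp
  then show ?thesis
    unfolding whp_def using assms(1) by (intro exI[of _ "\<lambda>T. space M - {\<omega> \<in> space M. A T \<omega>}"]) auto
qed

text \<open>\<open>measure\<close> is 0 on sets that are not measurable, so a limit 1 already forces
  measurability for large T.\<close>

lemma (in prob_space) whp_tendsto_1:
  assumes "((\<lambda>T. prob {\<omega> \<in> space M. A T \<omega>}) \<longlongrightarrow> 1) at_top"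
  shows "whp M A"
proof -
  let ?E = "\<lambda>T. if {\<omega> \<in> space M. A T \<omega>} \<in> sets M then {\<omega> \<in> space M. A T \<omega>} else {}"
  have "prob (?E T) = prob {\<omega> \<in> space M. A T \<omega>}" for T
    by (auto simp: measure_notin_sets)
  with assms show ?thesis unfolding whp_def by (intro exI[of _ ?E]) auto
qed

lemma (in prob_space) whp_not_tendsto_0:
  assumes "whp M (\<lambda>T \<omega>. \<not> A T \<omega>)"
  shows "((\<lambda>T. prob {\<omega> \<in> space M. A T \<omega>}) \<longlongrightarrow> 0) at_top"
proof -
  obtain E where E: "\<And>T. E T \<in> sets M" "\<And>T. E T \<subseteq> {\<omega> \<in> space M. \<not> A T \<omega>}"
    "((\<lambda>T. prob (E T)) \<longlongrightarrow> 1) at_top"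
    using assms by (auto simp: whp_def)
  have le: "prob {\<omega> \<in> space M. A T \<omega>} \<le> 1 - prob (E T)" for T
  proof (cases "{\<omega> \<in> space M. A T \<omega>} \<in> sets M")
    case True
    have "{\<omega> \<in> space M. A T \<omega>} \<subseteq> space M - E T" using E(2)[of T] by auto
    then have "prob {\<omega> \<in> space M. A T \<omega>} \<le> prob (space M - E T)"
      using E(1)[of T] by (intro finite_measure_mono) auto
    then show ?thesis by (simp add: prob_compl[OF E(1)])
  qed (simp add: measure_notin_sets)
  have "((\<lambda>T. 1 - prob (E T)) \<longlongrightarrow> 0) at_top"
    using tendsto_diff[OF tendsto_const[of 1] E(3)] by simp
  then show ?thesis
  proof (rule tendsto_sandwich[rotated 3])
    show "\<forall>\<^sub>F T in at_top. 0 \<le> prob {\<omega> \<in> space M. A T \<omega>}" by (rule always_eventually) simp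
    show "\<forall>\<^sub>F T in at_top. prob {\<omega> \<in> space M. A T \<omega>} \<le> 1 - prob (E T)"
      by (rule always_eventually) (intro allI le)
  qed (rule tendsto_const)
qed

lemma (in prob_space) tendsto_in_probI:
  assumes "\<And>e. e > 0 \<Longrightarrow> whp M (\<lambda>T \<omega>. \<bar>Y T \<omega> - c\<bar> \<le> e)"
  shows "tendsto_in_prob M Y c"
  unfolding tendsto_in_prob_def
proof (intro allI impI whp_not_tendsto_0)
  fix e :: real assume "e > 0"
  then show "whp M (\<lambda>T \<omega>. \<not> \<bar>Y T \<omega> - c\<bar> > e)" using assms[of e] by (simp add: not_less)
qed

text \<open>Measurability matters in this direction: the event of a large deviation has
  \<open>measure\<close> 0 for free if it is not measurable. It is asked for T > 0 only, because
  walls are controlled only there; hence the replacement of Y by 0 at other T.\<close>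

lemma (in prob_space) tendsto_in_probD:
  assumes "tendsto_in_prob M Y c" "\<And>T. T > 0 \<Longrightarrow> Y T \<in> borel_measurable M" "e > 0"
  shows "whp M (\<lambda>T \<omega>. \<bar>Y T \<omega> - c\<bar> \<le> e)"
proof -
  let ?Y = "\<lambda>T. if T > 0 then Y T else (\<lambda>_. 0)"
  have [measurable]: "?Y T \<in> borel_measurable M" for T using assms(2) by auto
  have "((\<lambda>T. prob {\<omega> \<in> space M. \<bar>Y T \<omega> - c\<bar> > e}) \<longlongrightarrow> 0) at_top"
    using assms by (auto simp: tendsto_in_prob_def)
  then have "((\<lambda>T. prob {\<omega> \<in> space M. \<bar>?Y T \<omega> - c\<bar> > e}) \<longlongrightarrow> 0) at_top"
  proof (rule Lim_transform_eventually)
    show "\<forall>\<^sub>F T in at_top. prob {\<omega> \<in> space M. \<bar>Y T \<omega> - c\<bar> > e} = prob {\<omega> \<in> space M. \<bar>?Y T \<omega> - c\<bar> > e}"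
      using eventually_gt_at_top[of 0] by eventually_elim simp
  qed
  then have "whp M (\<lambda>T \<omega>. \<not> \<bar>?Y T \<omega> - c\<bar> > e)"
    by (intro whp_complement) auto
  then show ?thesis by (rule whp_monoI[where c=0]) auto
qed

lemma (in prob_space) tendsto_in_prob_unique:
  assumes "tendsto_in_prob M Y c" "tendsto_in_prob M Y d" "\<And>T. T > 0 \<Longrightarrow> Y T \<in> borel_measurable M"
  shows "c = d"
proof (rule ccontr)
  assume "c \<noteq> d"
  then have e: "\<bar>c - d\<bar> / 3 > 0" by simp
  have "\<forall>\<^sub>F T in at_top. \<exists>\<omega>\<in>space M. \<bar>Y T \<omega> - c\<bar> \<le> \<bar>c - d\<bar> / 3 \<and> \<bar>Y T \<omega> - d\<bar> \<le> \<bar>c - d\<bar> / 3"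
    by (intro whp_ex whp_conj tendsto_in_probD[OF assms(1,3) e] tendsto_in_probD[OF assms(2,3) e])
  then obtain y :: real where "\<bar>y - c\<bar> \<le> \<bar>c - d\<bar> / 3" "\<bar>y - d\<bar> \<le> \<bar>c - d\<bar> / 3"
    using eventually_happens[of _ "at_top :: real filter"] by fastforce
  moreover have "\<bar>c - d\<bar> \<le> \<bar>y - c\<bar> + \<bar>y - d\<bar>" by linarith
  moreover have "u \<le> k / 3 \<Longrightarrow> v \<le> k / 3 \<Longrightarrow> k \<le> u + v \<Longrightarrow> k / 3 > 0 \<Longrightarrow> False" for u v k :: real
    by linarith
  ultimately show False using e by blast
qed

lemma (in prob_space) lim_in_prob_eq:
  assumes "tendsto_in_prob M Y c" "\<And>T. T > 0 \<Longrightarrow> Y T \<in> borel_measurable M"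
  shows "lim_in_prob M Y = c"
  unfolding lim_in_prob_def
proof (rule the_equality, rule assms(1))
  fix d assume "tendsto_in_prob M Y d"
  then show "d = c" by (rule tendsto_in_prob_unique) (use assms in auto)
qed

lemma label_le: "0 \<le> \<mu> \<Longrightarrow> 0 \<le> T \<Longrightarrow> real (label \<mu> T) \<le> \<mu> * T"
  by (simp add: label_def)

lemma label_ge: "real (label \<mu> T) \<ge> \<mu> * T - 1"
  unfolding label_def by linarith

subsection \<open>Exponential variables\<close>

definition expo :: "real measure" where
  "expo = density lborel (\<lambda>s. ennreal (exponential_density 1 s))"

abbreviation "iid_expo \<equiv> stream_space expo"

abbreviation "iid_field \<equiv> stream_space iid_expo"

lemma sets_expo [simp, measurable_cong]: "sets expo = sets borel"
  by (simp add: expo_def)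

lemma space_expo [simp]: "space expo = UNIV"
  by (simp add: expo_def)

interpretation expo: prob_space expo
  unfolding expo_def by (rule prob_space_exponential_density) simp

interpretation expos: prob_space "iid_expo"
  by (rule expo.prob_space_stream_space)

lemma space_expos [simp]: "space iid_expo = UNIV"
  by (simp add: space_stream_space)

lemma expos_Collect: "Measurable.pred iid_expo P \<Longrightarrow> {s. P s} \<in> sets iid_expo"
  by (simp add: pred_def)

lemma nn_integral_expo:
  assumes [measurable]: "f \<in> borel_measurable borel"
  shows "(\<integral>\<^sup>+x. f x \<partial>expo) = (\<integral>\<^sup>+x. ennreal (exp (- x)) * f x * indicator {0..} x \<partial>lborel)"
  unfolding expo_def
  by (subst nn_integral_density)
     (auto simp: exponential_density_def intro!: nn_integral_cong split: split_indicator)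

lemma AE_expo_nonneg: "AE x in expo. 0 \<le> x"
  unfolding expo_def by (subst AE_density) (auto simp: exponential_density_def)

lemma nn_integral_expo_exp:
  assumes "\<theta> < 1"
  shows "(\<integral>\<^sup>+x. ennreal (exp (\<theta> * x)) \<partial>expo) = ennreal (1 / (1 - \<theta>))"
proof -
  have 1: "(\<integral>\<^sup>+x. ennreal (exponential_density (1 - \<theta>) x) \<partial>lborel) = 1"
    using prob_space.emeasure_space_1[OF prob_space_exponential_density[of "1 - \<theta>"]] assms
    by (simp add: emeasure_density)
  have "(\<integral>\<^sup>+x. ennreal (exp (\<theta> * x)) \<partial>expo)
      = (\<integral>\<^sup>+x. ennreal (1 / (1 - \<theta>)) * ennreal (exponential_density (1 - \<theta>) x) \<partial>lborel)"
    unfolding nn_integral_expo[of "\<lambda>x. ennreal (exp (\<theta> * x))", simplified]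
  proof (intro nn_integral_cong)
    fix x :: real
    have "exp (- x) * exp (\<theta> * x) = exp (- x * (1 - \<theta>))"
      by (simp add: algebra_simps flip: exp_add)
    then show "ennreal (exp (- x)) * ennreal (exp (\<theta> * x)) * indicator {0..} x
      = ennreal (1 / (1 - \<theta>)) * ennreal (exponential_density (1 - \<theta>) x)"
      using assms by (simp add: exponential_density_def flip: ennreal_mult)
  qed
  also have "\<dots> = ennreal (1 / (1 - \<theta>))"
    by (subst nn_integral_cmult) (auto simp: 1)
  finally show ?thesis .
qed

lemma nn_integral_expos_exp_sum:
  assumes "\<theta> < 1"
  shows "(\<integral>\<^sup>+s. ennreal (exp (\<theta> * (\<Sum>j<k. s !! j))) \<partial>iid_expo) = ennreal (1 / (1 - \<theta>)) ^ k"
proof (induction k)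
  case 0
  then show ?case using expos.emeasure_space_1 by simp
next
  case (Suc k)
  have "(\<integral>\<^sup>+s. ennreal (exp (\<theta> * (\<Sum>j<Suc k. s !! j))) \<partial>iid_expo)
     = (\<integral>\<^sup>+x. \<integral>\<^sup>+s. ennreal (exp (\<theta> * x)) * ennreal (exp (\<theta> * (\<Sum>j<k. s !! j))) \<partial>iid_expo \<partial>expo)"
    by (subst expo.nn_integral_stream_space)
       (simp_all add: sum.lessThan_Suc_shift distrib_left exp_add ennreal_mult' del: sum.lessThan_Suc)
  also have "\<dots> = (\<integral>\<^sup>+x. ennreal (exp (\<theta> * x)) * ennreal (1 / (1 - \<theta>)) ^ k \<partial>expo)"
    by (subst nn_integral_cmult) (auto simp: Suc)
  also have "\<dots> = ennreal (1 / (1 - \<theta>)) ^ Suc k"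
    using nn_integral_expo_exp[OF assms] by (subst nn_integral_multc) auto
  finally show ?case .
qed

text \<open>One statement serves both tails, through the sign of \<theta>. The exponent 2 \<theta>^2
  k comes from -ln (1 - \<theta>) - \<theta> <= 2 \<theta>^2, a bound on the logarithmic moment
  generating function of a centred variable for |\<theta>| <= 1/2.\<close>

lemma chernoff_expos:
  assumes "\<bar>\<theta>\<bar> \<le> 1/2"
  shows "measure iid_expo {s. \<theta> * ((\<Sum>j<k. s !! j) - real k) \<ge> x} \<le> exp (2 * \<theta>\<^sup>2 * real k - x)"
proof -
  let ?P = "iid_expo"
  have \<theta>: "\<theta> < 1" using assms by auto
  have ln: "- ln (1 - \<theta>) - \<theta> \<le> 2 * \<theta>\<^sup>2"
    using abs_ln_one_plus_x_minus_x_bound[of "- \<theta>"] assms by auto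
  have eq: "1 / (1 - \<theta>) = exp (- ln (1 - \<theta>))" using \<theta> by (simp add: exp_minus inverse_eq_divide)
  have "emeasure ?P {s. \<theta> * ((\<Sum>j<k. s !! j) - real k) \<ge> x}
      = (\<integral>\<^sup>+s. indicator {s. \<theta> * ((\<Sum>j<k. s !! j) - real k) \<ge> x} s \<partial>?P)"
    by (intro nn_integral_indicator[symmetric] expos_Collect) measurable
  also have "\<dots> \<le> (\<integral>\<^sup>+s. ennreal (exp (- x - \<theta> * real k)) * ennreal (exp (\<theta> * (\<Sum>j<k. s !! j))) \<partial>?P)"
    by (intro nn_integral_mono)
       (auto simp: algebra_simps simp flip: ennreal_mult exp_add ennreal_1 split: split_indicator intro!: ennreal_leI)
  also have "\<dots> = ennreal (exp (- x - \<theta> * real k)) * ennreal (1 / (1 - \<theta>)) ^ k"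
    by (subst nn_integral_cmult) (auto simp: nn_integral_expos_exp_sum[OF \<theta>])
  also have "\<dots> = ennreal (exp (- x - \<theta> * real k) * exp (- ln (1 - \<theta>)) ^ k)"
    using \<theta> by (simp add: ennreal_mult ennreal_power eq)
  also have "exp (- x - \<theta> * real k) * exp (- ln (1 - \<theta>)) ^ k
      = exp (real k * (- ln (1 - \<theta>) - \<theta>) - x)"
    by (simp add: algebra_simps flip: exp_of_nat_mult exp_add)
  also have "\<dots> \<le> exp (2 * \<theta>\<^sup>2 * real k - x)"
    using mult_left_mono[OF ln, of "real k"] by (simp add: algebra_simps)
  finally show ?thesis by (simp add: expos.emeasure_eq_measure ennreal_leI)
qed

lemma expos_sum_concentration:
  assumes "0 < \<delta>" "\<delta> \<le> 2" "real k \<le> N"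
  shows "measure iid_expo {s. \<bar>(\<Sum>j<k. s !! j) - real k\<bar> \<ge> \<delta> * N} \<le> 2 * exp (- (\<delta>\<^sup>2 / 8) * N)"
proof -
  \<comment> \<open>The minimiser of 2 \<theta>^2 N - \<theta> \<delta> N; the condition \<delta> <=
    2 keeps it at most 1/2.\<close>
  define \<theta> where "\<theta> = \<delta> / 4"
  have b: "2 * \<theta>\<^sup>2 * real k - \<theta> * (\<delta> * N) \<le> - (\<delta>\<^sup>2 / 8) * N"
    using mult_left_mono[OF assms(3), of "\<delta>\<^sup>2"] by (simp add: \<theta>_def power2_eq_square field_simps)
  let ?A = "\<lambda>\<theta>'. {s. \<theta>' * ((\<Sum>j<k. s !! j) - real k) \<ge> \<theta> * (\<delta> * N)}"
  have "{s. \<bar>(\<Sum>j<k. s !! j) - real k\<bar> \<ge> \<delta> * N} \<subseteq> ?A \<theta> \<union> ?A (- \<theta>)"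
  proof
    fix s :: "real stream" assume "s \<in> {s. \<bar>(\<Sum>j<k. s !! j) - real k\<bar> \<ge> \<delta> * N}"
    then have "\<delta> * N \<le> (\<Sum>j<k. s !! j) - real k \<or> \<delta> * N \<le> - ((\<Sum>j<k. s !! j) - real k)" by auto
    moreover have "\<theta> \<ge> 0" using assms(1) by (simp add: \<theta>_def)
    ultimately have "\<theta> * (\<delta> * N) \<le> \<theta> * ((\<Sum>j<k. s !! j) - real k) \<or> \<theta> * (\<delta> * N) \<le> \<theta> * - ((\<Sum>j<k. s !! j) - real k)"
      using mult_left_mono[of "\<delta> * N" _ \<theta>] by blast
    then show "s \<in> ?A \<theta> \<union> ?A (- \<theta>)" by (auto simp: algebra_simps)
  qed
  then have "measure iid_expo {s. \<bar>(\<Sum>j<k. s !! j) - real k\<bar> \<ge> \<delta> * N}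
     \<le> measure iid_expo (?A \<theta> \<union> ?A (- \<theta>))"
    by (intro expos.finite_measure_mono sets.Un expos_Collect) measurable
  also have "\<dots> \<le> measure iid_expo (?A \<theta>) + measure iid_expo (?A (- \<theta>))"
    by (intro measure_Un_le expos_Collect) measurable
  also have "\<dots> \<le> exp (2 * \<theta>\<^sup>2 * real k - \<theta> * (\<delta> * N)) + exp (2 * (-\<theta>)\<^sup>2 * real k - \<theta> * (\<delta> * N))"
    using assms by (intro add_mono chernoff_expos) (auto simp: \<theta>_def)
  also have "\<dots> \<le> 2 * exp (- (\<delta>\<^sup>2 / 8) * N)" using b by simp
  finally show ?thesis .
qed

subsection \<open>Stationarity\<close>

text \<open>Allows indicators of half-lines whose end point is itself a variable, such as
  \<open>indicator {q * c<..} (p * r)\<close> below.\<close>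

lemma pred_greaterThan [measurable (raw)]:
  fixes f g :: "'a \<Rightarrow> real"
  assumes [measurable]: "f \<in> borel_measurable M" "g \<in> borel_measurable M"
  shows "Measurable.pred M (\<lambda>x. f x \<in> {g x<..})"
  unfolding greaterThan_iff by measurable

text \<open>
  A corner of a last passage percolation model with increments \<open>p * r\<close> and \<open>q * c\<close> on two adjacent
  edges and weight \<open>w\<close>: \<open>p * corner_r\<close> and \<open>q * corner_c\<close> are the increments on the opposite edges.
\<close>

definition corner_r :: "real \<Rightarrow> real \<Rightarrow> real \<Rightarrow> real \<Rightarrow> real \<Rightarrow> real" where
  "corner_r p q r c w = (max (p * r - q * c) 0 + w) / p"

definition corner_c :: "real \<Rightarrow> real \<Rightarrow> real \<Rightarrow> real \<Rightarrow> real \<Rightarrow> real" where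
  "corner_c p q r c w = (max (q * c - p * r) 0 + w) / q"

lemma corner_measurable [measurable (raw)]:
  assumes [measurable]: "f \<in> borel_measurable M" "g \<in> borel_measurable M" "h \<in> borel_measurable M"
  shows "(\<lambda>x. corner_r p q (f x) (g x) (h x)) \<in> borel_measurable M"
    "(\<lambda>x. corner_c p q (f x) (g x) (h x)) \<in> borel_measurable M"
  unfolding corner_r_def corner_c_def by measurable

lemma corner_swap: "corner_c q p c r w = corner_r p q r c w" "corner_r q p c r w = corner_c p q r c w"
  by (simp_all add: corner_r_def corner_c_def)

text \<open>Half of Burke's property: after the substitution \<open>r = q * c / p + u\<close> the variable \<open>c\<close> can be integrated out.\<close>

lemma corner_half:
  fixes F :: "real \<Rightarrow> real \<Rightarrow> ennreal"
  assumes p: "p > 0" and q: "q > 0" and pq: "1 / p + 1 / q = 1"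
    and [measurable]: "case_prod F \<in> borel_measurable (borel \<Otimes>\<^sub>M borel)"
  shows "(\<integral>\<^sup>+c. \<integral>\<^sup>+r. \<integral>\<^sup>+w. F (corner_r p q r c w) (corner_c p q r c w) * indicator {q * c<..} (p * r) \<partial>expo \<partial>expo \<partial>expo)
       = (\<integral>\<^sup>+y. \<integral>\<^sup>+x. F x y * indicator {q * y<..} (p * x) \<partial>expo \<partial>expo)"
    (is "?L = ?R")
proof -
  have pq': "p + q = p * q" using p q pq by (simp add: field_simps)
  define H where "H u = (\<integral>\<^sup>+w. F (u + w / p) (w / q) * ennreal (exp (- w)) * indicator {0..} w \<partial>lborel) * ennreal (exp (- u)) * indicator {0<..} u" for u :: real
  have H[measurable]: "H \<in> borel_measurable borel" unfolding H_def by measurable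
  have inner: "(\<integral>\<^sup>+r. \<integral>\<^sup>+w. F (corner_r p q r c w) (corner_c p q r c w) * indicator {q * c<..} (p * r) \<partial>expo \<partial>expo)
      = ennreal (exp (- (q / p) * c)) * (\<integral>\<^sup>+u. H u \<partial>lborel)" if c: "c \<ge> 0" for c
  proof -
    have "(\<integral>\<^sup>+r. \<integral>\<^sup>+w. F (corner_r p q r c w) (corner_c p q r c w) * indicator {q * c<..} (p * r) \<partial>expo \<partial>expo)
       = (\<integral>\<^sup>+r. ennreal (exp (- r)) * (\<integral>\<^sup>+w. F (corner_r p q r c w) (corner_c p q r c w) * indicator {q * c<..} (p * r) \<partial>expo) * indicator {0..} r \<partial>lborel)"
      by (subst nn_integral_expo) auto
    also have "\<dots> = (\<integral>\<^sup>+u. ennreal (exp (- (q / p * c + 1 * u))) * (\<integral>\<^sup>+w. F (corner_r p q (q / p * c + 1 * u) c w) (corner_c p q (q / p * c + 1 * u) c w) * indicator {q * c<..} (p * (q / p * c + 1 * u)) \<partial>expo) * indicator {0..} (q / p * c + 1 * u) \<partial>lborel)"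
      by (subst nn_integral_real_affine[where c=1 and t="q / p * c"]) auto
    also have "\<dots> = (\<integral>\<^sup>+u. ennreal (exp (- (q / p) * c)) * H u \<partial>lborel)"
    proof (intro nn_integral_cong)
      fix u :: real
      show "ennreal (exp (- (q / p * c + 1 * u))) * (\<integral>\<^sup>+w. F (corner_r p q (q / p * c + 1 * u) c w) (corner_c p q (q / p * c + 1 * u) c w) * indicator {q * c<..} (p * (q / p * c + 1 * u)) \<partial>expo) * indicator {0..} (q / p * c + 1 * u)
        = ennreal (exp (- (q / p) * c)) * H u"
      proof (cases "u > 0")
        case True
        have 1: "corner_r p q (q / p * c + 1 * u) c w = u + w / p" "corner_c p q (q / p * c + 1 * u) c w = w / q" for w
          using p q True by (auto simp: corner_r_def corner_c_def field_simps max_def not_le mult_less_0_iff)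
        have 2: "q / p * c + 1 * u \<ge> 0" using p q c True by (simp add: add_nonneg_nonneg)
        have 3: "p * (q / p * c + 1 * u) > q * c" using p q True by (simp add: field_simps)
        have 4: "exp (- (q / p * c + 1 * u)) = exp (- (q / p) * c) * exp (- u)" by (simp flip: exp_add)
        show ?thesis unfolding 1 4 using 2 3 True
          by (subst nn_integral_expo) (auto simp: H_def ennreal_mult mult_ac)
      next
        case False
        then have "p * u \<le> 0" using p by (simp add: mult_le_0_iff)
        moreover have "p * (q / p * c + 1 * u) = q * c + p * u" using p by (simp add: distrib_left)
        ultimately have "\<not> p * (q / p * c + 1 * u) > q * c" by simp
        then show ?thesis using False by (simp add: H_def)
      qed
    qed
    also have "\<dots> = ennreal (exp (- (q / p) * c)) * (\<integral>\<^sup>+u. H u \<partial>lborel)"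
      by (rule nn_integral_cmult) simp
    finally show ?thesis .
  qed
  \<comment> \<open>Integrating out c gives 1 / (1 + q / p), and 1 / p + 1 / q = 1 turns this into 1
    / q. The factor is used up by the later substitution w = q * y.\<close>
  have qp: "- (q / p) < 1" using p q by (simp add: field_simps)
  have q1: "1 / (1 - - (q / p)) = 1 / q" using pq' p q by (simp add: field_simps)
  have "?L = (\<integral>\<^sup>+c. ennreal (exp (- (q / p) * c)) * (\<integral>\<^sup>+u. H u \<partial>lborel) \<partial>expo)"
  proof (rule nn_integral_cong_AE)
    show "AE c in expo. (\<integral>\<^sup>+r. \<integral>\<^sup>+w. F (corner_r p q r c w) (corner_c p q r c w) * indicator {q * c<..} (p * r) \<partial>expo \<partial>expo)
        = ennreal (exp (- (q / p) * c)) * (\<integral>\<^sup>+u. H u \<partial>lborel)"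
      using AE_expo_nonneg by eventually_elim (rule inner)
  qed
  also have "\<dots> = ennreal (1 / q) * (\<integral>\<^sup>+u. H u \<partial>lborel)"
    using nn_integral_expo_exp[OF qp] unfolding q1 by (subst nn_integral_multc) auto
  also have "\<dots> = ennreal (1 / q) * (\<integral>\<^sup>+u. \<integral>\<^sup>+w. F (u + w / p) (w / q) * ennreal (exp (- w)) * ennreal (exp (- u)) * indicator {0..} w * indicator {0<..} u \<partial>lborel \<partial>lborel)"
  proof (intro arg_cong[where f="\<lambda>x. ennreal (1 / q) * x"] nn_integral_cong)
    fix u
    have "H u = (\<integral>\<^sup>+w. F (u + w / p) (w / q) * ennreal (exp (- w)) * indicator {0..} w * (ennreal (exp (- u)) * indicator {0<..} u) \<partial>lborel)"
      unfolding H_def by (subst nn_integral_multc) (auto simp: mult_ac)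
    then show "H u = (\<integral>\<^sup>+w. F (u + w / p) (w / q) * ennreal (exp (- w)) * ennreal (exp (- u)) * indicator {0..} w * indicator {0<..} u \<partial>lborel)"
      by (simp add: mult_ac)
  qed
  also have "\<dots> = ennreal (1 / q) * (\<integral>\<^sup>+w. \<integral>\<^sup>+u. F (u + w / p) (w / q) * ennreal (exp (- w)) * ennreal (exp (- u)) * indicator {0..} w * indicator {0<..} u \<partial>lborel \<partial>lborel)"
    by (subst lborel_pair.Fubini') auto
  also have "\<dots> = (\<integral>\<^sup>+y. \<integral>\<^sup>+u. F (u + q * y / p) y * ennreal (exp (- (q * y))) * ennreal (exp (- u)) * indicator {0..} y * indicator {0<..} u \<partial>lborel \<partial>lborel)"
    using q by (subst nn_integral_real_affine[where c=q and t=0])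
       (auto simp: indicator_def zero_le_mult_iff ennreal_mult[symmetric] mult.assoc[symmetric] intro!: nn_integral_cong)
  also have "\<dots> = (\<integral>\<^sup>+y. \<integral>\<^sup>+x. F x y * ennreal (exp (- y)) * ennreal (exp (- x)) * indicator {0..} y * indicator {q * y<..} (p * x) * indicator {0..} x \<partial>lborel \<partial>lborel)"
  proof (rule nn_integral_cong)
    fix y :: real
    show "(\<integral>\<^sup>+u. F (u + q * y / p) y * ennreal (exp (- (q * y))) * ennreal (exp (- u)) * indicator {0..} y * indicator {0<..} u \<partial>lborel)
       = (\<integral>\<^sup>+x. F x y * ennreal (exp (- y)) * ennreal (exp (- x)) * indicator {0..} y * indicator {q * y<..} (p * x) * indicator {0..} x \<partial>lborel)" (is "_ = ?X")
    proof -
      \<comment> \<open>The relation between p and q again: with x = u + q * y / p the density exp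
        (- q y - u) becomes exp (- y - x), that of two independent exponential variables.\<close>
      have qe: "q * y = y + q * y / p" using pq' p q by (simp add: field_simps) (metis distrib_right mult.commute mult.assoc)
      have "?X = (\<integral>\<^sup>+u. F (q * y / p + 1 * u) y * ennreal (exp (- y)) * ennreal (exp (- (q * y / p + 1 * u))) * indicator {0..} y * indicator {q * y<..} (p * (q * y / p + 1 * u)) * indicator {0..} (q * y / p + 1 * u) \<partial>lborel)"
        by (subst nn_integral_real_affine[where c=1 and t="q * y / p"]) auto
      also have "\<dots> = (\<integral>\<^sup>+u. F (u + q * y / p) y * ennreal (exp (- (q * y))) * ennreal (exp (- u)) * indicator {0..} y * indicator {0<..} u \<partial>lborel)"
      proof (intro nn_integral_cong)
        fix u :: real
        have "exp (- y) * exp (- (q * y / p + 1 * u)) = exp (- (q * y)) * exp (- u)"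
          by (subst qe) (simp flip: exp_add)
        then have e: "ennreal (exp (- y)) * ennreal (exp (- (q * y / p + 1 * u))) = ennreal (exp (- (q * y))) * ennreal (exp (- u))"
          by (simp flip: ennreal_mult)
        have "indicator {0..} y * indicator {q * y<..} (p * (q * y / p + 1 * u)) * indicator {0..} (q * y / p + 1 * u)
            = (indicator {0..} y * indicator {0<..} u :: ennreal)"
          using p q by (auto simp: indicator_def field_simps zero_less_mult_iff intro!: add_nonneg_nonneg)
        then show "F (q * y / p + 1 * u) y * ennreal (exp (- y)) * ennreal (exp (- (q * y / p + 1 * u))) * indicator {0..} y * indicator {q * y<..} (p * (q * y / p + 1 * u)) * indicator {0..} (q * y / p + 1 * u)
          = F (u + q * y / p) y * ennreal (exp (- (q * y))) * ennreal (exp (- u)) * indicator {0..} y * indicator {0<..} u"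
          using e by (simp add: mult.assoc add.commute)
      qed
      finally show ?thesis by simp
    qed
  qed
  also have "\<dots> = ?R"
  proof -
    let ?I = "\<lambda>y. \<integral>\<^sup>+x. F x y * indicator {q * y<..} (p * x) \<partial>expo"
    have 1: "?I y = (\<integral>\<^sup>+x. ennreal (exp (- x)) * (F x y * indicator {q * y<..} (p * x)) * indicator {0..} x \<partial>lborel)" for y
      by (rule nn_integral_expo) measurable
    have 2: "(\<integral>\<^sup>+x. F x y * ennreal (exp (- y)) * ennreal (exp (- x)) * indicator {0..} y * indicator {q * y<..} (p * x) * indicator {0..} x \<partial>lborel)
       = ennreal (exp (- y)) * ?I y * indicator {0..} y" for y
    proof -
      have "(\<integral>\<^sup>+x. F x y * ennreal (exp (- y)) * ennreal (exp (- x)) * indicator {0..} y * indicator {q * y<..} (p * x) * indicator {0..} x \<partial>lborel)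
        = (\<integral>\<^sup>+x. (ennreal (exp (- y)) * indicator {0..} y) * (ennreal (exp (- x)) * (F x y * indicator {q * y<..} (p * x)) * indicator {0..} x) \<partial>lborel)"
        by (simp only: mult_ac)
      also have "\<dots> = (ennreal (exp (- y)) * indicator {0..} y) * ?I y"
        unfolding 1 by (rule nn_integral_cmult) measurable
      finally show ?thesis by (simp only: mult_ac)
    qed
    show ?thesis unfolding 2 by (rule nn_integral_expo[symmetric]) measurable
  qed
  finally show ?thesis .
qed

interpretation expo2: pair_sigma_finite expo expo ..

lemma AE_expo_neq: "AE r in expo. r \<noteq> c"
proof -
  have "AE r in lborel. 0 < ennreal (exponential_density 1 r) \<longrightarrow> r \<noteq> c"
    using AE_lborel_singleton[of c] by eventually_elim simp
  then show ?thesis unfolding expo_def by (subst AE_density) auto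
qed

text \<open>The domain is split by which of p * r and q * c is larger, ties being null. Exchanging
  the roles of the two edges carries one half into the other, so \<open>corner_half\<close> covers
  both. Probabilistically, the outgoing increments of a corner are again independent exponential
  variables.\<close>

lemma corner_stationary:
  fixes F :: "real \<Rightarrow> real \<Rightarrow> ennreal"
  assumes p: "p > 0" and q: "q > 0" and pq: "1 / p + 1 / q = 1"
    and [measurable]: "case_prod F \<in> borel_measurable (borel \<Otimes>\<^sub>M borel)"
  shows "(\<integral>\<^sup>+c. \<integral>\<^sup>+r. \<integral>\<^sup>+w. F (corner_r p q r c w) (corner_c p q r c w) \<partial>expo \<partial>expo \<partial>expo)
       = (\<integral>\<^sup>+y. \<integral>\<^sup>+x. F x y \<partial>expo \<partial>expo)"
proof -
  have split: "(\<integral>\<^sup>+c. \<integral>\<^sup>+r. G r c \<partial>expo \<partial>expo)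
      = (\<integral>\<^sup>+c. \<integral>\<^sup>+r. G r c * indicator {q * c<..} (p * r) \<partial>expo \<partial>expo)
      + (\<integral>\<^sup>+r. \<integral>\<^sup>+c. G r c * indicator {p * r<..} (q * c) \<partial>expo \<partial>expo)"
    if [measurable]: "case_prod G \<in> borel_measurable (borel \<Otimes>\<^sub>M borel)" for G :: "real \<Rightarrow> real \<Rightarrow> ennreal"
  proof -
    have "(\<integral>\<^sup>+c. \<integral>\<^sup>+r. G r c \<partial>expo \<partial>expo)
        = (\<integral>\<^sup>+c. \<integral>\<^sup>+r. G r c * indicator {q * c<..} (p * r) + G r c * indicator {p * r<..} (q * c) \<partial>expo \<partial>expo)"
    proof (rule nn_integral_cong, rule nn_integral_cong_AE)
      fix c
      show "AE r in expo. G r c = G r c * indicator {q * c<..} (p * r) + G r c * indicator {p * r<..} (q * c)"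
        using AE_expo_neq[of "q * c / p"] by eventually_elim (use p in \<open>auto simp: indicator_def field_simps\<close>)
    qed
    also have "\<dots> = (\<integral>\<^sup>+c. \<integral>\<^sup>+r. G r c * indicator {q * c<..} (p * r) \<partial>expo \<partial>expo)
      + (\<integral>\<^sup>+c. \<integral>\<^sup>+r. G r c * indicator {p * r<..} (q * c) \<partial>expo \<partial>expo)"
      by (subst nn_integral_add[symmetric], measurable)
         (intro nn_integral_cong nn_integral_add, measurable)
    also have "(\<integral>\<^sup>+c. \<integral>\<^sup>+r. G r c * indicator {p * r<..} (q * c) \<partial>expo \<partial>expo)
       = (\<integral>\<^sup>+r. \<integral>\<^sup>+c. G r c * indicator {p * r<..} (q * c) \<partial>expo \<partial>expo)"
      by (rule expo2.Fubini') measurable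
    finally show ?thesis .
  qed
  have m: "(\<lambda>(r, c). \<integral>\<^sup>+w. F (corner_r p q r c w) (corner_c p q r c w) \<partial>expo) \<in> borel_measurable (borel \<Otimes>\<^sub>M borel)"
    by measurable
  have m': "(\<lambda>(x, y). F y x) \<in> borel_measurable (borel \<Otimes>\<^sub>M borel)" by measurable
  have qp: "1 / q + 1 / p = 1" using pq by simp
  have 1: "(\<integral>\<^sup>+w. F (corner_r p q r c w) (corner_c p q r c w) * indicator A x \<partial>expo)
      = (\<integral>\<^sup>+w. F (corner_r p q r c w) (corner_c p q r c w) \<partial>expo) * indicator A x" for r c A and x :: real
    by (rule nn_integral_multc) measurable
  have 2: "(\<integral>\<^sup>+c. \<integral>\<^sup>+r. (\<integral>\<^sup>+w. F (corner_r p q r c w) (corner_c p q r c w) \<partial>expo) * indicator {q * c<..} (p * r) \<partial>expo \<partial>expo)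
      = (\<integral>\<^sup>+y. \<integral>\<^sup>+x. F x y * indicator {q * y<..} (p * x) \<partial>expo \<partial>expo)"
    using corner_half[OF p q pq assms(4)] unfolding 1 .
  have 3: "(\<integral>\<^sup>+r. \<integral>\<^sup>+c. (\<integral>\<^sup>+w. F (corner_r p q r c w) (corner_c p q r c w) \<partial>expo) * indicator {p * r<..} (q * c) \<partial>expo \<partial>expo)
      = (\<integral>\<^sup>+x. \<integral>\<^sup>+y. F x y * indicator {p * x<..} (q * y) \<partial>expo \<partial>expo)"
    using corner_half[OF q p qp m'] unfolding corner_swap[where p=p and q=q] 1 .
  show ?thesis
    unfolding split[OF m] split[OF assms(4)] 2 3 ..
qed

section \<open>Invariance along a row and from row to row\<close>

primrec row_r :: "real \<Rightarrow> real \<Rightarrow> real \<Rightarrow> real stream \<Rightarrow> real stream \<Rightarrow> nat \<Rightarrow> real" where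
  "row_r p q r cs ws 0 = r"
| "row_r p q r cs ws (Suc j) = corner_r p q (row_r p q r cs ws j) (cs !! j) (ws !! j)"

text \<open>\<open>row_r\<close> is the increment between two consecutive rows in column j, carried
  from left to right; \<open>row_c\<close> collects the increments along the new row, each produced
  by the same corner that updates \<open>row_r\<close>.\<close>

definition row_c :: "real \<Rightarrow> real \<Rightarrow> real \<Rightarrow> real stream \<Rightarrow> real stream \<Rightarrow> real stream" where
  "row_c p q r cs ws = to_stream (\<lambda>j. corner_c p q (row_r p q r cs ws j) (cs !! j) (ws !! j))"

lemma expos_snth_measurable [measurable (raw)]:
  "f \<in> measurable M iid_expo \<Longrightarrow> (\<lambda>x. f x !! n) \<in> borel_measurable M"
  using measurable_compose[OF _ measurable_snth[of n expo]] by (simp cong: measurable_cong_sets)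

lemma expos'_snth_measurable [measurable (raw)]:
  "f \<in> measurable M iid_field \<Longrightarrow> (\<lambda>x. f x !! n) \<in> measurable M iid_expo"
  by (rule measurable_compose[OF _ measurable_snth[of n iid_expo]])

lemma snth_to_stream [simp]: "to_stream X !! n = X n"
  by (simp add: to_stream_def)

lemma stream_eqI: "(\<And>n. s !! n = t !! n) \<Longrightarrow> s = t"
  by (metis ext stream_smap_nats)

lemma snth_row_c: "row_c p q r cs ws !! j = corner_c p q (row_r p q r cs ws j) (cs !! j) (ws !! j)"
  by (simp add: row_c_def)

lemma row_r_Stream:
  "row_r p q r (c ## cs) (w ## ws) (Suc j) = row_r p q (corner_r p q r c w) cs ws j"
  by (induction j) auto

lemma row_c_Stream:
  "row_c p q r (c ## cs) (w ## ws) = corner_c p q r c w ## row_c p q (corner_r p q r c w) cs ws"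
proof (rule stream_eqI)
  fix n show "row_c p q r (c ## cs) (w ## ws) !! n = (corner_c p q r c w ## row_c p q (corner_r p q r c w) cs ws) !! n"
    by (cases n) (simp_all only: snth_row_c row_r_Stream Stream_snth row_r.simps(1) nat.case)
qed

lemma row_r_measurable [measurable (raw)]:
  assumes [measurable]: "f \<in> borel_measurable M" "g \<in> measurable M iid_expo" "h \<in> measurable M iid_expo"
  shows "(\<lambda>x. row_r p q (f x) (g x) (h x) j) \<in> borel_measurable M"
  by (induction j) (simp, simp, measurable)

lemma row_c_measurable [measurable (raw)]:
  assumes [measurable]: "f \<in> borel_measurable M" "g \<in> measurable M iid_expo" "h \<in> measurable M iid_expo"
  shows "(\<lambda>x. row_c p q (f x) (g x) (h x)) \<in> measurable M iid_expo"
  by (rule measurable_stream_space2) (simp add: snth_row_c cong: measurable_cong_sets)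

text \<open>Invariance is proved one corner at a time, by induction over the number of coordinates
  on which the test function depends. Such functions suffice, because every event considered later
  concerns a finite sum or a single coordinate.\<close>

definition prefix_dependent :: "nat \<Rightarrow> ('a stream \<Rightarrow> 'b) \<Rightarrow> bool" where
  "prefix_dependent m f \<longleftrightarrow> (\<forall>s t. (\<forall>j<m. s !! j = t !! j) \<longrightarrow> f s = f t)"

lemma prefix_dependentD: "prefix_dependent m f \<Longrightarrow> (\<And>j. j < m \<Longrightarrow> s !! j = t !! j) \<Longrightarrow> f s = f t"
  by (auto simp: prefix_dependent_def)

lemma prefix_dependent_Stream: "prefix_dependent (Suc m) f \<Longrightarrow> prefix_dependent m (\<lambda>s. f (x ## s))"
  by (auto simp: prefix_dependent_def Stream_snth split: nat.splits)

interpretation expo_expos: pair_sigma_finite expo "iid_expo" ..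

text \<open>The outputs of the first corner are independent: \<open>corner_c\<close> becomes the
  first new increment, and \<open>corner_r\<close> enters the remaining row as a fresh exponential
  variable, so the induction hypothesis applies to the rest.\<close>

lemma row_stationary:
  fixes f :: "real stream \<Rightarrow> ennreal"
  assumes p: "p > 0" and q: "q > 0" and pq: "1 / p + 1 / q = 1"
    and f: "f \<in> borel_measurable iid_expo" "prefix_dependent m f"
  shows "(\<integral>\<^sup>+r. \<integral>\<^sup>+cs. \<integral>\<^sup>+ws. f (row_c p q r cs ws) \<partial>iid_expo \<partial>iid_expo \<partial>expo)
       = (\<integral>\<^sup>+s. f s \<partial>iid_expo)"
  using f
proof (induction m arbitrary: f)
  case 0
  then have "f s = f t" for s t by (auto simp: prefix_dependent_def)
  then have "f = (\<lambda>_. f undefined)" by blast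
  then obtain c where "f = (\<lambda>_. c)" by metis
  then show ?case using expo.emeasure_space_1 expos.emeasure_space_1 by simp
next
  case (Suc m)
  note [measurable] = Suc.prems(1)
  let ?P = "iid_expo"
  define \<Phi> where "\<Phi> r c = (\<integral>\<^sup>+cs. \<integral>\<^sup>+ws. f (c ## row_c p q r cs ws) \<partial>?P \<partial>?P)" for r c
  have [measurable]: "case_prod \<Phi> \<in> borel_measurable (borel \<Otimes>\<^sub>M borel)"
    unfolding \<Phi>_def by measurable
  have "(\<integral>\<^sup>+r. \<integral>\<^sup>+cs. \<integral>\<^sup>+ws. f (row_c p q r cs ws) \<partial>?P \<partial>?P \<partial>expo)
     = (\<integral>\<^sup>+r. \<integral>\<^sup>+c. \<integral>\<^sup>+cs. \<integral>\<^sup>+ws. f (row_c p q r (c ## cs) ws) \<partial>?P \<partial>?P \<partial>expo \<partial>expo)"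
    by (subst expo.nn_integral_stream_space) auto
  also have "\<dots> = (\<integral>\<^sup>+r. \<integral>\<^sup>+c. \<integral>\<^sup>+cs. \<integral>\<^sup>+w. \<integral>\<^sup>+ws. f (row_c p q r (c ## cs) (w ## ws)) \<partial>?P \<partial>expo \<partial>?P \<partial>expo \<partial>expo)"
    by (intro nn_integral_cong, subst expo.nn_integral_stream_space) auto
  also have "\<dots> = (\<integral>\<^sup>+r. \<integral>\<^sup>+c. \<integral>\<^sup>+w. \<integral>\<^sup>+cs. \<integral>\<^sup>+ws. f (row_c p q r (c ## cs) (w ## ws)) \<partial>?P \<partial>?P \<partial>expo \<partial>expo \<partial>expo)"
    by (intro nn_integral_cong expo_expos.Fubini') measurable
  also have "\<dots> = (\<integral>\<^sup>+r. \<integral>\<^sup>+c. \<integral>\<^sup>+w. \<Phi> (corner_r p q r c w) (corner_c p q r c w) \<partial>expo \<partial>expo \<partial>expo)"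
    by (simp add: row_c_Stream \<Phi>_def)
  also have "\<dots> = (\<integral>\<^sup>+c. \<integral>\<^sup>+r. \<integral>\<^sup>+w. \<Phi> (corner_r p q r c w) (corner_c p q r c w) \<partial>expo \<partial>expo \<partial>expo)"
    by (rule expo2.Fubini') measurable
  also have "\<dots> = (\<integral>\<^sup>+c. \<integral>\<^sup>+r. \<Phi> r c \<partial>expo \<partial>expo)"
    by (rule corner_stationary[OF p q pq]) measurable
  also have "\<dots> = (\<integral>\<^sup>+c. \<integral>\<^sup>+s. f (c ## s) \<partial>?P \<partial>expo)"
    unfolding \<Phi>_def
    by (intro nn_integral_cong Suc.IH) (measurable, auto intro: prefix_dependent_Stream Suc.prems)
  also have "\<dots> = (\<integral>\<^sup>+s. f s \<partial>?P)"
    by (rule expo.nn_integral_stream_space[symmetric]) measurable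
  finally show ?case .
qed

text \<open>The increments along row \<open>n\<close> of the percolation model whose row \<open>0\<close> has increments \<open>q * cs\<close>.\<close>

primrec stat_row :: "real \<Rightarrow> real \<Rightarrow> nat \<Rightarrow> real stream \<Rightarrow> real stream \<Rightarrow> real stream stream \<Rightarrow> real stream" where
  "stat_row p q 0 cs rs \<omega> = cs"
| "stat_row p q (Suc n) cs rs \<omega> = stat_row p q n (row_c p q (shd rs) cs (shd \<omega>)) (stl rs) (stl \<omega>)"

lemma stat_row_Suc: "stat_row p q (Suc n) cs rs \<omega> = row_c p q (rs !! n) (stat_row p q n cs rs \<omega>) (\<omega> !! n)"
  by (induction n arbitrary: cs rs \<omega>) simp_all

interpretation expos': prob_space "iid_field"
  by (rule expos.prob_space_stream_space)

lemma stat_row_measurable [measurable (raw)]: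
  assumes [measurable]: "f \<in> measurable M iid_expo" "g \<in> measurable M iid_expo"
    "h \<in> measurable M iid_field"
  shows "(\<lambda>x. stat_row p q n (f x) (g x) (h x)) \<in> measurable M iid_expo"
proof (induction n)
  case (Suc n)
  note [measurable] = Suc
  show ?case unfolding stat_row_Suc by measurable
qed simp

lemma row_r_cong: "(\<And>i. i < j \<Longrightarrow> cs !! i = cs' !! i) \<Longrightarrow> row_r p q r cs ws j = row_r p q r cs' ws j"
  by (induction j) auto

lemma stat_row_cong:
  "(\<And>i. i < m \<Longrightarrow> cs !! i = cs' !! i) \<Longrightarrow> j < m \<Longrightarrow> stat_row p q n cs rs \<omega> !! j = stat_row p q n cs' rs \<omega> !! j"
proof (induction n arbitrary: j)
  case (Suc n)
  then have "row_r p q (rs !! n) (stat_row p q n cs rs \<omega>) (\<omega> !! n) j = row_r p q (rs !! n) (stat_row p q n cs' rs \<omega>) (\<omega> !! n) j"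
    by (intro row_r_cong) auto
  with Suc show ?case by (simp only: stat_row_Suc snth_row_c)
qed simp

interpretation expos_expos: pair_sigma_finite "iid_expo" "iid_expo" ..
interpretation expos_expos': pair_sigma_finite "iid_expo" "iid_field" ..

text \<open>\<open>stat_row\<close> recurses from row 0 upwards, so the heads of rs and \<omega> act
  in the first step only. Everything else is integrated out into h, which still depends on finitely
  many coordinates by \<open>stat_row_cong\<close>; \<open>row_stationary\<close> removes the first
  step.\<close>

lemma stat_row_stationary:
  fixes f :: "real stream \<Rightarrow> ennreal"
  assumes p: "p > 0" and q: "q > 0" and pq: "1 / p + 1 / q = 1"
    and [measurable]: "f \<in> borel_measurable iid_expo" and f: "prefix_dependent m f"
  shows "(\<integral>\<^sup>+cs. \<integral>\<^sup>+rs. \<integral>\<^sup>+\<omega>. f (stat_row p q n cs rs \<omega>) \<partial>iid_field \<partial>iid_expo \<partial>iid_expo)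
       = (\<integral>\<^sup>+s. f s \<partial>iid_expo)"
proof (induction n)
  case 0
  then show ?case using expos.emeasure_space_1 expos'.emeasure_space_1 by simp
next
  case (Suc n)
  let ?P = "iid_expo" and ?Q = "iid_field"
  define h where "h cs = (\<integral>\<^sup>+rs. \<integral>\<^sup>+\<omega>. f (stat_row p q n cs rs \<omega>) \<partial>?Q \<partial>?P)" for cs
  have [measurable]: "h \<in> borel_measurable ?P" unfolding h_def by measurable
  have h: "prefix_dependent m h"
    unfolding h_def prefix_dependent_def
    by (auto intro!: nn_integral_cong prefix_dependentD[OF f] intro: stat_row_cong)
  have "(\<integral>\<^sup>+cs. \<integral>\<^sup>+rs. \<integral>\<^sup>+\<omega>. f (stat_row p q (Suc n) cs rs \<omega>) \<partial>?Q \<partial>?P \<partial>?P)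
      = (\<integral>\<^sup>+cs. \<integral>\<^sup>+r. \<integral>\<^sup>+rs. \<integral>\<^sup>+\<omega>. f (stat_row p q (Suc n) cs (r ## rs) \<omega>) \<partial>?Q \<partial>?P \<partial>expo \<partial>?P)"
    by (intro nn_integral_cong, subst expo.nn_integral_stream_space) (auto simp del: stat_row.simps)
  also have "\<dots> = (\<integral>\<^sup>+cs. \<integral>\<^sup>+r. \<integral>\<^sup>+rs. \<integral>\<^sup>+w. \<integral>\<^sup>+\<omega>. f (stat_row p q (Suc n) cs (r ## rs) (w ## \<omega>)) \<partial>?Q \<partial>?P \<partial>?P \<partial>expo \<partial>?P)"
    by (intro nn_integral_cong, subst expos.nn_integral_stream_space) (auto simp del: stat_row.simps)
  also have "\<dots> = (\<integral>\<^sup>+cs. \<integral>\<^sup>+r. \<integral>\<^sup>+w. \<integral>\<^sup>+rs. \<integral>\<^sup>+\<omega>. f (stat_row p q (Suc n) cs (r ## rs) (w ## \<omega>)) \<partial>?Q \<partial>?P \<partial>?P \<partial>expo \<partial>?P)"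
    by (intro nn_integral_cong expos_expos.Fubini') measurable
  also have "\<dots> = (\<integral>\<^sup>+cs. \<integral>\<^sup>+r. \<integral>\<^sup>+w. h (row_c p q r cs w) \<partial>?P \<partial>expo \<partial>?P)"
    by (simp add: h_def)
  also have "\<dots> = (\<integral>\<^sup>+r. \<integral>\<^sup>+cs. \<integral>\<^sup>+w. h (row_c p q r cs w) \<partial>?P \<partial>?P \<partial>expo)"
    by (rule expo_expos.Fubini') measurable
  also have "\<dots> = (\<integral>\<^sup>+s. h s \<partial>?P)"
    by (rule row_stationary[OF p q pq _ h]) measurable
  finally show ?case using Suc by (simp add: h_def)
qed

subsection \<open>Last passage percolation\<close>

text \<open>
  Boundary data \<open>A\<close> (column \<open>0\<close>) and \<open>B\<close> (row \<open>0\<close>) enter only through \<open>max\<close> and \<open>+\<close>, so \<open>lpp\<close> is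
  a max-plus linear function of them.
\<close>

fun lpp :: "(nat \<Rightarrow> real) \<Rightarrow> (nat \<Rightarrow> real) \<Rightarrow> (nat \<Rightarrow> nat \<Rightarrow> real) \<Rightarrow> nat \<Rightarrow> nat \<Rightarrow> real" where
  "lpp A B w 0 m = B m"
| "lpp A B w (Suc n) 0 = A (Suc n)"
| "lpp A B w (Suc n) (Suc m) = max (lpp A B w n (Suc m)) (lpp A B w (Suc n) m) + w n m"

lemma lattice_induct [case_names row column corner]:
  fixes n m :: nat
  assumes "\<And>m. P 0 m" "\<And>n. P (Suc n) 0" "\<And>n m. P n (Suc m) \<Longrightarrow> P (Suc n) m \<Longrightarrow> P (Suc n) (Suc m)"
  shows "P n m"
proof (induction n arbitrary: m)
  case (Suc n)
  then show ?case by (induction m) (auto intro: assms)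
qed (rule assms)

lemma lpp_mono:
  assumes "\<And>i. A i \<le> A' i" "\<And>j. B j \<le> B' j"
  shows "lpp A B w n m \<le> lpp A' B' w n m"
proof (induction n m rule: lattice_induct)
  case (corner n m)
  then show ?case by (auto intro: max.mono)
qed (use assms in auto)

lemma lpp_max:
  "lpp (\<lambda>i. max (A i) (A' i)) (\<lambda>j. max (B j) (B' j)) w n m = max (lpp A B w n m) (lpp A' B' w n m)"
proof (induction n m rule: lattice_induct)
  case (corner n m)
  then show ?case by (simp add: max_add_distrib_left ac_simps)
qed simp_all

lemma lpp_add_const: "lpp (\<lambda>i. A i + c) (\<lambda>j. B j + c) w n m = lpp A B w n m + c"
  by (induction n m rule: lattice_induct) (auto simp: max_def)

definition bulk_lpp :: "nat \<Rightarrow> nat \<Rightarrow> real stream stream \<Rightarrow> real" where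
  "bulk_lpp n m \<omega> = lpp (\<lambda>_. 0) (\<lambda>_. 0) (\<lambda>i j. \<omega> !! i !! j) n m"

text \<open>With independent standard exponential cs and rs, the boundary increments have means q
  and p; for 1 / p + 1 / q = 1 this is the stationary exponential corner growth model.\<close>

definition stat_lpp :: "real \<Rightarrow> real \<Rightarrow> nat \<Rightarrow> nat \<Rightarrow> real stream \<Rightarrow> real stream \<Rightarrow> real stream stream \<Rightarrow> real" where
  "stat_lpp p q n m cs rs \<omega> =
     lpp (\<lambda>i. p * (\<Sum>k<i. rs !! k)) (\<lambda>j. q * (\<Sum>k<j. cs !! k)) (\<lambda>i j. \<omega> !! i !! j) n m"

text \<open>Telescoping along column 0 and then along row n. Under the stationary law each of the
  two sums is a sum of independent standard exponential variables, which reduces the limit of the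
  passage time to concentration of such sums.\<close>

lemma stat_lpp_eq:
  assumes p: "p > 0" and q: "q > 0"
  shows "stat_lpp p q n m cs rs \<omega> = p * (\<Sum>i<n. rs !! i) + q * (\<Sum>j<m. stat_row p q n cs rs \<omega> !! j)"
proof (induction n arbitrary: m)
  case 0
  then show ?case by (simp add: stat_lpp_def)
next
  case (Suc n)
  let ?G = "\<lambda>n m. stat_lpp p q n m cs rs \<omega>"
  let ?c = "stat_row p q n cs rs \<omega>" and ?c' = "stat_row p q (Suc n) cs rs \<omega>"
  let ?r = "row_r p q (rs !! n) ?c (\<omega> !! n)"
  have c': "?c' !! j = corner_c p q (?r j) (?c !! j) (\<omega> !! n !! j)" for j
    by (simp only: stat_row_Suc snth_row_c)
  have rec: "?G (Suc n) (Suc m) = max (?G n (Suc m)) (?G (Suc n) m) + \<omega> !! n !! m" for m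
    by (simp add: stat_lpp_def)
  have step: "?G n (Suc m) = ?G n m + q * ?c !! m" for m
    by (simp add: Suc distrib_left)
  have pr: "p * corner_r p q r c w = max (p * r - q * c) 0 + w" for r c w
    using p by (simp add: corner_r_def)
  have qc: "q * corner_c p q r c w = max (q * c - p * r) 0 + w" for r c w
    using q by (simp add: corner_c_def)
  have 1: "?G (Suc n) m = ?G n m + p * ?r m" for m
  proof (induction m)
    case 0
    have "?G n 0 = p * (\<Sum>i<n. rs !! i)" by (simp add: Suc)
    then show ?case by (simp add: stat_lpp_def distrib_left)
  next
    case (Suc m)
    show ?case by (simp only: rec Suc step row_r.simps(2) pr, (simp add: max_def)?)
  qed
  show ?case
  proof (induction m)
    case 0
    then show ?case by (simp add: stat_lpp_def)
  next
    case (Suc m)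
    have "?G (Suc n) (Suc m) = ?G (Suc n) m + q * ?c' !! m"
      by (simp only: 1 step row_r.simps(2) pr c' qc, (simp add: max_def)?)
    then show ?case by (simp add: Suc distrib_left del: stat_row.simps)
  qed
qed

lemma bulk_le_stat:
  assumes "p > 0" "q > 0" "\<And>i. rs !! i \<ge> 0" "\<And>j. cs !! j \<ge> 0"
  shows "bulk_lpp n m \<omega> \<le> stat_lpp p q n m cs rs \<omega>"
  unfolding bulk_lpp_def stat_lpp_def using assms by (intro lpp_mono) (auto intro!: mult_nonneg_nonneg sum_nonneg)

text \<open>
  Comparison with stationary models of slightly different parameters replaces the usual analysis of
  the exit point: beyond \<open>k\<close> the boundary data are dominated by those with a larger factor, lowered
  by the amount gained up to \<open>k\<close>.
\<close>

lemma stat_le_bulk_or_perturbed: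
  assumes pos: "p > 0" "q > 0" "\<And>i. rs !! i \<ge> 0" "\<And>j. cs !! j \<ge> 0" and p': "p \<le> p'" and q'': "q \<le> q''"
    and R_def: "R = (\<Sum>i<k. rs !! i)" and C_def: "C = (\<Sum>j<k. cs !! j)"
  shows "stat_lpp p q n m cs rs \<omega> \<le> max (bulk_lpp n m \<omega> + max (p * R) (q * C))
     (max (stat_lpp p' q' n m cs rs \<omega> - (p' - p) * R) (stat_lpp p'' q'' n m cs rs \<omega> - (q'' - q) * C))"
proof -
  let ?K = "max (p * R) (q * C)"
  have key: "a * (\<Sum>i<l. u !! i) \<le> max (a * (\<Sum>i<k. u !! i)) (b * (\<Sum>i<l. u !! i) - (b - a) * (\<Sum>i<k. u !! i))"
    if "\<And>i. u !! i \<ge> 0" "0 < a" "a \<le> b" for a b :: real and u l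
  proof (cases "l \<le> k")
    case True
    then have "(\<Sum>i<l. u !! i) \<le> (\<Sum>i<k. u !! i)" using that by (intro sum_mono2) auto
    then show ?thesis using that by (intro max.coboundedI1) simp
  next
    case False
    then have "(\<Sum>i<k. u !! i) \<le> (\<Sum>i<l. u !! i)" using that by (intro sum_mono2) auto
    then have "(b - a) * (\<Sum>i<k. u !! i) \<le> (b - a) * (\<Sum>i<l. u !! i)" using that by (intro mult_left_mono) auto
    then show ?thesis by (intro max.coboundedI2) (simp add: algebra_simps)
  qed
  \<comment> \<open>Column 0 is handled by the first perturbed model through p' >= p and row 0 by
    the second through q'' >= q. The parameters q' and p'' remain free, so that each perturbed pair
    can again be chosen conjugate.\<close>
  have "stat_lpp p q n m cs rs \<omega> \<le>
    lpp (\<lambda>i. max (0 + ?K) (max (p' * (\<Sum>k<i. rs !! k) + - ((p' - p) * R)) (p'' * (\<Sum>k<i. rs !! k) + - ((q'' - q) * C))))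
        (\<lambda>j. max (0 + ?K) (max (q' * (\<Sum>k<j. cs !! k) + - ((p' - p) * R)) (q'' * (\<Sum>k<j. cs !! k) + - ((q'' - q) * C))))
        (\<lambda>i j. \<omega> !! i !! j) n m"
    unfolding stat_lpp_def
  proof (rule lpp_mono)
    fix i
    show "p * (\<Sum>k<i. rs !! k) \<le> max (0 + ?K) (max (p' * (\<Sum>k<i. rs !! k) + - ((p' - p) * R)) (p'' * (\<Sum>k<i. rs !! k) + - ((q'' - q) * C)))"
      using key[OF pos(3) pos(1) p', of i] unfolding R_def[symmetric] by auto
  next
    fix j
    show "q * (\<Sum>k<j. cs !! k) \<le> max (0 + ?K) (max (q' * (\<Sum>k<j. cs !! k) + - ((p' - p) * R)) (q'' * (\<Sum>k<j. cs !! k) + - ((q'' - q) * C)))"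
      using key[OF pos(4) pos(2) q'', of j] unfolding C_def[symmetric] by auto
  qed
  also have "\<dots> = max (bulk_lpp n m \<omega> + ?K)
     (max (stat_lpp p' q' n m cs rs \<omega> + - ((p' - p) * R)) (stat_lpp p'' q'' n m cs rs \<omega> + - ((q'' - q) * C)))"
    by (simp only: lpp_max lpp_add_const bulk_lpp_def stat_lpp_def)
  finally show ?thesis by simp
qed

lemma lpp_measurable [measurable (raw)]:
  assumes [measurable]: "\<And>i. (\<lambda>x. A x i) \<in> borel_measurable M" "\<And>i. (\<lambda>x. B x i) \<in> borel_measurable M"
    "\<And>i j. (\<lambda>x. w x i j) \<in> borel_measurable M"
  shows "(\<lambda>x. lpp (A x) (B x) (w x) n m) \<in> borel_measurable M"
proof (induction n arbitrary: m)
  case (Suc n)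
  note [measurable] = Suc
  show ?case
  proof (induction m)
    case (Suc m)
    note [measurable] = Suc
    show ?case by simp
  qed simp
qed simp

lemma bulk_lpp_measurable [measurable (raw)]:
  assumes [measurable]: "f \<in> measurable M iid_field"
  shows "(\<lambda>x. bulk_lpp n m (f x)) \<in> borel_measurable M"
  unfolding bulk_lpp_def by measurable

subsection \<open>Law of large numbers\<close>

definition env :: "(real stream \<times> real stream \<times> real stream stream) measure" where
  "env = iid_expo \<Otimes>\<^sub>M (iid_expo \<Otimes>\<^sub>M iid_field)"

lemma sets_env [measurable_cong]:
  "sets env = sets (iid_expo \<Otimes>\<^sub>M (iid_expo \<Otimes>\<^sub>M iid_field))"
  by (simp add: env_def)

lemma space_expos' [simp]: "space iid_field = UNIV"
  by (simp add: space_stream_space)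

lemma space_env [simp]: "space env = UNIV"
  by (simp add: env_def space_pair_measure)

interpretation env': pair_prob_space "iid_expo" "iid_field" ..
interpretation env'': pair_prob_space "iid_expo" "iid_expo \<Otimes>\<^sub>M iid_field" ..

interpretation env: prob_space env
  unfolding env_def by (rule env''.prob_space_axioms)

lemma nn_integral_env:
  assumes [measurable]: "f \<in> borel_measurable env"
  shows "(\<integral>\<^sup>+x. f x \<partial>env) = (\<integral>\<^sup>+cs. \<integral>\<^sup>+rs. \<integral>\<^sup>+\<omega>. f (cs, rs, \<omega>) \<partial>iid_field \<partial>iid_expo \<partial>iid_expo)"
proof -
  have "(\<integral>\<^sup>+x. f x \<partial>env) = (\<integral>\<^sup>+cs. \<integral>\<^sup>+y. f (cs, y) \<partial>(iid_expo \<Otimes>\<^sub>M iid_field) \<partial>iid_expo)"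
    unfolding env_def by (rule sigma_finite_measure.nn_integral_fst[symmetric, OF prob_space_imp_sigma_finite[OF env'.prob_space_axioms]]) (use assms in \<open>simp add: env_def\<close>)
  also have "\<dots> = (\<integral>\<^sup>+cs. \<integral>\<^sup>+rs. \<integral>\<^sup>+\<omega>. f (cs, rs, \<omega>) \<partial>iid_field \<partial>iid_expo \<partial>iid_expo)"
    by (intro nn_integral_cong expos'.nn_integral_fst[symmetric]) measurable
  finally show ?thesis .
qed

lemma prefix_dependent_sum: "prefix_dependent m (\<lambda>s. F (\<Sum>j<m. s !! j))"
  unfolding prefix_dependent_def by (intro allI impI arg_cong[where f=F] sum.cong) auto

text \<open>The stream may change with T, because it will be row number \<open>label \<nu> T\<close>
  of the stationary model; only its law on finite prefixes is prescribed.\<close>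

lemma whp_sum_concentration:
  fixes X :: "real \<Rightarrow> (real stream \<times> real stream \<times> real stream stream) \<Rightarrow> real stream"
  assumes [measurable]: "\<And>T. X T \<in> measurable env iid_expo"
    and law: "\<And>T m f. f \<in> borel_measurable iid_expo \<Longrightarrow> prefix_dependent m f \<Longrightarrow>
      (\<integral>\<^sup>+x. f (X T x) \<partial>env) = (\<integral>\<^sup>+s. f s \<partial>iid_expo)"
    and \<mu>: "\<mu> \<ge> 0" and \<delta>: "\<delta> > 0"
  shows "whp env (\<lambda>T x. \<bar>(\<Sum>j<label \<mu> T. X T x !! j) - \<mu> * T\<bar> \<le> \<delta> * T)"
proof -
  \<comment> \<open>\<open>c * T\<close> bounds the number of summands and is positive even for
    \<mu> = 0. The choice of e with \<open>e * c = \<delta> / 2\<close> keeps half of \<delta> for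
    the rounding in \<open>label\<close>.\<close>
  define c where "c = \<mu> + \<delta>"
  define e where "e = \<delta> / 2 / c"
  have c: "c > 0" and e: "0 < e" "e \<le> 2" and ec: "e * c = \<delta> / 2"
    using \<mu> \<delta> by (auto simp: c_def e_def field_simps)
  let ?B = "\<lambda>T s. \<bar>(\<Sum>j<label \<mu> T. s !! j) - real (label \<mu> T)\<bar> \<ge> e * (c * T)"
  have eq: "env.prob {x \<in> space env. ?B T (X T x)} = measure iid_expo {s. ?B T s}" for T
  proof -
    have [measurable]: "{s. ?B T s} \<in> sets iid_expo" by (rule expos_Collect) measurable
    have S: "{x \<in> space env. ?B T (X T x)} \<in> sets env" by measurable
    have "emeasure env {x \<in> space env. ?B T (X T x)} = (\<integral>\<^sup>+x. indicator {s. ?B T s} (X T x) \<partial>env)"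
      unfolding nn_integral_indicator[OF S, symmetric] by (intro nn_integral_cong) (simp add: indicator_def)
    also have "\<dots> = (\<integral>\<^sup>+s. indicator {s. ?B T s} s \<partial>iid_expo)"
    proof (rule law[where m="label \<mu> T"])
      have "indicator {s. ?B T s} = (\<lambda>s. (\<lambda>y. indicator {y. \<bar>y - real (label \<mu> T)\<bar> \<ge> e * (c * T)} y :: ennreal) (\<Sum>j<label \<mu> T. s !! j))"
        by (auto simp: indicator_def)
      then show "prefix_dependent (label \<mu> T) (indicator {s. ?B T s} :: _ \<Rightarrow> ennreal)"
        using prefix_dependent_sum by metis
    qed measurable
    also have "\<dots> = emeasure iid_expo {s. ?B T s}" by simp
    finally show ?thesis by (simp add: measure_def)
  qed
  have "\<forall>\<^sub>F T in at_top. env.prob {x \<in> space env. ?B T (X T x)} \<le> 2 * exp (- (e\<^sup>2 / 8) * (c * T))"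
    using eventually_ge_at_top[of 0]
  proof eventually_elim
    case (elim T)
    have "real (label \<mu> T) \<le> c * T" using label_le[OF \<mu> elim] \<delta> elim by (simp add: c_def distrib_right) (metis add_increasing2 less_imp_le mult_nonneg_nonneg)
    then show ?case unfolding eq by (rule expos_sum_concentration[OF e])
  qed
  note bound = this
  have "((\<lambda>T. env.prob {x \<in> space env. ?B T (X T x)}) \<longlongrightarrow> 0) at_top"
  proof (rule tendsto_sandwich)
    show "\<forall>\<^sub>F T in at_top. 0 \<le> env.prob {x \<in> space env. ?B T (X T x)}" by (rule always_eventually) simp
    show "\<forall>\<^sub>F T in at_top. env.prob {x \<in> space env. ?B T (X T x)} \<le> 2 * exp (- (e\<^sup>2 / 8) * (c * T))"
      by (rule bound)
    show "((\<lambda>T. 2 * exp (- (e\<^sup>2 / 8) * (c * T))) \<longlongrightarrow> 0) at_top" using e c by real_asymp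
  qed (rule tendsto_const)
  then have "whp env (\<lambda>T x. \<not> ?B T (X T x))"
    by (intro env.whp_complement) measurable
  then show ?thesis
  proof (rule whp_monoI[where c="2 / \<delta>"])
    fix T x assume T: "2 / \<delta> < T" and B: "\<not> ?B T (X T x)"
    have "\<delta> * T \<ge> 2" using T \<delta> by (simp add: field_simps)
    moreover have "e * (c * T) = \<delta> * T / 2" using ec by (simp add: mult.assoc[symmetric])
    moreover have "T \<ge> 0" using T \<delta> by (meson divide_nonneg_pos less_imp_le order_trans zero_le_numeral)
    ultimately show "\<bar>(\<Sum>j<label \<mu> T. X T x !! j) - \<mu> * T\<bar> \<le> \<delta> * T"
      using B label_le[OF \<mu>, of T] label_ge[of \<mu> T] by linarith
  qed
qed

lemma whp_sum_cs:
  assumes "\<mu> \<ge> 0" "\<delta> > 0"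
  shows "whp env (\<lambda>T x. \<bar>(\<Sum>j<label \<mu> T. fst x !! j) - \<mu> * T\<bar> \<le> \<delta> * T)"
  by (rule whp_sum_concentration[OF _ _ assms])
     (auto simp: nn_integral_env expos.emeasure_space_1[simplified] expos'.emeasure_space_1[simplified])

lemma whp_sum_rs:
  assumes "\<mu> \<ge> 0" "\<delta> > 0"
  shows "whp env (\<lambda>T x. \<bar>(\<Sum>j<label \<mu> T. fst (snd x) !! j) - \<mu> * T\<bar> \<le> \<delta> * T)"
  by (rule whp_sum_concentration[OF _ _ assms])
     (auto simp: nn_integral_env expos.emeasure_space_1[simplified] expos'.emeasure_space_1[simplified])

lemma whp_stat_lpp:
  assumes p: "p > 0" and q: "q > 0" and pq: "1 / p + 1 / q = 1" and \<nu>: "\<nu> \<ge> 0" and \<mu>: "\<mu> \<ge> 0" and \<delta>: "\<delta> > 0"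
  shows "whp env (\<lambda>T (cs, rs, \<omega>). \<bar>stat_lpp p q (label \<nu> T) (label \<mu> T) cs rs \<omega> - (p * \<nu> + q * \<mu>) * T\<bar> \<le> \<delta> * T)"
proof -
  define e where "e = \<delta> / (p + q)"
  have e: "e > 0" using p q \<delta> by (simp add: e_def)
  have pqe: "p * e + q * e = \<delta>" using p q distrib_right[of p q e] by (simp add: e_def)
  have "whp env (\<lambda>T x. \<bar>(\<Sum>j<label \<mu> T. stat_row p q (label \<nu> T) (fst x) (fst (snd x)) (snd (snd x)) !! j) - \<mu> * T\<bar> \<le> e * T)"
  proof (rule whp_sum_concentration[OF _ _ \<mu> e])
    fix T m and f :: "real stream \<Rightarrow> ennreal"
    assume [measurable]: "f \<in> borel_measurable iid_expo" and m: "prefix_dependent m f"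
    show "(\<integral>\<^sup>+x. f (stat_row p q (label \<nu> T) (fst x) (fst (snd x)) (snd (snd x))) \<partial>env) = (\<integral>\<^sup>+s. f s \<partial>iid_expo)"
      by (subst nn_integral_env, measurable)
         (simp add: stat_row_stationary[OF p q pq _ m])
  qed measurable
  from env.whp_conj[OF this whp_sum_rs[OF \<nu> e]] show ?thesis
  proof (rule whp_mono, intro always_eventually allI ballI impI)
    fix T x
    assume *: "\<bar>(\<Sum>j<label \<mu> T. stat_row p q (label \<nu> T) (fst x) (fst (snd x)) (snd (snd x)) !! j) - \<mu> * T\<bar> \<le> e * T \<and>
       \<bar>(\<Sum>j<label \<nu> T. fst (snd x) !! j) - \<nu> * T\<bar> \<le> e * T"
    obtain cs rs \<omega> where x: "x = (cs, rs, \<omega>)" by (cases x)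
    define a where "a = (\<Sum>j<label \<nu> T. rs !! j) - \<nu> * T"
    define b where "b = (\<Sum>j<label \<mu> T. stat_row p q (label \<nu> T) cs rs \<omega> !! j) - \<mu> * T"
    have "stat_lpp p q (label \<nu> T) (label \<mu> T) cs rs \<omega> - (p * \<nu> + q * \<mu>) * T = p * a + q * b"
      by (simp add: stat_lpp_eq[OF p q] a_def b_def algebra_simps)
    also have "\<bar>\<dots>\<bar> \<le> p * \<bar>a\<bar> + q * \<bar>b\<bar>"
      using p q abs_triangle_ineq[of "p * a" "q * b"] by (simp add: abs_mult)
    also have "\<dots> \<le> p * (e * T) + q * (e * T)"
      using * p q by (intro add_mono mult_left_mono) (auto simp: a_def b_def x)
    also have "\<dots> = \<delta> * T" using pqe by (simp flip: mult.assoc distrib_right)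
    finally show "case x of (cs, rs, \<omega>) \<Rightarrow> \<bar>stat_lpp p q (label \<nu> T) (label \<mu> T) cs rs \<omega> - (p * \<nu> + q * \<mu>) * T\<bar> \<le> \<delta> * T"
      by (simp add: x)
  qed
qed

lemma AE_env_nonneg: "AE x in env. (\<forall>i. fst x !! i \<ge> 0) \<and> (\<forall>i. fst (snd x) !! i \<ge> 0)"
proof -
  have P: "AE s in iid_expo. \<forall>i. s !! i \<ge> 0"
    using expo.AE_stream_all[OF _ AE_expo_nonneg] by (simp add: stream_all_def sset_range)
  have [measurable]: "Measurable.pred iid_expo (\<lambda>s. \<forall>i. s !! i \<ge> 0)" by measurable
  have "AE x in env. \<forall>i. fst x !! i \<ge> 0"
    unfolding env_def
  proof (rule env''.AE_pair_measure)
    show "AE x in iid_expo. AE y in iid_expo \<Otimes>\<^sub>M iid_field. \<forall>i. fst (x, y) !! i \<ge> 0"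
      using P by eventually_elim simp
  qed measurable
  moreover have "AE x in env. \<forall>i. fst (snd x) !! i \<ge> 0"
    unfolding env_def
  proof (rule env''.AE_pair_measure)
    have "AE y in iid_expo \<Otimes>\<^sub>M iid_field. \<forall>i. fst y !! i \<ge> 0"
    proof (rule expos_expos'.AE_pair_measure)
      show "AE x in iid_expo. AE y in iid_field. \<forall>i. fst (x, y) !! i \<ge> 0"
        using P by eventually_elim simp
    qed measurable
    then show "AE x in iid_expo. AE y in iid_expo \<Otimes>\<^sub>M iid_field.
      \<forall>i. fst (snd (x, y)) !! i \<ge> 0" by simp
  qed measurable
  ultimately show ?thesis by eventually_elim simp
qed

lemma prob_env_snd:
  assumes [measurable]: "Measurable.pred iid_field P"
  shows "env.prob {x \<in> space env. P (snd (snd x))} = measure iid_field {\<omega>. P \<omega>}"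
proof -
  have [measurable]: "{\<omega>. P \<omega>} \<in> sets iid_field"
    using assms by (simp add: pred_def)
  have S: "{x \<in> space env. P (snd (snd x))} \<in> sets env" by measurable
  have "emeasure env {x \<in> space env. P (snd (snd x))} = (\<integral>\<^sup>+x. indicator {\<omega>. P \<omega>} (snd (snd x)) \<partial>env)"
    unfolding nn_integral_indicator[OF S, symmetric] by (intro nn_integral_cong) (simp add: indicator_def)
  also have "\<dots> = emeasure iid_field {\<omega>. P \<omega>}"
    by (subst nn_integral_env) (auto simp: expos.emeasure_space_1[simplified])
  finally show ?thesis by (simp add: measure_def)
qed

text \<open>With p = 1 + x and q = 1 + 1 / x the parameter x > 0 runs through all conjugate pairs of
  positive numbers.\<close>

lemma conjugate_sum:
  fixes x :: real
  assumes "x > 0"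
  shows "1 / (1 + x) + 1 / (1 + 1 / x) = 1"
  using assms by (simp add: field_simps)

lemma bulk_lpp_upper:
  assumes \<nu>: "\<nu> > 0" and \<mu>: "\<mu> > 0" and \<delta>: "\<delta> > 0"
  shows "((\<lambda>T. measure iid_field
    {\<omega>. bulk_lpp (label \<nu> T) (label \<mu> T) \<omega> > ((sqrt \<nu> + sqrt \<mu>)\<^sup>2 + \<delta>) * T}) \<longlongrightarrow> 0) at_top"
proof -
  \<comment> \<open>The minimiser of (1 + x) \<nu> + (1 + 1 / x) \<mu>, so the best upper bound
    among the stationary models. Its value is (sqrt \<nu> + sqrt \<mu>)^2.\<close>
  define x where "x = sqrt \<mu> / sqrt \<nu>"
  have x: "x > 0" using \<nu> \<mu> by (simp add: x_def)
  have val: "(1 + x) * \<nu> + (1 + 1 / x) * \<mu> = (sqrt \<nu> + sqrt \<mu>)\<^sup>2"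
  proof -
    have 1: "sqrt \<nu> * sqrt \<nu> = \<nu>" "sqrt \<mu> * sqrt \<mu> = \<mu>" using \<nu> \<mu> by simp_all
    have "x * \<nu> = sqrt \<mu> * sqrt \<nu>" using \<nu> 1(1) by (simp add: x_def field_simps)
    moreover have "1 / x * \<mu> = sqrt \<nu> * sqrt \<mu>" using \<mu> 1(2) by (simp add: x_def field_simps)
    ultimately show ?thesis using \<nu> \<mu> by (simp add: algebra_simps power2_eq_square)
  qed
  have "whp env (\<lambda>T (cs, rs, \<omega>). \<bar>stat_lpp (1 + x) (1 + 1 / x) (label \<nu> T) (label \<mu> T) cs rs \<omega> - ((1 + x) * \<nu> + (1 + 1 / x) * \<mu>) * T\<bar> \<le> \<delta> * T)"
    using x \<nu> \<mu> \<delta> conjugate_sum[OF x] by (intro whp_stat_lpp) (auto intro: add_pos_pos)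
  from env.whp_conj[OF this env.whp_AE[OF AE_env_nonneg]]
  have "whp env (\<lambda>T y. \<not> bulk_lpp (label \<nu> T) (label \<mu> T) (snd (snd y)) > ((sqrt \<nu> + sqrt \<mu>)\<^sup>2 + \<delta>) * T)"
  proof (rule whp_mono, intro always_eventually allI ballI impI)
    fix T y
    assume *: "(case y of (cs, rs, \<omega>) \<Rightarrow> \<bar>stat_lpp (1 + x) (1 + 1 / x) (label \<nu> T) (label \<mu> T) cs rs \<omega> - ((1 + x) * \<nu> + (1 + 1 / x) * \<mu>) * T\<bar> \<le> \<delta> * T) \<and>
      (\<forall>i. fst y !! i \<ge> 0) \<and> (\<forall>i. fst (snd y) !! i \<ge> 0)"
    obtain cs rs \<omega> where y: "y = (cs, rs, \<omega>)" by (cases y)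
    have "bulk_lpp (label \<nu> T) (label \<mu> T) \<omega> \<le> stat_lpp (1 + x) (1 + 1 / x) (label \<nu> T) (label \<mu> T) cs rs \<omega>"
      using * x by (intro bulk_le_stat) (auto simp: y intro: add_pos_pos)
    then show "\<not> bulk_lpp (label \<nu> T) (label \<mu> T) (snd (snd y)) > ((sqrt \<nu> + sqrt \<mu>)\<^sup>2 + \<delta>) * T"
      using * unfolding val y by (simp add: distrib_right) linarith
  qed
  then have "((\<lambda>T. env.prob {y \<in> space env. bulk_lpp (label \<nu> T) (label \<mu> T) (snd (snd y)) > ((sqrt \<nu> + sqrt \<mu>)\<^sup>2 + \<delta>) * T}) \<longlongrightarrow> 0) at_top"
    by (rule env.whp_not_tendsto_0)
  then show ?thesis by (subst (asm) prob_env_snd) auto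
qed

text \<open>At the minimiser x a relative change s of the parameter costs only h s^2, whereas the
  larger boundary factor gains a multiple of s \<kappa> T up to index \<kappa> T. For small s the
  perturbed terms of \<open>stat_le_bulk_or_perturbed\<close> therefore stay below the stationary
  passage time, and the maximum must come from the bulk term, up to a boundary contribution of order
  \<kappa> T.\<close>

lemma bulk_lpp_lower:
  assumes \<nu>: "\<nu> > 0" and \<mu>: "\<mu> > 0" and \<delta>: "\<delta> > 0"
  shows "((\<lambda>T. measure iid_field
    {\<omega>. bulk_lpp (label \<nu> T) (label \<mu> T) \<omega> < ((sqrt \<nu> + sqrt \<mu>)\<^sup>2 - \<delta>) * T}) \<longlongrightarrow> 0) at_top"
proof -
  define x where "x = sqrt \<mu> / sqrt \<nu>"
  define g where "g = (sqrt \<nu> + sqrt \<mu>)\<^sup>2"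
  define h where "h = sqrt \<nu> * sqrt \<mu>"
  have x: "x > 0" and h: "h > 0" using \<nu> \<mu> by (simp_all add: x_def h_def)
  have sq: "sqrt \<nu> * sqrt \<nu> = \<nu>" "sqrt \<mu> * sqrt \<mu> = \<mu>" using \<nu> \<mu> by simp_all
  have x\<nu>: "x * \<nu> = h" using \<nu> sq(1) by (simp add: x_def h_def field_simps)
  have x\<mu>: "1 / x * \<mu> = h" using \<mu> sq(2) by (simp add: x_def h_def field_simps)
  have g: "g = \<nu> + \<mu> + 2 * h" using sq by (simp add: g_def h_def power2_eq_square algebra_simps)
  define K where "K = 2 + x + 1 / x"
  have K: "K > 0" using x by (simp add: K_def add_pos_pos)
  \<comment> \<open>The boundary sums up to \<kappa> T will be at most 2 \<kappa> T, so the boundary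
    costs at most 2 K \<kappa> T = \<delta> T / 2.\<close>
  define \<kappa> where "\<kappa> = \<delta> / (4 * K)"
  have \<kappa>: "\<kappa> > 0" using \<delta> K by (simp add: \<kappa>_def)
  \<comment> \<open>So small that the quadratic cost \<open>h * s\<^sup>2\<close> uses at most half
    of each of the gains x s \<kappa> and s \<kappa> / x.\<close>
  define s where "s = min (x * \<kappa> / (2 * h)) (\<kappa> / x / (2 * h))"
  have s: "s > 0" using x \<kappa> h by (simp add: s_def)
  have s1: "h * s \<le> x * \<kappa> / 2" and s2: "h * s \<le> \<kappa> / x / 2"
    using mult_left_mono[of s "x * \<kappa> / (2 * h)" h] mult_left_mono[of s "\<kappa> / x / (2 * h)" h] h
    by (simp_all add: s_def)
  \<comment> \<open>The other half of each gain absorbs the fluctuations: one e from each of two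
    passage times, x s or s / x times e from the boundary sum, and a third e for strictness.\<close>
  define e where "e = min (min \<kappa> (\<delta> / 4)) (min (x * s * \<kappa> / (2 * (3 + x * s))) (s / x * \<kappa> / (2 * (3 + s / x))))"
  have xs: "3 + x * s > 0" "3 + s / x > 0" using x s by (simp_all add: add_pos_pos)
  have e: "e > 0" "e \<le> \<kappa>" "e \<le> \<delta> / 4"
    using x s \<kappa> \<delta> xs by (simp add: e_def, unfold e_def, linarith+)
  have half: "k * u \<le> c / 2" if "u \<le> c / (2 * k)" "k > 0" for k u c :: real
    using that by (simp add: field_simps)
  have e1: "(3 + x * s) * e \<le> x * s * \<kappa> / 2"
    by (rule half[OF _ xs(1)]) (unfold e_def, linarith)
  have e2: "(3 + s / x) * e \<le> s / x * \<kappa> / 2"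
    by (rule half[OF _ xs(2)]) (unfold e_def, linarith)
  define x' where "x' = x * (1 + s)"
  define x'' where "x'' = x / (1 + s)"
  have x': "x' > 0" and x'': "x'' > 0" using x s by (simp_all add: x'_def x''_def)
  let ?val = "\<lambda>y. (1 + y) * \<nu> + (1 + 1 / y) * \<mu>"
  have val: "?val x = g" using x\<nu> x\<mu> by (simp add: g algebra_simps)
  \<comment> \<open>The first order terms of 1 + s and 1 / (1 + s) cancel in \<open>?val\<close>,
    which leaves the error h s^2.\<close>
  have s3: "1 / (1 + s) \<le> 1 - s + s\<^sup>2"
    using s by (simp add: field_simps power2_eq_square)
  have val': "?val x' \<le> g + h * s\<^sup>2"
  proof -
    have "x' * \<nu> = h * (1 + s)" using x\<nu> by (simp add: x'_def mult.commute mult.left_commute)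
    moreover have "1 / x' * \<mu> = 1 / x * \<mu> * (1 / (1 + s))" by (simp add: x'_def)
    then have "1 / x' * \<mu> = h * (1 / (1 + s))" by (simp only: x\<mu>)
    ultimately have "?val x' = \<nu> + \<mu> + h * (1 + s) + h * (1 / (1 + s))"
      by (simp only: distrib_right, simp?)
    also have "\<dots> \<le> \<nu> + \<mu> + h * (1 + s) + h * (1 - s + s\<^sup>2)"
      using mult_left_mono[OF s3, of h] h by simp
    finally show ?thesis by (simp add: g algebra_simps)
  qed
  have val'': "?val x'' \<le> g + h * s\<^sup>2"
  proof -
    have "x'' * \<nu> = h * (1 / (1 + s))" using x\<nu> by (simp add: x''_def)
    moreover have "1 / x'' * \<mu> = 1 / x * \<mu> * (1 + s)" by (simp add: x''_def mult.commute)
    then have "1 / x'' * \<mu> = h * (1 + s)" by (simp only: x\<mu>)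
    ultimately have "?val x'' = \<nu> + \<mu> + h * (1 + s) + h * (1 / (1 + s))"
      by (simp only: distrib_right, simp?)
    also have "\<dots> \<le> \<nu> + \<mu> + h * (1 + s) + h * (1 - s + s\<^sup>2)"
      using mult_left_mono[OF s3, of h] h by simp
    finally show ?thesis by (simp add: g algebra_simps)
  qed
  let ?G = "\<lambda>y T cs rs \<omega>. stat_lpp (1 + y) (1 + 1 / y) (label \<nu> T) (label \<mu> T) cs rs \<omega>"
  have G: "whp env (\<lambda>T (cs, rs, \<omega>). \<bar>?G y T cs rs \<omega> - ?val y * T\<bar> \<le> e * T)" if "y > 0" for y
    using that \<nu> \<mu> e conjugate_sum[OF that] by (intro whp_stat_lpp) (auto intro: add_pos_pos)
  have C: "whp env (\<lambda>T y. \<bar>(\<Sum>j<label \<kappa> T. fst y !! j) - \<kappa> * T\<bar> \<le> e * T)"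
    using \<kappa> e by (intro whp_sum_cs) auto
  have R: "whp env (\<lambda>T y. \<bar>(\<Sum>j<label \<kappa> T. fst (snd y) !! j) - \<kappa> * T\<bar> \<le> e * T)"
    using \<kappa> e by (intro whp_sum_rs) auto
  from env.whp_conj[OF env.whp_conj[OF G[OF x] env.whp_conj[OF G[OF x'] G[OF x'']]] env.whp_conj[OF env.whp_conj[OF C R] env.whp_AE[OF AE_env_nonneg]]]
  have "whp env (\<lambda>T y. \<not> bulk_lpp (label \<nu> T) (label \<mu> T) (snd (snd y)) < (g - \<delta>) * T)"
  proof (rule whp_monoI[where c=0])
    fix T y
    assume T: "T > (0 :: real)" and *: "((case y of (cs, rs, \<omega>) \<Rightarrow> \<bar>?G x T cs rs \<omega> - ?val x * T\<bar> \<le> e * T) \<and>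
      (case y of (cs, rs, \<omega>) \<Rightarrow> \<bar>?G x' T cs rs \<omega> - ?val x' * T\<bar> \<le> e * T) \<and>
      (case y of (cs, rs, \<omega>) \<Rightarrow> \<bar>?G x'' T cs rs \<omega> - ?val x'' * T\<bar> \<le> e * T)) \<and>
      (\<bar>(\<Sum>j<label \<kappa> T. fst y !! j) - \<kappa> * T\<bar> \<le> e * T \<and> \<bar>(\<Sum>j<label \<kappa> T. fst (snd y) !! j) - \<kappa> * T\<bar> \<le> e * T) \<and>
      (\<forall>i. 0 \<le> fst y !! i) \<and> (\<forall>i. 0 \<le> fst (snd y) !! i)"
    obtain cs rs \<omega> where y: "y = (cs, rs, \<omega>)" by (cases y)
    define R where "R = (\<Sum>j<label \<kappa> T. rs !! j)"
    define C where "C = (\<Sum>j<label \<kappa> T. cs !! j)"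
    have R: "\<bar>R - \<kappa> * T\<bar> \<le> e * T" and C: "\<bar>C - \<kappa> * T\<bar> \<le> e * T" using * by (auto simp: R_def C_def y)
    have pos: "\<And>i. rs !! i \<ge> 0" "\<And>i. cs !! i \<ge> 0" using * by (auto simp: y)
    define G where "G = ?G x T cs rs \<omega>"
    define G1 where "G1 = ?G x' T cs rs \<omega>"
    define G2 where "G2 = ?G x'' T cs rs \<omega>"
    have G: "G \<ge> g * T - e * T"
    proof -
      have "\<bar>G - g * T\<bar> \<le> e * T" using * by (simp only: G_def y val split_conv)
      then show ?thesis by linarith
    qed
    have G1: "G1 \<le> (g + h * s\<^sup>2) * T + e * T"
    proof -
      have "\<bar>G1 - ?val x' * T\<bar> \<le> e * T" using * by (simp add: G1_def y)
      then show ?thesis using mult_right_mono[OF val', of T] T by linarith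
    qed
    have G2: "G2 \<le> (g + h * s\<^sup>2) * T + e * T"
    proof -
      have "\<bar>G2 - ?val x'' * T\<bar> \<le> e * T" using * by (simp add: G2_def y)
      then show ?thesis using mult_right_mono[OF val'', of T] T by linarith
    qed
    define L where "L = bulk_lpp (label \<nu> T) (label \<mu> T) \<omega>"
    have le: "G \<le> max (L + max ((1 + x) * R) ((1 + 1 / x) * C))
       (max (G1 - ((1 + x') - (1 + x)) * R) (G2 - ((1 + 1 / x'') - (1 + 1 / x)) * C))"
      unfolding G_def G1_def G2_def L_def
      using x x' x'' s pos by (intro stat_le_bulk_or_perturbed[where k="label \<kappa> T"])
        (auto simp: R_def C_def x'_def x''_def add_pos_pos divide_right_mono)
    have d1: "(1 + x') - (1 + x) = x * s" by (simp add: x'_def algebra_simps)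
    have d2: "(1 + 1 / x'') - (1 + 1 / x) = s / x" using x s by (simp add: x''_def field_simps)
    have hs: "h * s\<^sup>2 \<le> x * \<kappa> / 2 * s" "h * s\<^sup>2 \<le> \<kappa> / x / 2 * s"
      using mult_right_mono[OF s1, of s] mult_right_mono[OF s2, of s] s by (simp_all add: power2_eq_square mult.assoc)
    have n1: "G1 - x * s * R < G"
    proof -
      have "x * s * R \<ge> x * s * (\<kappa> * T - e * T)" using R x s by (intro mult_left_mono) auto
      moreover have "h * s\<^sup>2 * T \<le> x * \<kappa> / 2 * s * T" using hs(1) T by (intro mult_right_mono) auto
      moreover have "(3 + x * s) * e * T \<le> x * s * \<kappa> / 2 * T" using e1 T by (intro mult_right_mono) auto
      moreover have "e * T > 0" using e T by simp
      ultimately show ?thesis using G1 G by (simp add: algebra_simps)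
    qed
    have n2: "G2 - s / x * C < G"
    proof -
      have "s / x * C \<ge> s / x * (\<kappa> * T - e * T)" using C x s by (intro mult_left_mono) auto
      moreover have "h * s\<^sup>2 * T \<le> \<kappa> / x / 2 * s * T" using hs(2) T by (intro mult_right_mono) auto
      moreover have "(3 + s / x) * e * T \<le> s / x * \<kappa> / 2 * T" using e2 T by (intro mult_right_mono) auto
      moreover have "e * T > 0" using e T by simp
      ultimately show ?thesis using G2 G by (simp add: algebra_simps)
    qed
    have "G \<le> L + max ((1 + x) * R) ((1 + 1 / x) * C)"
      using le n1 n2 unfolding d1 d2 by linarith
    moreover have "max ((1 + x) * R) ((1 + 1 / x) * C) \<le> K * (2 * \<kappa> * T)"
    proof -
      have "R \<le> 2 * \<kappa> * T" "C \<le> 2 * \<kappa> * T"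
        using R C mult_right_mono[OF e(2), of T] T by linarith+
      moreover have "R \<ge> 0" "C \<ge> 0" using pos by (simp_all add: R_def C_def sum_nonneg)
      ultimately show ?thesis using x \<kappa> T
        by (intro max.boundedI mult_mono) (auto simp: K_def)
    qed
    moreover have "K * (2 * \<kappa> * T) = \<delta> / 2 * T" using K by (simp add: \<kappa>_def)
    moreover have "e * T \<le> \<delta> / 4 * T" using e T by (intro mult_right_mono) auto
    moreover have "\<delta> * T > 0" using \<delta> T by simp
    ultimately show "\<not> bulk_lpp (label \<nu> T) (label \<mu> T) (snd (snd y)) < (g - \<delta>) * T"
      using G by (simp add: y L_def left_diff_distrib)
  qed
  then have "((\<lambda>T. env.prob {y \<in> space env. bulk_lpp (label \<nu> T) (label \<mu> T) (snd (snd y)) < (g - \<delta>) * T}) \<longlongrightarrow> 0) at_top"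
    by (rule env.whp_not_tendsto_0)
  then show ?thesis by (subst (asm) prob_env_snd) (auto simp: g_def)
qed

subsection \<open>The memoryless property\<close>

text \<open>Waiting times of a clock seen from time \<open>b\<close> on.\<close>

definition restart_at :: "nat \<Rightarrow> real \<Rightarrow> real stream \<Rightarrow> real stream" where
  "restart_at k b s = ((\<Sum>j\<le>k. s !! j) - b) ## sdrop (Suc k) s"

definition restart :: "real \<Rightarrow> real stream \<Rightarrow> real stream" where
  "restart b s = restart_at (LEAST k. b \<le> (\<Sum>j\<le>k. s !! j)) b s"

definition first_ring :: "nat \<Rightarrow> real \<Rightarrow> real stream \<Rightarrow> bool" where
  "first_ring k b s \<longleftrightarrow> (\<forall>i<k. (\<Sum>j\<le>i. s !! j) < b) \<and> b \<le> (\<Sum>j\<le>k. s !! j)"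

lemma first_ring_Least: "first_ring k b s \<Longrightarrow> (LEAST k. b \<le> (\<Sum>j\<le>k. s !! j)) = k"
  unfolding first_ring_def by (intro Least_equality) (auto simp: not_less[symmetric])

lemma first_ring_unique: "first_ring k b s \<Longrightarrow> first_ring l b s \<Longrightarrow> k = l"
  using first_ring_Least by metis

lemma first_ring_restart: "first_ring k b s \<Longrightarrow> restart b s = restart_at k b s"
  by (simp add: restart_def first_ring_Least)

lemma first_ring_0_Stream: "first_ring 0 b (x ## s) \<longleftrightarrow> b \<le> x"
  by (simp add: first_ring_def)

lemma first_ring_Suc_Stream: "first_ring (Suc k) b (x ## s) \<longleftrightarrow> x < b \<and> first_ring k (b - x) s"
proof -
  have "(\<Sum>j\<le>Suc i. (x ## s) !! j) = x + (\<Sum>j\<le>i. s !! j)" for i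
    by (simp add: sum.atMost_Suc_shift del: sum.atMost_Suc)
  then show ?thesis
    unfolding first_ring_def All_less_Suc2 by (auto simp: algebra_simps)
qed

lemma restart_at_0_Stream: "restart_at 0 b (x ## s) = (x - b) ## s"
  by (simp add: restart_at_def)

lemma restart_at_Suc_Stream: "restart_at (Suc k) b (x ## s) = restart_at k (b - x) s"
  by (simp add: restart_at_def sum.atMost_Suc_shift del: sum.atMost_Suc)

lemma restart_at_measurable [measurable (raw)]:
  assumes [measurable]: "f \<in> borel_measurable M" "g \<in> measurable M iid_expo"
  shows "(\<lambda>x. restart_at k (f x) (g x)) \<in> measurable M iid_expo"
  unfolding restart_at_def by measurable

lemma first_ring_measurable [measurable (raw)]:
  assumes [measurable]: "f \<in> borel_measurable M" "g \<in> measurable M iid_expo"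
  shows "Measurable.pred M (\<lambda>x. first_ring k (f x) (g x))"
  unfolding first_ring_def by measurable

lemma restart_measurable [measurable (raw)]:
  assumes [measurable]: "f \<in> borel_measurable M" "g \<in> measurable M iid_expo"
  shows "(\<lambda>x. restart (f x) (g x)) \<in> measurable M iid_expo"
  unfolding restart_def
  by (rule measurable_compose_countable[where f="\<lambda>k x. restart_at k (f x) (g x)"]) measurable

text \<open>Passes from the Poisson weight of k rings to that of k + 1 rings, the integration
  variable being the first ring.\<close>

lemma nn_integral_power_poly:
  fixes b :: real
  assumes "b \<ge> 0"
  shows "(\<integral>\<^sup>+x. ennreal ((b - x) ^ k / fact k) * indicator {0..b} x \<partial>lborel) = ennreal (b ^ Suc k / fact (Suc k))"
proof -
  let ?F = "\<lambda>x. - ((b - x) ^ Suc k / fact (Suc k))"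
  have "(\<integral>\<^sup>+x. ennreal ((b - x) ^ k / fact k) * indicator {0..b} x \<partial>lborel) = ?F b - ?F 0"
  proof (rule nn_integral_FTC_Icc)
    fix x assume "x \<in> {0..b}"
    have "((\<lambda>x. - ((b - x) ^ Suc k / fact (Suc k))) has_field_derivative
        - ((real (Suc k) * (b - x) ^ k * (0 - 1)) / fact (Suc k))) (at x)"
      by (rule derivative_eq_intros refl | simp)+
    moreover have "- ((real (Suc k) * (b - x) ^ k * (0 - 1)) / fact (Suc k)) = (b - x) ^ k / fact k"
      by (simp add: fact_Suc del: of_nat_Suc)
    ultimately show "(?F has_real_derivative ((b - x) ^ k / fact k)) (at x)"
      by simp
  qed (use assms in auto)
  then show ?thesis by simp
qed

text \<open>The number of rings before time \<open>b\<close> is a Poisson variable, independent of the clock seen from \<open>b\<close> on.\<close>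

lemma nn_integral_restart_at:
  fixes f :: "real stream \<Rightarrow> ennreal"
  assumes [measurable]: "f \<in> borel_measurable iid_expo" and "b \<ge> 0"
  shows "(\<integral>\<^sup>+s. f (restart_at k b s) * of_bool (first_ring k b s) \<partial>iid_expo)
       = ennreal (exp (- b) * b ^ k / fact k) * (\<integral>\<^sup>+s. f s \<partial>iid_expo)"
  using assms(2)
proof (induction k arbitrary: b)
  case 0
  let ?P = "iid_expo"
  have m: "(\<lambda>x. \<integral>\<^sup>+s. f ((x - b) ## s) \<partial>?P) \<in> borel_measurable borel" by measurable
  have "(\<integral>\<^sup>+s. f (restart_at 0 b s) * of_bool (first_ring 0 b s) \<partial>?P)
     = (\<integral>\<^sup>+x. \<integral>\<^sup>+s. f ((x - b) ## s) * of_bool (b \<le> x) \<partial>?P \<partial>expo)"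
    by (subst expo.nn_integral_stream_space) (auto simp: first_ring_0_Stream restart_at_0_Stream)
  also have "\<dots> = (\<integral>\<^sup>+x. (\<integral>\<^sup>+s. f ((x - b) ## s) \<partial>?P) * of_bool (b \<le> x) \<partial>expo)"
    by (intro nn_integral_cong nn_integral_multc) measurable
  also have "\<dots> = (\<integral>\<^sup>+x. ennreal (exp (- x)) * ((\<integral>\<^sup>+s. f ((x - b) ## s) \<partial>?P) * of_bool (b \<le> x)) * indicator {0..} x \<partial>lborel)"
    by (rule nn_integral_expo) measurable
  also have "\<dots> = (\<integral>\<^sup>+y. ennreal (exp (- (b + 1 * y))) * ((\<integral>\<^sup>+s. f ((b + 1 * y - b) ## s) \<partial>?P) * of_bool (b \<le> b + 1 * y)) * indicator {0..} (b + 1 * y) \<partial>lborel)"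
    by (subst nn_integral_real_affine[where c=1 and t=b]) auto
  also have "\<dots> = (\<integral>\<^sup>+y. ennreal (exp (- b)) * (ennreal (exp (- y)) * (\<integral>\<^sup>+s. f (y ## s) \<partial>?P) * indicator {0..} y) \<partial>lborel)"
  proof (rule nn_integral_cong)
    fix y
    have "ennreal (exp (- (b + 1 * y))) = ennreal (exp (- b)) * ennreal (exp (- y))"
      by (simp flip: ennreal_mult exp_add)
    then show "ennreal (exp (- (b + 1 * y))) * ((\<integral>\<^sup>+s. f ((b + 1 * y - b) ## s) \<partial>?P) * of_bool (b \<le> b + 1 * y)) * indicator {0..} (b + 1 * y)
      = ennreal (exp (- b)) * (ennreal (exp (- y)) * (\<integral>\<^sup>+s. f (y ## s) \<partial>?P) * indicator {0..} y)"
      using 0 by (auto simp: indicator_def mult.assoc)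
  qed
  also have "\<dots> = ennreal (exp (- b)) * (\<integral>\<^sup>+y. ennreal (exp (- y)) * (\<integral>\<^sup>+s. f (y ## s) \<partial>?P) * indicator {0..} y \<partial>lborel)"
    by (rule nn_integral_cmult) measurable
  also have "(\<integral>\<^sup>+y. ennreal (exp (- y)) * (\<integral>\<^sup>+s. f (y ## s) \<partial>?P) * indicator {0..} y \<partial>lborel) = (\<integral>\<^sup>+y. \<integral>\<^sup>+s. f (y ## s) \<partial>?P \<partial>expo)"
    by (rule nn_integral_expo[symmetric]) measurable
  also have "\<dots> = (\<integral>\<^sup>+s. f s \<partial>?P)"
    by (rule expo.nn_integral_stream_space[symmetric]) measurable
  finally show ?case by simp
next
  case (Suc k)
  let ?P = "iid_expo"
  \<comment> \<open>In the chain below the first ring x splits off and leaves the horizon b - x. The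
    factors exp (- x) and exp (- (b - x)) combine to exp (- b), so only a convolution integral
    remains.\<close>
  define I where "I = (\<integral>\<^sup>+s. f s \<partial>?P)"
  have "(\<integral>\<^sup>+s. f (restart_at (Suc k) b s) * of_bool (first_ring (Suc k) b s) \<partial>?P)
     = (\<integral>\<^sup>+x. \<integral>\<^sup>+s. f (restart_at k (b - x) s) * of_bool (first_ring k (b - x) s) * of_bool (x < b) \<partial>?P \<partial>expo)"
    by (subst expo.nn_integral_stream_space)
       (auto simp: first_ring_Suc_Stream restart_at_Suc_Stream of_bool_conj mult_ac intro!: nn_integral_cong)
  also have "\<dots> = (\<integral>\<^sup>+x. (\<integral>\<^sup>+s. f (restart_at k (b - x) s) * of_bool (first_ring k (b - x) s) \<partial>?P) * of_bool (x < b) \<partial>expo)"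
    by (intro nn_integral_cong nn_integral_multc) measurable
  also have "\<dots> = (\<integral>\<^sup>+x. ennreal (exp (- (b - x)) * (b - x) ^ k / fact k) * I * of_bool (x < b) \<partial>expo)"
    by (intro nn_integral_cong) (auto simp: Suc.IH I_def)
  also have "\<dots> = (\<integral>\<^sup>+x. ennreal (exp (- x)) * (ennreal (exp (- (b - x)) * (b - x) ^ k / fact k) * I * of_bool (x < b)) * indicator {0..} x \<partial>lborel)"
    by (rule nn_integral_expo) measurable
  also have "\<dots> = (\<integral>\<^sup>+x. ennreal (exp (- b)) * I * (ennreal ((b - x) ^ k / fact k) * indicator {0..b} x) \<partial>lborel)"
  proof (rule nn_integral_cong_AE)
    show "AE x in lborel. ennreal (exp (- x)) * (ennreal (exp (- (b - x)) * (b - x) ^ k / fact k) * I * of_bool (x < b)) * indicator {0..} x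
       = ennreal (exp (- b)) * I * (ennreal ((b - x) ^ k / fact k) * indicator {0..b} x)"
      using AE_lborel_singleton[of b]
    proof eventually_elim
      case (elim x)
      show ?case
      proof (cases "0 \<le> x \<and> x < b")
        case True
        have "exp (- x) * (exp (- (b - x)) * (b - x) ^ k / fact k) = exp (- b) * ((b - x) ^ k / fact k)"
          by (simp flip: exp_add)
        then have "ennreal (exp (- x)) * ennreal (exp (- (b - x)) * (b - x) ^ k / fact k) = ennreal (exp (- b)) * ennreal ((b - x) ^ k / fact k)"
          using True by (simp flip: ennreal_mult)
        note eq = this
        have "ennreal (exp (- x)) * (ennreal (exp (- (b - x)) * (b - x) ^ k / fact k) * I * of_bool (x < b)) * indicator {0..} x
          = (ennreal (exp (- x)) * ennreal (exp (- (b - x)) * (b - x) ^ k / fact k)) * I"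
          using True by (simp add: mult.assoc)
        also have "\<dots> = ennreal (exp (- b)) * ennreal ((b - x) ^ k / fact k) * I" by (simp only: eq)
        also have "\<dots> = ennreal (exp (- b)) * I * (ennreal ((b - x) ^ k / fact k) * indicator {0..b} x)"
          using True by (simp add: mult_ac)
        finally show ?thesis .
      qed (use elim in \<open>auto simp: indicator_def\<close>)
    qed
  qed
  also have "\<dots> = ennreal (exp (- b)) * I * ennreal (b ^ Suc k / fact (Suc k))"
    using Suc.prems by (subst nn_integral_cmult, measurable) (simp only: nn_integral_power_poly)
  also have "\<dots> = ennreal (exp (- b) * b ^ Suc k / fact (Suc k)) * I"
  proof -
    have "ennreal (exp (- b) * b ^ Suc k / fact (Suc k)) = ennreal (exp (- b)) * ennreal (b ^ Suc k / fact (Suc k))"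
      using Suc.prems by (simp add: ennreal_mult[symmetric] del: fact_Suc power_Suc)
    then show ?thesis by (simp only: mult_ac)
  qed
  finally show ?case by (simp only: I_def)
qed

lemma poisson_weights_sum:
  assumes "b \<ge> (0 :: real)"
  shows "(\<Sum>k. ennreal (exp (- b) * b ^ k / fact k)) = 1"
proof -
  have "(\<lambda>k. exp (- b) * (b ^ k / fact k)) sums (exp (- b) * exp b)"
    using exp_converges[of b] by (intro sums_mult) (simp add: scaleR_conv_of_real field_simps)
  then have "(\<lambda>k. exp (- b) * b ^ k / fact k) sums 1" by (simp flip: exp_add)
  then show ?thesis using assms
    by (subst suminf_ennreal_eq[where x=1]) (auto simp: zero_le_mult_iff)
qed

text \<open>The previous identity with f = 1 gives the Poisson weights of these disjoint events, and
  the weights sum to 1.\<close>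

lemma AE_first_ring:
  assumes "b \<ge> 0"
  shows "AE s in iid_expo. \<exists>k. first_ring k b s"
proof -
  have [measurable]: "{s. first_ring k b s} \<in> sets iid_expo" for k
    by (rule expos_Collect) measurable
  have 1: "emeasure iid_expo {s. first_ring k b s} = ennreal (exp (- b) * b ^ k / fact k)" for k
  proof -
    have "emeasure iid_expo {s. first_ring k b s} = (\<integral>\<^sup>+s. 1 * of_bool (first_ring k b s) \<partial>iid_expo)"
    proof -
      have "(\<lambda>s. 1 * of_bool (first_ring k b s)) = (indicator {s. first_ring k b s} :: _ \<Rightarrow> ennreal)"
        by (auto simp: indicator_def)
      then show ?thesis by simp
    qed
    then show ?thesis
      using nn_integral_restart_at[of "\<lambda>_. 1" b k] assms expos.emeasure_space_1 by simp
  qed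
  have "emeasure iid_expo (\<Union>k. {s. first_ring k b s}) = (\<Sum>k. emeasure iid_expo {s. first_ring k b s})"
    by (rule suminf_emeasure[symmetric]) (auto simp: disjoint_family_on_def dest: first_ring_unique)
  also have "\<dots> = 1" unfolding 1 by (rule poisson_weights_sum) (rule assms)
  finally have "expos.prob (\<Union>k. {s. first_ring k b s}) = 1" by (simp add: measure_def)
  then have "AE s in iid_expo. s \<in> (\<Union>k. {s. first_ring k b s})"
    by (rule expos.AE_prob_1)
  then show ?thesis by simp
qed

lemma nn_integral_restart:
  fixes f :: "real stream \<Rightarrow> ennreal"
  assumes [measurable]: "f \<in> borel_measurable iid_expo" and b: "b \<ge> 0"
  shows "(\<integral>\<^sup>+s. f (restart b s) \<partial>iid_expo) = (\<integral>\<^sup>+s. f s \<partial>iid_expo)"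
proof -
  have "(\<integral>\<^sup>+s. f (restart b s) \<partial>iid_expo)
     = (\<integral>\<^sup>+s. (\<Sum>k. f (restart_at k b s) * of_bool (first_ring k b s)) \<partial>iid_expo)"
  proof (rule nn_integral_cong_AE)
    show "AE s in iid_expo. f (restart b s) = (\<Sum>k. f (restart_at k b s) * of_bool (first_ring k b s))"
      using AE_first_ring[OF b]
    proof eventually_elim
      case (elim s)
      then obtain k where k: "first_ring k b s" by auto
      have "(\<Sum>l. f (restart_at l b s) * of_bool (first_ring l b s)) = (\<Sum>l\<in>{k}. f (restart_at l b s) * of_bool (first_ring l b s))"
        by (rule suminf_finite) (use first_ring_unique[OF k] in auto)
      then show ?case using k by (simp add: first_ring_restart)
    qed
  qed
  also have "\<dots> = (\<Sum>k. \<integral>\<^sup>+s. f (restart_at k b s) * of_bool (first_ring k b s) \<partial>iid_expo)"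
    by (rule nn_integral_suminf) measurable
  also have "\<dots> = (\<Sum>k. ennreal (exp (- b) * b ^ k / fact k) * (\<integral>\<^sup>+s. f s \<partial>iid_expo))"
    by (simp only: nn_integral_restart_at[OF assms])
  also have "\<dots> = (\<integral>\<^sup>+s. f s \<partial>iid_expo)"
    by (simp only: ennreal_suminf_multc poisson_weights_sum[OF b]) simp
  finally show ?thesis .
qed

subsection \<open>Jump times\<close>

text \<open>
  A particle may make its jump number \<open>m + 1\<close> from time \<open>b m\<close> on. The pair consists of the time of
  jump \<open>m\<close> and of the clock seen from that time on; the clock and the time at the start are \<open>s\<close> and \<open>\<tau>\<close>.
\<close>

primrec jump_state :: "real \<Rightarrow> (nat \<Rightarrow> real) \<Rightarrow> real stream \<Rightarrow> nat \<Rightarrow> real \<times> real stream" where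
  "jump_state \<tau> b s 0 = (\<tau>, s)"
| "jump_state \<tau> b s (Suc m) =
    (let t = fst (jump_state \<tau> b s m); s' = restart (max 0 (b m - t)) (snd (jump_state \<tau> b s m))
     in (max t (b m) + shd s', stl s'))"

definition clock_jumps :: "real \<Rightarrow> (nat \<Rightarrow> real) \<Rightarrow> real stream \<Rightarrow> real stream" where
  "clock_jumps \<tau> b s = to_stream (\<lambda>m. fst (jump_state \<tau> b s (Suc m)))"

text \<open>Last passage percolation along one row: b holds the passage times of the row before,
  \<tau> is the boundary value.\<close>

primrec passage_time :: "real \<Rightarrow> (nat \<Rightarrow> real) \<Rightarrow> real stream \<Rightarrow> nat \<Rightarrow> real" where
  "passage_time \<tau> b w 0 = \<tau>"
| "passage_time \<tau> b w (Suc m) = max (passage_time \<tau> b w m) (b m) + w !! m"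

definition weight_jumps :: "real \<Rightarrow> (nat \<Rightarrow> real) \<Rightarrow> real stream \<Rightarrow> real stream" where
  "weight_jumps \<tau> b w = to_stream (\<lambda>m. passage_time \<tau> b w (Suc m))"

text \<open>Peels off the first jump instead of the last, so that all later jumps are a function of
  the restarted clock, to which \<open>nn_integral_restart\<close> applies.\<close>

lemma jump_state_head:
  fixes b s \<tau>
  defines "s' \<equiv> restart (max 0 (b 0 - \<tau>)) s"
  shows "jump_state \<tau> b s (Suc m) = jump_state (max \<tau> (b 0) + shd s') (\<lambda>i. b (Suc i)) (stl s') m"
proof (induction m)
  case 0
  show ?case by (simp add: s'_def Let_def)
next
  case (Suc m)
  show ?case
    by (simp only: jump_state.simps(2)[of \<tau> b s "Suc m"] Suc
        jump_state.simps(2)[of "max \<tau> (b 0) + shd s'" "\<lambda>i. b (Suc i)" "stl s'" m])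
qed

lemma clock_jumps_head:
  fixes b s \<tau>
  defines "s' \<equiv> restart (max 0 (b 0 - \<tau>)) s"
  defines "t \<equiv> max \<tau> (b 0) + shd s'"
  shows "clock_jumps \<tau> b s = t ## clock_jumps t (\<lambda>i. b (Suc i)) (stl s')"
proof (rule stream_eqI)
  fix m
  show "clock_jumps \<tau> b s !! m = (t ## clock_jumps t (\<lambda>i. b (Suc i)) (stl s')) !! m"
    unfolding clock_jumps_def snth_to_stream jump_state_head[of \<tau> b s]
    by (cases m) (simp_all only: Stream_snth nat.case snth_to_stream jump_state.simps(1) fst_conv s'_def t_def)
qed

lemma passage_time_head: "passage_time \<tau> b (x ## w) (Suc m) = passage_time (max \<tau> (b 0) + x) (\<lambda>i. b (Suc i)) w m"
  by (induction m) auto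

lemma weight_jumps_head:
  "weight_jumps \<tau> b (x ## w) = (max \<tau> (b 0) + x) ## weight_jumps (max \<tau> (b 0) + x) (\<lambda>i. b (Suc i)) w"
proof (rule stream_eqI)
  fix m
  show "weight_jumps \<tau> b (x ## w) !! m = ((max \<tau> (b 0) + x) ## weight_jumps (max \<tau> (b 0) + x) (\<lambda>i. b (Suc i)) w) !! m"
    unfolding weight_jumps_def snth_to_stream passage_time_head[of \<tau> b x w]
    by (cases m) (simp_all only: Stream_snth nat.case snth_to_stream passage_time.simps(1))
qed

lemma expos_shd_measurable [measurable (raw)]:
  "f \<in> measurable M iid_expo \<Longrightarrow> (\<lambda>x. shd (f x)) \<in> borel_measurable M"
  using expos_snth_measurable[of f M 0] by simp

lemma expos_stl_measurable [measurable (raw)]: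
  "f \<in> measurable M iid_expo \<Longrightarrow> (\<lambda>x. stl (f x)) \<in> measurable M iid_expo"
  by (rule measurable_compose[OF _ measurable_stl])

lemma jump_state_measurable:
  assumes [measurable]: "f \<in> borel_measurable M" "\<And>i. (\<lambda>x. b x i) \<in> borel_measurable M" "g \<in> measurable M iid_expo"
  shows "(\<lambda>x. fst (jump_state (f x) (b x) (g x) m)) \<in> borel_measurable M \<and>
     (\<lambda>x. snd (jump_state (f x) (b x) (g x) m)) \<in> measurable M iid_expo"
proof (induction m)
  case (Suc m)
  then have [measurable]: "(\<lambda>x. fst (jump_state (f x) (b x) (g x) m)) \<in> borel_measurable M"
     "(\<lambda>x. snd (jump_state (f x) (b x) (g x) m)) \<in> measurable M iid_expo" by auto
  show ?case by (simp add: Let_def) measurable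
qed simp

lemma clock_jumps_measurable [measurable (raw)]:
  assumes "f \<in> borel_measurable M" "\<And>i. (\<lambda>x. b x i) \<in> borel_measurable M" "g \<in> measurable M iid_expo"
  shows "(\<lambda>x. clock_jumps (f x) (b x) (g x)) \<in> measurable M iid_expo"
  by (rule measurable_stream_space2)
     (use jump_state_measurable[OF assms] in \<open>simp add: clock_jumps_def cong: measurable_cong_sets del: jump_state.simps\<close>)

lemma passage_time_measurable:
  assumes [measurable]: "f \<in> borel_measurable M" "\<And>i. (\<lambda>x. b x i) \<in> borel_measurable M" "g \<in> measurable M iid_expo"
  shows "(\<lambda>x. passage_time (f x) (b x) (g x) m) \<in> borel_measurable M"
  by (induction m) (simp_all, measurable)

lemma weight_jumps_measurable [measurable (raw)]:
  assumes "f \<in> borel_measurable M" "\<And>i. (\<lambda>x. b x i) \<in> borel_measurable M" "g \<in> measurable M iid_expo"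
  shows "(\<lambda>x. weight_jumps (f x) (b x) (g x)) \<in> measurable M iid_expo"
  by (rule measurable_stream_space2)
     (use passage_time_measurable[OF assms] in \<open>simp add: weight_jumps_def cong: measurable_cong_sets del: passage_time.simps\<close>)

text \<open>The times b are fixed here, since the preceding particles use other clocks. Restarting
  at the first admissible time preserves the law of the clock; its head is then a fresh weight and
  its tail the clock for the remaining jumps.\<close>

lemma nn_integral_clock_jumps:
  fixes f :: "real stream \<Rightarrow> ennreal"
  assumes "f \<in> borel_measurable iid_expo" "prefix_dependent m f"
  shows "(\<integral>\<^sup>+s. f (clock_jumps \<tau> b s) \<partial>iid_expo) = (\<integral>\<^sup>+w. f (weight_jumps \<tau> b w) \<partial>iid_expo)"
  using assms
proof (induction m arbitrary: f \<tau> b)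
  case 0
  then have "f s = f t" for s t by (auto simp: prefix_dependent_def)
  then have "(\<lambda>s. f (clock_jumps \<tau> b s)) = (\<lambda>s. f (weight_jumps \<tau> b s))" by blast
  then show ?case by simp
next
  case (Suc m)
  note [measurable] = Suc.prems(1)
  let ?P = "iid_expo"
  define t where "t x = max \<tau> (b 0) + x" for x
  define b' where "b' = (\<lambda>i. b (Suc i))"
  have [measurable]: "t \<in> borel_measurable borel" unfolding t_def by measurable
  have "(\<integral>\<^sup>+s. f (clock_jumps \<tau> b s) \<partial>?P)
      = (\<integral>\<^sup>+s. (\<lambda>s'. f (t (shd s') ## clock_jumps (t (shd s')) b' (stl s'))) (restart (max 0 (b 0 - \<tau>)) s) \<partial>?P)"
    unfolding clock_jumps_head[of \<tau> b] t_def b'_def ..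
  also have "\<dots> = (\<integral>\<^sup>+s. f (t (shd s) ## clock_jumps (t (shd s)) b' (stl s)) \<partial>?P)"
  proof (rule nn_integral_restart)
    have "(\<lambda>s. clock_jumps (t (shd s)) b' (stl s)) \<in> measurable ?P ?P" by measurable
    then show "(\<lambda>s. f (t (shd s) ## clock_jumps (t (shd s)) b' (stl s))) \<in> borel_measurable ?P" by measurable
  qed simp
  also have "\<dots> = (\<integral>\<^sup>+x. \<integral>\<^sup>+s. f (t x ## clock_jumps (t x) b' s) \<partial>?P \<partial>expo)"
    by (subst expo.nn_integral_stream_space) auto
  also have "\<dots> = (\<integral>\<^sup>+x. \<integral>\<^sup>+s. f (t x ## weight_jumps (t x) b' s) \<partial>?P \<partial>expo)"
    by (intro nn_integral_cong Suc.IH) (measurable, rule prefix_dependent_Stream, rule Suc.prems)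
  also have "\<dots> = (\<integral>\<^sup>+s. f (weight_jumps \<tau> b s) \<partial>?P)"
    by (subst (2) expo.nn_integral_stream_space) (auto simp: weight_jumps_head t_def b'_def)
  finally show ?case .
qed

primrec clock_times_of :: "nat \<Rightarrow> real stream \<Rightarrow> real stream stream \<Rightarrow> real stream" where
  "clock_times_of 0 b S = b"
| "clock_times_of (Suc n) b S = clock_times_of n (clock_jumps 0 ((!!) b) (shd S)) (stl S)"

primrec weight_times_of :: "nat \<Rightarrow> real stream \<Rightarrow> real stream stream \<Rightarrow> real stream" where
  "weight_times_of 0 b S = b"
| "weight_times_of (Suc n) b S = weight_times_of n (weight_jumps 0 ((!!) b) (shd S)) (stl S)"

lemma clock_times_of_Suc: "clock_times_of (Suc n) b S = clock_jumps 0 ((!!) (clock_times_of n b S)) (S !! n)"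
  by (induction n arbitrary: b S) simp_all

lemma weight_times_of_Suc: "weight_times_of (Suc n) b S = weight_jumps 0 ((!!) (weight_times_of n b S)) (S !! n)"
  by (induction n arbitrary: b S) simp_all

lemma clock_times_of_measurable [measurable (raw)]:
  assumes [measurable]: "f \<in> measurable M iid_expo" "g \<in> measurable M iid_field"
  shows "(\<lambda>x. clock_times_of n (f x) (g x)) \<in> measurable M iid_expo"
proof (induction n)
  case (Suc n)
  note [measurable] = Suc
  show ?case unfolding clock_times_of_Suc by measurable
qed simp

lemma weight_times_of_measurable [measurable (raw)]:
  assumes [measurable]: "f \<in> measurable M iid_expo" "g \<in> measurable M iid_field"
  shows "(\<lambda>x. weight_times_of n (f x) (g x)) \<in> measurable M iid_expo"
proof (induction n)
  case (Suc n)
  note [measurable] = Suc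
  show ?case unfolding weight_times_of_Suc by measurable
qed simp

lemma jump_state_cong: "(\<And>i. i < m \<Longrightarrow> b i = b' i) \<Longrightarrow> jump_state \<tau> b w m = jump_state \<tau> b' w m"
  by (induction m) (auto simp: Let_def)

lemma clock_times_of_cong:
  "(\<And>i. i < m \<Longrightarrow> b !! i = b' !! i) \<Longrightarrow> j < m \<Longrightarrow> clock_times_of n b S !! j = clock_times_of n b' S !! j"
proof (induction n arbitrary: j)
  case (Suc n)
  then have "jump_state 0 ((!!) (clock_times_of n b S)) (S !! n) (Suc j) = jump_state 0 ((!!) (clock_times_of n b' S)) (S !! n) (Suc j)"
    by (intro jump_state_cong) auto
  then show ?case by (simp only: clock_times_of_Suc clock_jumps_def snth_to_stream)
qed simp

text \<open>Clock times and passage times agree in law only, not outcome by outcome, so one row is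
  exchanged at a time: \<open>nn_integral_clock_jumps\<close> treats the first row while the others
  are integrated out into h.\<close>

lemma nn_integral_clock_times_of:
  fixes f :: "real stream \<Rightarrow> ennreal"
  assumes [measurable]: "f \<in> borel_measurable iid_expo" and f: "prefix_dependent m f"
  shows "(\<integral>\<^sup>+S. f (clock_times_of n b S) \<partial>iid_field)
       = (\<integral>\<^sup>+S. f (weight_times_of n b S) \<partial>iid_field)"
proof (induction n arbitrary: b)
  case (Suc n)
  let ?P = "iid_expo" and ?Q = "iid_field"
  define h where "h b = (\<integral>\<^sup>+S. f (clock_times_of n b S) \<partial>?Q)" for b
  have [measurable]: "h \<in> borel_measurable ?P" unfolding h_def by measurable
  have h: "prefix_dependent m h"
    unfolding h_def prefix_dependent_def
    by (auto intro!: nn_integral_cong prefix_dependentD[OF f] intro: clock_times_of_cong)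
  have "(\<integral>\<^sup>+S. f (clock_times_of (Suc n) b S) \<partial>?Q) = (\<integral>\<^sup>+s. h (clock_jumps 0 ((!!) b) s) \<partial>?P)"
    unfolding h_def by (subst expos.nn_integral_stream_space) (auto simp del: clock_times_of.simps, simp)
  also have "\<dots> = (\<integral>\<^sup>+s. h (weight_jumps 0 ((!!) b) s) \<partial>?P)"
    by (rule nn_integral_clock_jumps[OF _ h]) measurable
  also have "\<dots> = (\<integral>\<^sup>+S. f (weight_times_of (Suc n) b S) \<partial>?Q)"
    unfolding h_def Suc by (subst (2) expos.nn_integral_stream_space) (auto simp del: weight_times_of.simps, simp)
  finally show ?case .
qed simp

subsection \<open>Step initial condition and last passage percolation\<close>

primrec jump_count :: "(nat \<Rightarrow> real) \<Rightarrow> (nat \<Rightarrow> real) \<Rightarrow> nat \<Rightarrow> nat" where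
  "jump_count \<sigma> b 0 = 0"
| "jump_count \<sigma> b (Suc k) = (if b (jump_count \<sigma> b k) \<le> \<sigma> k then Suc (jump_count \<sigma> b k) else jump_count \<sigma> b k)"

lemma jump_count_mono: "k \<le> l \<Longrightarrow> jump_count \<sigma> b k \<le> jump_count \<sigma> b l"
  by (induction l rule: dec_induct) auto

text \<open>Every jump occurs at a ring, so the restarted clocks are tails of the original one. The
  last conjunct makes k the first number of rings with m jumps, which is what inverting the jump
  count requires.\<close>

lemma jump_state_eq:
  fixes s :: "real stream"
  defines "\<sigma> \<equiv> \<lambda>k. \<Sum>j\<le>k. s !! j"
  assumes \<sigma>: "clock_times \<sigma>"
  shows "\<exists>k. jump_state 0 b s m = ((\<Sum>j<k. s !! j), sdrop k s) \<and> jump_count \<sigma> b k = m \<and>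
    (\<forall>l. m \<le> jump_count \<sigma> b l \<longleftrightarrow> k \<le> l)"
proof (induction m)
  case 0
  then show ?case by (intro exI[of _ 0]) simp
next
  case (Suc m)
  let ?c = "jump_count \<sigma> b"
  obtain k where k: "jump_state 0 b s m = ((\<Sum>j<k. s !! j), sdrop k s)" "?c k = m"
    "\<And>l. m \<le> ?c l \<longleftrightarrow> k \<le> l" using Suc by blast
  define \<rho> where "\<rho> = (\<Sum>j<k. s !! j)"
  have sum: "(\<Sum>j\<le>i. sdrop k s !! j) = \<sigma> (k + i) - \<rho>" for i
  proof -
    have "\<sigma> (k + i) = (\<Sum>j<k + Suc i. s !! j)" unfolding \<sigma>_def by (simp add: lessThan_Suc_atMost)
    also have "\<dots> = \<rho> + (\<Sum>j<Suc i. s !! (k + j))"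
      unfolding \<rho>_def by (induction i) (simp_all add: add.assoc)
    finally show ?thesis by (simp add: sdrop_snth lessThan_Suc_atMost)
  qed
  have \<rho>: "\<rho> < \<sigma> (k + i)" for i
  proof (cases k)
    case 0
    then show ?thesis using clock_times_pos[OF \<sigma>, of i] by (simp add: \<rho>_def)
  next
    case (Suc k')
    then have "\<rho> = \<sigma> k'" by (simp add: \<rho>_def \<sigma>_def lessThan_Suc_atMost)
    moreover have "\<sigma> k' < \<sigma> (k + i)" using \<sigma> Suc by (simp add: clock_times_def strict_mono_less)
    ultimately show ?thesis by simp
  qed
  \<comment> \<open>If b m lies before the last jump, the maximum is 0 and the very next ring
    counts; both sides then hold for all i because \<rho> < \<sigma> (k + i).\<close>
  have iff: "max 0 (b m - \<rho>) \<le> (\<Sum>j\<le>i. sdrop k s !! j) \<longleftrightarrow> b m \<le> \<sigma> (k + i)" for i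
    unfolding sum using \<rho>[of i] by auto
  have "eventually (\<lambda>i. b m \<le> \<sigma> i) sequentially"
    using \<sigma> by (auto simp: clock_times_def filterlim_at_top)
  then obtain N where "\<And>i. i \<ge> N \<Longrightarrow> b m \<le> \<sigma> i" by (auto simp: eventually_sequentially)
  then have ex: "b m \<le> \<sigma> (k + N)" by simp
  define K where "K = (LEAST i. b m \<le> \<sigma> (k + i))"
  have K: "b m \<le> \<sigma> (k + K)" unfolding K_def by (rule LeastI[of _ N]) (rule ex)
  have K': "\<sigma> (k + i) < b m" if "i < K" for i
    using not_less_Least[of i "\<lambda>i. b m \<le> \<sigma> (k + i)"] that by (simp add: K_def)
  have R: "restart (max 0 (b m - \<rho>)) (sdrop k s) = (\<sigma> (k + K) - \<rho> - max 0 (b m - \<rho>)) ## sdrop (k + Suc K) s"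
  proof -
    have "(LEAST i. max 0 (b m - \<rho>) \<le> (\<Sum>j\<le>i. sdrop k s !! j)) = K" by (simp only: iff K_def)
    then show ?thesis by (simp only: restart_def restart_at_def sum sdrop_add)
  qed
  have js: "jump_state 0 b s (Suc m) = ((\<Sum>j<k + Suc K. s !! j), sdrop (k + Suc K) s)"
    unfolding jump_state.simps k(1) fst_conv snd_conv \<rho>_def[symmetric] R Let_def
    by (simp add: \<sigma>_def lessThan_Suc_atMost max_def)
  have same: "?c (k + i) = m" if "i \<le> K" for i
    using that
  proof (induction i)
    case (Suc i)
    then show ?case using K'[of i] by auto
  qed (simp add: k(2))
  have next': "?c (k + Suc K) = Suc m" using same[of K] K by simp
  have "Suc m \<le> ?c l \<longleftrightarrow> k + Suc K \<le> l" for l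
  proof
    assume "Suc m \<le> ?c l"
    show "k + Suc K \<le> l"
    proof (rule ccontr)
      assume "\<not> k + Suc K \<le> l"
      then have "?c l \<le> ?c (k + K)" by (intro jump_count_mono) simp
      with same[of K] \<open>Suc m \<le> ?c l\<close> show False by simp
    qed
  next
    assume "k + Suc K \<le> l"
    then show "Suc m \<le> ?c l" using jump_count_mono[of "k + Suc K" l \<sigma> b] next' by simp
  qed
  then show ?case using js next' by blast
qed

lemma clock_jumps_le_iff:
  fixes s :: "real stream"
  defines "\<sigma> \<equiv> \<lambda>k. \<Sum>j\<le>k. s !! j"
  assumes \<sigma>: "clock_times \<sigma>"
  shows "clock_jumps 0 b s !! m \<le> t \<longleftrightarrow> m < jump_count \<sigma> b (card {k. \<sigma> k \<le> t})"
proof -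
  obtain k where k: "jump_state 0 b s (Suc m) = ((\<Sum>j<k. s !! j), sdrop k s)" "jump_count \<sigma> b k = Suc m"
    "\<And>l. Suc m \<le> jump_count \<sigma> b l \<longleftrightarrow> k \<le> l" using jump_state_eq[of s b "Suc m"] \<sigma> unfolding \<sigma>_def by blast
  then obtain k' where k': "k = Suc k'" by (cases k) auto
  have "clock_jumps 0 b s !! m = \<sigma> k'"
    by (simp only: clock_jumps_def snth_to_stream k(1) fst_conv k' \<sigma>_def lessThan_Suc_atMost)
  then have "clock_jumps 0 b s !! m \<le> t \<longleftrightarrow> k' < card {k. \<sigma> k \<le> t}"
    using less_card_rings_iff[OF \<sigma>] by simp
  also have "\<dots> \<longleftrightarrow> Suc m \<le> jump_count \<sigma> b (card {k. \<sigma> k \<le> t})" unfolding k(3) k' by auto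
  finally show ?thesis by auto
qed

text \<open>Step initial data put particle n exactly one site ahead of particle n + 1, so jump c + 1
  of the latter becomes possible exactly when the former has made its own jump c + 1. This is the
  percolation recursion.\<close>

lemma step_tasep_ge_iff:
  assumes \<sigma>: "\<forall>n\<ge>1. clock_times (\<sigma> n)" and S: "\<And>n k. \<sigma> (Suc n) k = (\<Sum>j\<le>k. S !! n !! j)" and "n \<ge> 1"
  shows "step_initial n + int (Suc m) \<le> tasep \<sigma> no_wall step_initial n t \<longleftrightarrow> clock_times_of n (to_stream (\<lambda>_. 0)) S !! m \<le> t"
  using assms(3)
proof (induction n arbitrary: m t)
  case (Suc n)
  note prev = Suc.IH
  define b where "b = (!!) (clock_times_of n (to_stream (\<lambda>_. 0)) S)"
  have eq: "\<sigma> (Suc n) = (\<lambda>k. \<Sum>j\<le>k. S !! n !! j)" using S by blast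
  have \<sigma>': "clock_times (\<lambda>k. \<Sum>j\<le>k. S !! n !! j)" using \<sigma> eq by (metis Suc_le_mono le0 One_nat_def)
  define ok where "ok = (\<lambda>s z. (n = 0 \<or> z < tasep \<sigma> no_wall step_initial n s) \<and> ereal (real_of_int z) \<le> no_wall s)"
  have after: "after_rings (\<sigma> (Suc n)) ok (step_initial (Suc n)) k = step_initial (Suc n) + int (jump_count (\<sigma> (Suc n)) b k)" for k
  proof (induction k)
    case (Suc k)
    let ?c = "jump_count (\<sigma> (Suc n)) b k"
    have "(n = 0 \<or> step_initial (Suc n) + int ?c + 1 < tasep \<sigma> no_wall step_initial n (\<sigma> (Suc n) k)) \<longleftrightarrow> b ?c \<le> \<sigma> (Suc n) k"
    proof (cases "n = 0")
      case True
      \<comment> \<open>Label 1 has nobody ahead; the zero stream as row 0 encodes this because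
        rings occur at positive times.\<close>
      then show ?thesis using \<sigma> clock_times_pos[of "\<sigma> 1" k] by (simp add: b_def)
    next
      case False
      have "step_initial (Suc n) + int ?c + 1 < tasep \<sigma> no_wall step_initial n (\<sigma> (Suc n) k)
        \<longleftrightarrow> step_initial n + int (Suc ?c) \<le> tasep \<sigma> no_wall step_initial n (\<sigma> (Suc n) k)"
        by (auto simp: step_initial_def)
      then show ?thesis using prev[of ?c "\<sigma> (Suc n) k"] False by (simp add: b_def)
    qed
    then have "ok (\<sigma> (Suc n) k) (step_initial (Suc n) + int ?c + 1) \<longleftrightarrow> b ?c \<le> \<sigma> (Suc n) k"
      by (simp add: ok_def no_wall_def)
    then show ?case by (simp add: Suc.IH)
  qed simp
  show ?case
    unfolding tasep.simps ok_def[symmetric] after clock_times_of_Suc b_def[symmetric] clock_jumps_le_iff[OF \<sigma>', of b m t]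
    unfolding eq by auto
qed simp

lemma weight_times_eq_bulk_lpp: "weight_times_of n (to_stream (\<lambda>_. 0)) \<omega> !! m = bulk_lpp n (Suc m) \<omega>"
proof (induction n arbitrary: m)
  case (Suc n)
  note prev = Suc.IH
  define b where "b = (!!) (weight_times_of n (to_stream (\<lambda>_. 0)) \<omega>)"
  have b: "b i = bulk_lpp n (Suc i) \<omega>" for i by (simp add: b_def prev)
  have "passage_time 0 b (\<omega> !! n) m = bulk_lpp (Suc n) m \<omega>" for m
  proof (induction m)
    case (Suc m)
    show ?case by (simp only: passage_time.simps(2) Suc.IH) (simp add: b bulk_lpp_def max.commute)
  qed (simp add: bulk_lpp_def)
  then show ?case by (simp only: weight_times_of_Suc weight_jumps_def snth_to_stream b_def)
qed (simp add: bulk_lpp_def)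

subsection \<open>The clocks\<close>

definition clock_env :: "(nat \<Rightarrow> nat \<Rightarrow> 'w \<Rightarrow> real) \<Rightarrow> 'w \<Rightarrow> real stream stream" where
  "clock_env W \<omega> = to_stream (\<lambda>n. to_stream (\<lambda>j. W (Suc n) j \<omega>))"

locale clocks =
  fixes M :: "'w measure" and W :: "nat \<Rightarrow> nat \<Rightarrow> 'w \<Rightarrow> real"
  assumes clocks: "poisson_clocks M W"

sublocale clocks \<subseteq> prob_space M
  using clocks by (simp add: poisson_clocks_def)

context clocks
begin

abbreviation "step_position \<equiv> position W no_wall step_initial"

lemma W_measurable [measurable]: "n \<ge> 1 \<Longrightarrow> W n j \<in> borel_measurable M"
  using clocks by (auto simp: poisson_clocks_def distributed_def)

lemma distr_W: "n \<ge> 1 \<Longrightarrow> distr M borel (W n j) = expo"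
  using clocks unfolding poisson_clocks_def distributed_def expo_def
  by (metis distr_cong sets_lborel)

lemma clock_times_ring: "\<omega> \<in> space M \<Longrightarrow> n \<ge> 1 \<Longrightarrow> clock_times (ring_time W \<omega> n)"
  using clocks unfolding poisson_clocks_def clock_times_def ring_time_def
  by (auto simp: strict_mono_Suc_iff)

lemma indep_W: "indep_vars (\<lambda>_. borel) (\<lambda>(n, j). W n j) ({1..} \<times> UNIV)"
  using clocks by (simp add: poisson_clocks_def)

lemma clock_stream_law:
  assumes "n \<ge> 1"
  shows "distr M iid_expo (\<lambda>\<omega>. to_stream (\<lambda>j. W n j \<omega>)) = iid_expo"
proof -
  let ?K = "{n} \<times> (UNIV :: nat set)"
  have "indep_vars (\<lambda>_. borel) (\<lambda>(n, j). W n j) ?K"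
    by (rule indep_vars_subset[OF indep_W]) (use assms in auto)
  then have "distr M (\<Pi>\<^sub>M i\<in>?K. borel) (\<lambda>\<omega>. \<lambda>i\<in>?K. (\<lambda>(n, j). W n j) i \<omega>) = (\<Pi>\<^sub>M i\<in>?K. distr M borel ((\<lambda>(n, j). W n j) i))"
    using assms by (subst indep_vars_iff_distr_eq_PiM'[symmetric]) auto
  also have "\<dots> = (\<Pi>\<^sub>M i\<in>?K. expo)"
    using assms by (intro PiM_cong) (auto simp: distr_W)
  finally have K: "distr M (\<Pi>\<^sub>M i\<in>?K. expo) (\<lambda>\<omega>. \<lambda>i\<in>?K. (\<lambda>(n, j). W n j) i \<omega>) = (\<Pi>\<^sub>M i\<in>?K. expo)"
    by (simp cong: sets_PiM_cong distr_cong)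
  have [measurable]: "(\<lambda>\<omega>. \<lambda>i\<in>?K. (\<lambda>(n, j). W n j) i \<omega>) \<in> measurable M (\<Pi>\<^sub>M i\<in>?K. expo)"
    using assms by (intro measurable_restrict) (auto cong: measurable_cong_sets)
  have R: "distr (\<Pi>\<^sub>M i\<in>?K. expo) (\<Pi>\<^sub>M j\<in>UNIV. expo) (\<lambda>g. \<lambda>j\<in>UNIV. g (n, j)) = (\<Pi>\<^sub>M j\<in>UNIV. expo)"
    by (rule distr_PiM_reindex) (auto simp: inj_on_def expo.prob_space_axioms)
  have m: "(\<lambda>g. \<lambda>j\<in>UNIV. g (n, j)) \<in> measurable (\<Pi>\<^sub>M i\<in>?K. expo) (\<Pi>\<^sub>M j\<in>(UNIV :: nat set). expo)"
    by (intro measurable_restrict measurable_component_singleton) simp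
  have "distr (distr M (\<Pi>\<^sub>M i\<in>?K. expo) (\<lambda>\<omega>. \<lambda>i\<in>?K. (\<lambda>(n, j). W n j) i \<omega>)) (\<Pi>\<^sub>M j\<in>UNIV. expo) (\<lambda>g. \<lambda>j\<in>UNIV. g (n, j))
      = distr M (\<Pi>\<^sub>M j\<in>UNIV. expo) ((\<lambda>g. \<lambda>j\<in>UNIV. g (n, j)) \<circ> (\<lambda>\<omega>. \<lambda>i\<in>?K. (\<lambda>(n, j). W n j) i \<omega>))"
    by (rule distr_distr[OF m]) measurable
  also have "(\<lambda>g. \<lambda>j\<in>UNIV. g (n, j)) \<circ> (\<lambda>\<omega>. \<lambda>i\<in>?K. (\<lambda>(n, j). W n j) i \<omega>) = (\<lambda>\<omega> j. W n j \<omega>)"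
    by (auto simp: restrict_def)
  finally have "distr M (\<Pi>\<^sub>M j\<in>UNIV. expo) (\<lambda>\<omega> j. W n j \<omega>)
      = distr (distr M (\<Pi>\<^sub>M i\<in>?K. expo) (\<lambda>\<omega>. \<lambda>i\<in>?K. (\<lambda>(n, j). W n j) i \<omega>)) (\<Pi>\<^sub>M j\<in>UNIV. expo) (\<lambda>g. \<lambda>j\<in>UNIV. g (n, j))" ..
  then have eq: "distr M (\<Pi>\<^sub>M j\<in>UNIV. expo) (\<lambda>\<omega> j. W n j \<omega>) = (\<Pi>\<^sub>M j\<in>UNIV. expo)"
    by (simp only: K R)
  have [measurable]: "(\<lambda>\<omega> j. W n j \<omega>) \<in> measurable M (\<Pi>\<^sub>M j\<in>UNIV. expo)"
    using assms by (intro measurable_PiM_single') (auto cong: measurable_cong_sets)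
  have "distr M iid_expo (\<lambda>\<omega>. to_stream (\<lambda>j. W n j \<omega>))
    = distr (distr M (\<Pi>\<^sub>M j\<in>UNIV. expo) (\<lambda>\<omega> j. W n j \<omega>)) iid_expo to_stream"
    by (subst distr_distr) (auto simp: comp_def)
  also have "\<dots> = iid_expo"
    unfolding eq by (rule stream_space_eq_distr[symmetric])
  finally show ?thesis .
qed

lemma clock_stream_measurable [measurable]:
  "n \<ge> 1 \<Longrightarrow> (\<lambda>\<omega>. to_stream (\<lambda>j. W n j \<omega>)) \<in> measurable M iid_expo"
  by (rule measurable_stream_space2) (simp cong: measurable_cong_sets)

text \<open>Independence is used twice: within a clock for the law of its stream, and between
  clocks, whose index sets K n are disjoint, for the law of the stream of streams.\<close>

lemma clock_env_law: "distr M iid_field (clock_env W) = iid_field"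
proof -
  let ?P = "iid_expo"
  define K where "K n = {Suc n} \<times> (UNIV :: nat set)" for n :: nat
  have "indep_vars (\<lambda>n. \<Pi>\<^sub>M i\<in>K n. borel) (\<lambda>n \<omega>. \<lambda>i\<in>K n. (\<lambda>(n, j). W n j) i \<omega>) UNIV"
    by (rule indep_vars_restrict[OF indep_W]) (auto simp: K_def disjoint_family_on_def)
  then have "indep_vars (\<lambda>_. ?P) (\<lambda>n \<omega>. to_stream (\<lambda>j. (\<lambda>i\<in>K n. (\<lambda>(n, j). W n j) i \<omega>) (Suc n, j))) UNIV"
  proof (rule indep_vars_compose2[where Y="\<lambda>n g. to_stream (\<lambda>j. g (Suc n, j))"])
    fix n
    show "(\<lambda>g. to_stream (\<lambda>j. g (Suc n, j))) \<in> measurable (\<Pi>\<^sub>M i\<in>K n. borel) ?P"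
      by (rule measurable_stream_space2)
         (simp add: K_def measurable_component_singleton cong: measurable_cong_sets)
  qed
  then have "indep_vars (\<lambda>_. ?P) (\<lambda>n \<omega>. to_stream (\<lambda>j. W (Suc n) j \<omega>)) UNIV"
    by (simp add: K_def)
  then have "distr M (\<Pi>\<^sub>M n\<in>UNIV. ?P) (\<lambda>\<omega>. \<lambda>n\<in>UNIV. to_stream (\<lambda>j. W (Suc n) j \<omega>))
      = (\<Pi>\<^sub>M n\<in>UNIV. distr M ?P (\<lambda>\<omega>. to_stream (\<lambda>j. W (Suc n) j \<omega>)))"
    by (subst indep_vars_iff_distr_eq_PiM[symmetric]) auto
  then have eq: "distr M (\<Pi>\<^sub>M n\<in>UNIV. ?P) (\<lambda>\<omega> n. to_stream (\<lambda>j. W (Suc n) j \<omega>)) = (\<Pi>\<^sub>M n\<in>UNIV. ?P)"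
    by (simp add: clock_stream_law restrict_def)
  have [measurable]: "(\<lambda>\<omega> n. to_stream (\<lambda>j. W (Suc n) j \<omega>)) \<in> measurable M (\<Pi>\<^sub>M n\<in>UNIV. ?P)"
    by (intro measurable_PiM_single') auto
  have "distr M (stream_space ?P) (clock_env W)
    = distr (distr M (\<Pi>\<^sub>M n\<in>UNIV. ?P) (\<lambda>\<omega> n. to_stream (\<lambda>j. W (Suc n) j \<omega>))) (stream_space ?P) to_stream"
    unfolding clock_env_def by (subst distr_distr) (auto simp: comp_def)
  also have "\<dots> = stream_space ?P"
    unfolding eq by (rule stream_space_eq_distr[symmetric])
  finally show ?thesis .
qed

lemma clock_env_measurable [measurable]: "clock_env W \<in> measurable M iid_field"
  unfolding clock_env_def by (rule measurable_stream_space2) simp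

lemma prob_clock_times:
  assumes A: "A \<in> sets borel"
  shows "prob {\<omega> \<in> space M. clock_times_of n (to_stream (\<lambda>_. 0)) (clock_env W \<omega>) !! m \<in> A}
       = measure iid_field {S. bulk_lpp n (Suc m) S \<in> A}"
proof -
  let ?Q = "iid_field"
  define f :: "real stream \<Rightarrow> ennreal" where "f s = indicator A (s !! m)" for s
  note [measurable] = A
  have [measurable]: "f \<in> borel_measurable iid_expo" unfolding f_def by measurable
  have S: "{\<omega> \<in> space M. clock_times_of n (to_stream (\<lambda>_. 0)) (clock_env W \<omega>) !! m \<in> A} \<in> sets M" by measurable
  have S': "{S. bulk_lpp n (Suc m) S \<in> A} \<in> sets ?Q"
  proof -
    have "{S \<in> space ?Q. bulk_lpp n (Suc m) S \<in> A} \<in> sets ?Q" by measurable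
    then show ?thesis by simp
  qed
  have "emeasure M {\<omega> \<in> space M. clock_times_of n (to_stream (\<lambda>_. 0)) (clock_env W \<omega>) !! m \<in> A}
      = (\<integral>\<^sup>+\<omega>. f (clock_times_of n (to_stream (\<lambda>_. 0)) (clock_env W \<omega>)) \<partial>M)"
    unfolding nn_integral_indicator[OF S, symmetric] by (intro nn_integral_cong) (simp add: indicator_def f_def)
  also have "\<dots> = (\<integral>\<^sup>+S. f (clock_times_of n (to_stream (\<lambda>_. 0)) S) \<partial>distr M ?Q (clock_env W))"
    by (rule nn_integral_distr[symmetric]) measurable
  also have "\<dots> = (\<integral>\<^sup>+S. f (clock_times_of n (to_stream (\<lambda>_. 0)) S) \<partial>?Q)"
    by (simp only: clock_env_law)
  also have "\<dots> = (\<integral>\<^sup>+S. f (weight_times_of n (to_stream (\<lambda>_. 0)) S) \<partial>?Q)"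
    by (rule nn_integral_clock_times_of[where m="Suc m"]) (auto simp: prefix_dependent_def f_def)
  also have "\<dots> = emeasure ?Q {S. bulk_lpp n (Suc m) S \<in> A}"
    unfolding nn_integral_indicator[OF S', symmetric]
    by (intro nn_integral_cong) (simp add: indicator_def f_def weight_times_eq_bulk_lpp)
  finally show ?thesis by (simp add: measure_def)
qed

lemma step_position_ge_iff:
  assumes "\<omega> \<in> space M" "n \<ge> 1"
  shows "step_position n t \<omega> \<ge> real (Suc m) - (real n - 1)
    \<longleftrightarrow> clock_times_of n (to_stream (\<lambda>_. 0)) (clock_env W \<omega>) !! m \<le> t"
proof -
  have "step_initial n + int (Suc m) \<le> tasep (ring_time W \<omega>) no_wall step_initial n t \<longleftrightarrow> clock_times_of n (to_stream (\<lambda>_. 0)) (clock_env W \<omega>) !! m \<le> t"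
    using assms by (intro step_tasep_ge_iff) (auto simp: clock_times_ring ring_time_def clock_env_def)
  moreover have "step_initial n + int (Suc m) \<le> tasep (ring_time W \<omega>) no_wall step_initial n t \<longleftrightarrow>
      real_of_int (step_initial n + int (Suc m)) \<le> step_position n t \<omega>"
    unfolding position_def of_int_le_iff ..
  ultimately show ?thesis by (simp add: step_initial_def algebra_simps)
qed

section \<open>Law of large numbers for the step initial condition\<close>

abbreviation "jump_time n m \<omega> \<equiv> clock_times_of n (to_stream (\<lambda>_. 0)) (clock_env W \<omega>) !! m"

lemma label_ge_1: "0 < \<mu> \<Longrightarrow> 1 / \<mu> < T \<Longrightarrow> label \<mu> T \<ge> 1"
  unfolding label_def by (simp add: field_simps le_nat_iff)

lemma whp_jump_time:
  assumes lim: "((\<lambda>T. measure iid_field {S. bulk_lpp (label \<beta> T) (label \<mu> T) S \<in> A T}) \<longlongrightarrow> 0) at_top"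
    and [measurable]: "\<And>T. A T \<in> sets borel" and \<mu>: "\<mu> > 0"
  shows "whp M (\<lambda>T \<omega>. \<not> jump_time (label \<beta> T) (label \<mu> T - 1) \<omega> \<in> A T)"
proof (rule whp_complement)
  show "((\<lambda>T. prob {\<omega> \<in> space M. jump_time (label \<beta> T) (label \<mu> T - 1) \<omega> \<in> A T}) \<longlongrightarrow> 0) at_top"
  proof (rule Lim_transform_eventually[OF lim])
    show "\<forall>\<^sub>F T in at_top. measure iid_field {S. bulk_lpp (label \<beta> T) (label \<mu> T) S \<in> A T}
       = prob {\<omega> \<in> space M. jump_time (label \<beta> T) (label \<mu> T - 1) \<omega> \<in> A T}"
      using eventually_gt_at_top[of "1 / \<mu>"]
    proof eventually_elim
      case (elim T)
      then show ?case using label_ge_1[OF \<mu> elim] by (subst prob_clock_times) auto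
    qed
  qed
qed measurable

lemma step_position_label_iff:
  assumes "\<omega> \<in> space M" "0 < \<beta>" "1 / \<beta> < T" "0 < \<mu>" "1 / \<mu> < T"
  shows "step_position (label \<beta> T) t \<omega> \<ge> real (label \<mu> T) - real (label \<beta> T) + 1
    \<longleftrightarrow> jump_time (label \<beta> T) (label \<mu> T - 1) \<omega> \<le> t"
  using step_position_ge_iff[OF assms(1) label_ge_1[OF assms(2,3)], of "label \<mu> T - 1" t] label_ge_1[OF assms(4,5)]
  by (simp add: algebra_simps)

lemma step_upper:
  assumes \<beta>: "0 < \<beta>" "\<beta> < a" and \<delta>: "\<delta> > 0"
  shows "whp M (\<lambda>T \<omega>. step_position (label \<beta> T) (a * T) \<omega> \<le> (a - 2 * sqrt (a * \<beta>) + \<delta>) * T)"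
proof -
  \<comment> \<open>Jump \<mu> T of particle \<beta> T occurs at about (sqrt \<beta> + sqrt \<mu>)^2
    T, which is a T for \<mu> = (sqrt a - sqrt \<beta>)^2. One half of \<delta> delays this jump
    beyond a T; the other half pays for rounding.\<close>
  define \<mu> where "\<mu> = (sqrt a - sqrt \<beta>)\<^sup>2 + \<delta> / 2"
  have \<mu>: "\<mu> > 0" using \<delta> by (simp add: \<mu>_def add_nonneg_pos)
  have "(sqrt a - sqrt \<beta>)\<^sup>2 < \<mu>" using \<delta> by (simp add: \<mu>_def)
  then have "sqrt a - sqrt \<beta> < sqrt \<mu>" by (rule real_less_rsqrt)
  then have "(sqrt \<beta> + sqrt \<mu>)\<^sup>2 > (sqrt a)\<^sup>2" using \<beta> by (intro power_strict_mono) auto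
  then have gap: "(sqrt \<beta> + sqrt \<mu>)\<^sup>2 > a" using \<beta> by simp
  define d where "d = ((sqrt \<beta> + sqrt \<mu>)\<^sup>2 - a) / 2"
  have d: "d > 0" "(sqrt \<beta> + sqrt \<mu>)\<^sup>2 - d = a + d" using gap by (simp_all add: d_def field_simps)
  have \<mu>\<beta>: "\<mu> - \<beta> = a - 2 * sqrt (a * \<beta>) + \<delta> / 2"
    using \<beta> by (simp add: \<mu>_def power2_eq_square algebra_simps real_sqrt_mult)
  have "whp M (\<lambda>T \<omega>. \<not> jump_time (label \<beta> T) (label \<mu> T - 1) \<omega> \<in> {..<(a + d) * T})"
    using bulk_lpp_lower[OF \<beta>(1) \<mu> d(1)] \<mu> by (intro whp_jump_time) (simp_all add: d(2))
  then show ?thesis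
  proof (rule whp_monoI[where c="max (max (1 / \<mu>) (1 / \<beta>)) (4 / \<delta>)"])
    fix T \<omega>
    assume "max (max (1 / \<mu>) (1 / \<beta>)) (4 / \<delta>) < T" and \<omega>: "\<omega> \<in> space M"
      "\<not> jump_time (label \<beta> T) (label \<mu> T - 1) \<omega> \<in> {..<(a + d) * T}"
    then have T: "1 / \<mu> < T" "1 / \<beta> < T" "4 / \<delta> < T" by auto
    have T0: "T > 0" using T(1) \<mu> by (meson less_trans zero_less_divide_1_iff)
    then have "d * T > 0" using d by simp
    then have "\<not> jump_time (label \<beta> T) (label \<mu> T - 1) \<omega> \<le> a * T" using \<omega>(2) by (simp add: distrib_right)
    then have "step_position (label \<beta> T) (a * T) \<omega> < real (label \<mu> T) - real (label \<beta> T) + 1"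
      using step_position_label_iff[OF \<omega>(1) \<beta>(1) T(2) \<mu> T(1)] by (metis linorder_not_le)
    also have "\<dots> \<le> (\<mu> - \<beta>) * T + 2"
      using label_le[of \<mu> T] label_ge[of \<beta> T] \<mu> T0 by (simp add: left_diff_distrib)
    also have "\<dots> \<le> (a - 2 * sqrt (a * \<beta>) + \<delta>) * T"
      using T(3) \<delta> unfolding \<mu>\<beta> by (simp add: distrib_right field_simps)
    finally show "step_position (label \<beta> T) (a * T) \<omega> \<le> (a - 2 * sqrt (a * \<beta>) + \<delta>) * T" by simp
  qed
qed

lemma step_lower:
  assumes \<beta>: "0 < \<beta>" "\<beta> < a" and "0 < \<delta>'"
  shows "whp M (\<lambda>T \<omega>. step_position (label \<beta> T) (a * T) \<omega> \<ge> (a - 2 * sqrt (a * \<beta>) - \<delta>') * T)"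
proof -
  \<comment> \<open>The cap keeps the label parameter \<mu> below positive.\<close>
  define \<delta> where "\<delta> = min \<delta>' ((sqrt a - sqrt \<beta>)\<^sup>2)"
  have \<delta>: "0 < \<delta>" "\<delta> \<le> (sqrt a - sqrt \<beta>)\<^sup>2" "\<delta> \<le> \<delta>'" using assms by (auto simp: \<delta>_def)
  define \<mu> where "\<mu> = (sqrt a - sqrt \<beta>)\<^sup>2 - \<delta> / 2"
  have \<mu>: "\<mu> > 0" and less: "\<mu> < (sqrt a - sqrt \<beta>)\<^sup>2" using \<delta> by (simp_all add: \<mu>_def)
  then have "sqrt \<mu> < sqrt a - sqrt \<beta>" using \<beta> by (simp add: real_less_lsqrt)
  then have "(sqrt \<beta> + sqrt \<mu>)\<^sup>2 < (sqrt a)\<^sup>2" using \<beta> \<mu> by (intro power_strict_mono) auto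
  then have gap: "(sqrt \<beta> + sqrt \<mu>)\<^sup>2 < a" using \<beta> by simp
  define d where "d = a - (sqrt \<beta> + sqrt \<mu>)\<^sup>2"
  have d: "d > 0" "(sqrt \<beta> + sqrt \<mu>)\<^sup>2 + d = a" using gap by (simp_all add: d_def)
  have "\<mu> - \<beta> = a - 2 * sqrt (a * \<beta>) - \<delta> / 2"
    using \<beta> by (simp add: \<mu>_def power2_eq_square algebra_simps real_sqrt_mult)
  then have \<mu>\<beta>: "a - 2 * sqrt (a * \<beta>) - \<delta>' \<le> \<mu> - \<beta>" using \<delta> by simp
  have "whp M (\<lambda>T \<omega>. \<not> jump_time (label \<beta> T) (label \<mu> T - 1) \<omega> \<in> {a * T<..})"
    using bulk_lpp_upper[OF \<beta>(1) \<mu> d(1)] \<mu> by (intro whp_jump_time) (simp_all add: d(2))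
  then show ?thesis
  proof (rule whp_monoI[where c="max (1 / \<mu>) (1 / \<beta>)"])
    fix T \<omega>
    assume "max (1 / \<mu>) (1 / \<beta>) < T" and \<omega>: "\<omega> \<in> space M" "\<not> jump_time (label \<beta> T) (label \<mu> T - 1) \<omega> \<in> {a * T<..}"
    then have T: "1 / \<mu> < T" "1 / \<beta> < T" by auto
    have T0: "T > 0" using T(1) \<mu> by (meson less_trans zero_less_divide_1_iff)
    have "(a - 2 * sqrt (a * \<beta>) - \<delta>') * T \<le> (\<mu> - \<beta>) * T" using \<mu>\<beta> T0 by (intro mult_right_mono) auto
    also have "\<dots> \<le> real (label \<mu> T) - real (label \<beta> T) + 1"
      using label_ge[of \<mu> T] label_le[of \<beta> T] \<beta> T0 by (simp add: left_diff_distrib)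
    also have "\<dots> \<le> step_position (label \<beta> T) (a * T) \<omega>"
      using step_position_label_iff[OF \<omega>(1) \<beta>(1) T(2) \<mu> T(1)] \<omega>(2) by simp
    finally show "step_position (label \<beta> T) (a * T) \<omega> \<ge> (a - 2 * sqrt (a * \<beta>) - \<delta>') * T" .
  qed
qed

subsection \<open>Measurability of positions\<close>

lemma after_rings_cong:
  "(\<And>j z. ok (\<tau> j) z = ok' (\<tau> j) z) \<Longrightarrow> after_rings \<tau> ok y k = after_rings \<tau> ok' y k"
  by (induction k) simp_all

lemma ring_time_measurable [measurable (raw)]:
  assumes [measurable]: "g \<in> measurable N M" and "n \<ge> 1"
  shows "(\<lambda>x. ring_time W (g x) n k) \<in> borel_measurable N"
proof -
  have "(\<lambda>\<omega>. ring_time W \<omega> n k) \<in> borel_measurable M" unfolding ring_time_def using assms(2) by measurable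
  then show ?thesis by (rule measurable_compose[OF assms(1)])
qed

text \<open>As a least index, the number of rings can be handled by countable composition in the
  measurability proof.\<close>

lemma card_rings_Least: "clock_times \<sigma> \<Longrightarrow> card {k. \<sigma> k \<le> t} = (LEAST k. \<not> \<sigma> k \<le> t)"
  by (rule Least_equality[symmetric])
     (metis less_card_rings_iff less_irrefl, metis less_card_rings_iff not_less)

text \<open>Evaluating the wall at \<open>max 0 s\<close> is harmless, because clocks ring at positive times only.\<close>

lemma tasep_measurable:
  assumes w: "(\<lambda>s. w (max 0 s)) \<in> borel_measurable borel" and [measurable]: "g \<in> measurable N M" "h \<in> borel_measurable N"
  shows "(\<lambda>x. tasep (ring_time W (g x)) w y n (h x)) \<in> measurable N (count_space UNIV)"
  using assms(3)
\<comment> \<open>The time is itself random, because the recursion reads the preceding particle at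
  ring times.\<close>
proof (induction n arbitrary: h)
  case (Suc n)
  note [measurable] = Suc.prems w
  define \<sigma> where "\<sigma> x = ring_time W (g x) (Suc n)" for x
  have \<sigma>: "clock_times (\<sigma> x)" if "x \<in> space N" for x
    using that measurable_space[OF assms(2)] by (auto simp: \<sigma>_def intro: clock_times_ring)
  have [measurable]: "(\<lambda>x. \<sigma> x k) \<in> borel_measurable N" for k unfolding \<sigma>_def by measurable
  have [measurable]: "(\<lambda>x. tasep (ring_time W (g x)) w y n (\<sigma> x k)) \<in> measurable N (count_space UNIV)" for k
    by (rule Suc.IH) measurable
  define A where "A x = after_rings (\<sigma> x) (\<lambda>s z. (n = 0 \<or> z < tasep (ring_time W (g x)) w y n s) \<and> ereal (real_of_int z) \<le> w (max 0 s)) (y (Suc n))" for x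
  have A[measurable]: "(\<lambda>x. A x k) \<in> measurable N (count_space UNIV)" for k
  proof (induction k)
    case (Suc k)
    note [measurable] = Suc
    have "(\<lambda>x. A x (Suc k)) = (\<lambda>x. if (n = 0 \<or> A x k + 1 < tasep (ring_time W (g x)) w y n (\<sigma> x k)) \<and> ereal (real_of_int (A x k + 1)) \<le> w (max 0 (\<sigma> x k))
        then A x k + 1 else A x k)"
      by (simp only: A_def after_rings.simps(2))
    also have "\<dots> \<in> measurable N (count_space UNIV)" by measurable
    finally show ?case .
  qed (simp add: A_def)
  have "(\<lambda>x. A x (LEAST k. \<not> \<sigma> x k \<le> h x)) \<in> measurable N (count_space UNIV)"
    by (rule measurable_compose_countable[where f="\<lambda>k x. A x k"]) measurable
  moreover have "A x (LEAST k. \<not> \<sigma> x k \<le> h x) = tasep (ring_time W (g x)) w y (Suc n) (h x)" if "x \<in> space N" for x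
  proof -
    have "A x k = after_rings (\<sigma> x) (\<lambda>s z. (n = 0 \<or> z < tasep (ring_time W (g x)) w y n s) \<and> ereal (real_of_int z) \<le> w s) (y (Suc n)) k" for k
      unfolding A_def using clock_times_pos[OF \<sigma>[OF that]] by (intro after_rings_cong) (simp add: less_imp_le)
    then show ?thesis using card_rings_Least[OF \<sigma>[OF that], of "h x"] by (simp add: \<sigma>_def)
  qed
  ultimately show ?case by (simp cong: measurable_cong)
qed simp

lemma position_measurable:
  assumes "(\<lambda>s. w (max 0 s)) \<in> borel_measurable borel"
  shows "position W w y n t \<in> borel_measurable M"
proof -
  have "(\<lambda>\<omega>. tasep (ring_time W \<omega>) w y n t) \<in> measurable M (count_space UNIV)"
    by (rule tasep_measurable[OF assms]) measurable
  then show ?thesis unfolding position_def by (rule measurable_compose) simp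
qed

lemma free_position_measurable [measurable]: "free_position W x0 \<beta> T \<in> borel_measurable M"
  unfolding free_position_def by (rule position_measurable) (simp add: no_wall_def)

lemma wall_position_measurable:
  assumes "is_wall (f T)"
  shows "wall_position W f x0 \<beta> T \<in> borel_measurable M"
proof -
  have "mono (\<lambda>s. f T (max 0 s))"
    using assms by (auto simp: is_wall_def mono_def monotone_on_def)
  then have [measurable]: "(\<lambda>s. f T (max 0 s)) \<in> borel_measurable borel" by (rule borel_measurable_mono)
  show ?thesis unfolding wall_position_def by (rule position_measurable) measurable
qed

end

subsection \<open>Consequences of the Wall Assumption\<close>

text \<open>Macroscopic position at time \<open>a\<close> of the particle with label \<open>\<alpha>\<close> under the step initial condition.\<close>

definition step_shape :: "real \<Rightarrow> real \<Rightarrow> real" where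
  "step_shape \<alpha> a = (if \<alpha> < a then a - 2 * sqrt (a * \<alpha>) else - \<alpha>)"

text \<open>Identifies the profile in part (a) of the Wall Assumption: away from contact times, the
  wall value at time 1 - b plus the step profile at b exceeds \<xi> by at least K.\<close>

lemma f0_eq: "0 \<le> b \<Longrightarrow> f0 \<alpha> \<xi> (1 - b) = \<xi> - step_shape \<alpha> b"
  by (auto simp: f0_def step_shape_def algebra_simps real_sqrt_mult)

lemma c1_pos: "0 < \<alpha> \<Longrightarrow> \<alpha> < a \<Longrightarrow> c1 \<alpha> a > 0"
  by (simp add: c1_def)

lemma c2_pos: "0 < \<alpha> \<Longrightarrow> \<alpha> < a \<Longrightarrow> c2 \<alpha> a > 0"
  by (simp add: c2_def)

text \<open>Says that c1 / c2^2 = sqrt \<alpha> / (4 a sqrt a), half the second derivative of the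
  step profile at a. With \<tau> proportional to (a - b) / c2, the parabola is thus the quadratic
  Taylor term.\<close>

lemma c1_c2_sqrt:
  assumes "0 < \<alpha>" "\<alpha> < a"
  shows "c1 \<alpha> a * (4 * a * sqrt a) = (c2 \<alpha> a)\<^sup>2 * sqrt \<alpha>"
proof -
  define D where "D = sqrt a - sqrt \<alpha>"
  have "c1 \<alpha> a * (4 * a * sqrt a) = 4 * (\<alpha> powr (- 1/6)) * (a powr (1/6) * (a powr 1 * a powr (1/2))) * D powr (2/3)"
    using assms by (simp add: c1_def D_def powr_half_sqrt)
  also have "a powr (1/6) * (a powr 1 * a powr (1/2)) = a powr (5/6) * a powr (5/6)"
    by (simp only: powr_add[symmetric]) simp
  also have "D powr (2/3) = D powr (1/3) * D powr (1/3)" by (simp only: powr_add[symmetric]) simp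
  also have "\<alpha> powr (- 1/6) = \<alpha> powr (- 1/3) * \<alpha> powr (- 1/3) * \<alpha> powr (1/2)"
    by (simp only: powr_add[symmetric]) simp
  finally show ?thesis
    using assms by (simp add: c2_def D_def powr_half_sqrt power2_eq_square)
qed

text \<open>Divided by c2 sqrt a, this makes the linear coefficient of \<open>mu\<close> equal to 1
  - sqrt \<alpha> / sqrt a, the derivative of the step profile at a.\<close>

lemma mu_linear_coefficient:
  assumes "0 < \<alpha>" "\<alpha> < a"
  shows "2 * \<alpha> powr (- 1/3) * a powr (1/3) * (sqrt a - sqrt \<alpha>) powr (4/3) * sqrt a = c2 \<alpha> a * (sqrt a - sqrt \<alpha>)"
proof -
  define D where "D = sqrt a - sqrt \<alpha>"
  have D: "D > 0" using assms by (simp add: D_def)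
  have "D powr (4/3) = D powr (1/3 + 1)" by simp
  also have "\<dots> = D powr (1/3) * D" using D by (simp only: powr_add) simp
  finally have 1: "D powr (4/3) = D powr (1/3) * D" .
  have 2: "a powr (1/3) * sqrt a = a powr (5/6)"
    using assms by (simp add: powr_half_sqrt[symmetric] powr_add[symmetric])
  have "2 * \<alpha> powr (- 1/3) * a powr (1/3) * D powr (4/3) * sqrt a = 2 * \<alpha> powr (- 1/3) * (a powr (1/3) * sqrt a) * (D powr (1/3) * D)"
    unfolding 1 by simp
  also have "\<dots> = c2 \<alpha> a * D" unfolding 2 by (simp add: c2_def D_def)
  finally show ?thesis by (simp add: D_def)
qed

text \<open>
  The parabola in the Wall Assumption is the second order Taylor polynomial of the step shape; on
  \<open>b \<le> 2 * a\<close> half of its quadratic term leaves room for the remainder.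
\<close>

lemma step_shape_taylor:
  assumes "0 < \<alpha>" "\<alpha> < a" "\<alpha> < b" "a \<le> 1" "b \<le> 2 * a"
  shows "b - 2 * sqrt (b * \<alpha>) \<ge> a - 2 * sqrt (a * \<alpha>) + (b - a) * (1 - sqrt \<alpha> / sqrt a)
     + sqrt \<alpha> / (8 * a * sqrt a) * (b - a)\<^sup>2 + sqrt \<alpha> / 24 * (b - a)\<^sup>2"
proof -
  define p q r where "p = sqrt a" and "q = sqrt b" and "r = sqrt \<alpha>"
  have pos: "p > 0" "q > 0" "r > 0" using assms by (simp_all add: p_def q_def r_def)
  have sq: "a = p\<^sup>2" "b = q\<^sup>2" using assms by (simp_all add: p_def q_def)
  have p1: "p \<le> 1" using assms by (simp add: p_def)
  have ab: "q\<^sup>2 \<le> 2 * p\<^sup>2" using assms sq by simp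
  have "q \<le> 3/2 * p"
  proof (rule power2_le_imp_le)
    show "q\<^sup>2 \<le> (3/2 * p)\<^sup>2" using ab by (simp add: power_mult_distrib power2_eq_square) (use zero_le_square[of p] in linarith)
  qed (use pos in simp)
  have "(q + p)\<^sup>2 \<le> 6 * p\<^sup>2"
  proof -
    have "q * p \<le> 3/2 * p * p" using \<open>q \<le> 3/2 * p\<close> pos by (intro mult_right_mono) auto
    then have "(q + p)\<^sup>2 \<le> q\<^sup>2 + p\<^sup>2 + 3 * p\<^sup>2" by (simp add: power2_eq_square algebra_simps)
    then show ?thesis using ab by linarith
  qed
  \<comment> \<open>The profile exceeds its tangent by exactly r / p (q - p)^2. Since (q + p)^2 <= 6
    p^2, this is at least r / (6 p^3) times (b - a)^2, and 1 / 6 = 1 / 8 + 1 / 24; finally p <= 1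
    simplifies the second summand.\<close>
  have eq: "q\<^sup>2 - 2 * (q * r) - (p\<^sup>2 - 2 * (p * r) + (q\<^sup>2 - p\<^sup>2) * (1 - r / p)) = r / p * (q - p)\<^sup>2"
    using pos by (simp add: field_simps power2_eq_square)
  have quad: "(r / (8 * p\<^sup>2 * p) + r / 24) * (q\<^sup>2 - p\<^sup>2)\<^sup>2 \<le> r / p * (q - p)\<^sup>2"
  proof -
    have p3: "p\<^sup>2 * p \<le> 1" "p\<^sup>2 * p > 0" using p1 pos by (auto simp: power2_eq_square intro!: mult_le_one)
    have "r / 24 \<le> r / (24 * (p\<^sup>2 * p))"
      using p3 pos by (intro divide_left_mono) auto
    then have "r / (8 * p\<^sup>2 * p) + r / 24 \<le> r / (8 * p\<^sup>2 * p) + r / (24 * (p\<^sup>2 * p))"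
      by (rule add_left_mono)
    also have "\<dots> = r / (6 * (p\<^sup>2 * p))"
    proof -
      have "r / (8 * k) + r / (24 * k) = r / (6 * k)" for k :: real by (cases "k = 0") (simp_all add: field_simps)
      from this[of "p\<^sup>2 * p"] show ?thesis by (simp only: mult.assoc)
    qed
    finally have "(r / (8 * p\<^sup>2 * p) + r / 24) * (q\<^sup>2 - p\<^sup>2)\<^sup>2 \<le> r / (6 * (p\<^sup>2 * p)) * (q\<^sup>2 - p\<^sup>2)\<^sup>2"
      by (rule mult_right_mono) simp
    also have "\<dots> = r / (6 * (p\<^sup>2 * p)) * ((q - p)\<^sup>2 * (q + p)\<^sup>2)"
    proof -
      have "(q\<^sup>2 - p\<^sup>2)\<^sup>2 = (q - p)\<^sup>2 * (q + p)\<^sup>2" by (simp add: power2_eq_square algebra_simps)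
      then show ?thesis by (simp only:)
    qed
    also have "r / (6 * (p\<^sup>2 * p)) * ((q - p)\<^sup>2 * (q + p)\<^sup>2) \<le> r / (6 * (p\<^sup>2 * p)) * ((q - p)\<^sup>2 * (6 * p\<^sup>2))"
      using pos p3 \<open>(q + p)\<^sup>2 \<le> 6 * p\<^sup>2\<close> by (intro mult_left_mono) auto
    also have "\<dots> = r / p * (q - p)\<^sup>2" using pos by (simp add: field_simps)
    finally show ?thesis .
  qed
  have "sqrt (b * \<alpha>) = q * r" "sqrt (a * \<alpha>) = p * r" by (simp_all add: p_def q_def r_def real_sqrt_mult)
  then show ?thesis
    using eq quad unfolding p_def[symmetric] r_def[symmetric] unfolding sq by (simp add: distrib_right)
qed

lemma wall_time_eq:
  assumes "0 < \<alpha>" "\<alpha> < a" "0 < T"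
  shows "wall_time \<alpha> a ((a - b) / c2 \<alpha> a * T powr (1/3)) T = (1 - b) * T"
proof -
  have "T powr (1/3) * T powr (2/3) = T" using assms by (simp flip: powr_add)
  then have "c2 \<alpha> a * ((a - b) / c2 \<alpha> a * T powr (1/3)) * T powr (2/3) = (a - b) * T"
    using c2_pos[OF assms(1,2)] by (simp add: mult.assoc)
  then show ?thesis by (simp add: wall_time_def algebra_simps)
qed

lemma mu_eq:
  assumes "0 < \<alpha>" "\<alpha> < a" "0 < T"
  shows "mu \<alpha> a ((a - b) / c2 \<alpha> a * T powr (1/3)) T = (a - 2 * sqrt (a * \<alpha>) - (a - b) * (1 - sqrt \<alpha> / sqrt a)) * T"
proof -
  let ?A = "2 * \<alpha> powr (- 1/3) * a powr (1/3) * (sqrt a - sqrt \<alpha>) powr (4/3)"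
  have T: "T powr (1/3) * T powr (2/3) = T" using assms by (simp flip: powr_add)
  have c2: "c2 \<alpha> a > 0" by (rule c2_pos) (use assms in auto)
  have sa: "sqrt a > 0" using assms by simp
  have A: "?A / c2 \<alpha> a = 1 - sqrt \<alpha> / sqrt a"
    using mu_linear_coefficient[OF assms(1,2)] c2 sa by (simp add: field_simps)
  have "2 * ((a - b) / c2 \<alpha> a * T powr (1/3)) * \<alpha> powr (- 1/3) * a powr (1/3) * (sqrt a - sqrt \<alpha>) powr (4/3) * T powr (2/3)
    = (a - b) * (?A / c2 \<alpha> a) * (T powr (1/3) * T powr (2/3))" by simp
  also have "\<dots> = (a - b) * (1 - sqrt \<alpha> / sqrt a) * T" by (simp only: A T)
  finally show ?thesis
    using assms by (simp add: mu_def algebra_simps real_sqrt_mult)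
qed

lemma wall_assumptionD:
  assumes "wall_assumption f \<alpha> \<xi> n a \<epsilon>" "i \<le> n"
  shows "\<alpha> < a i" "a i \<le> 1" "0 < \<epsilon>" "\<epsilon> < a i - \<alpha>" "a 0 \<le> a i" "a i \<le> a n"
proof -
  have a: "strict_mono_on {..n} a" "\<forall>i\<le>n. \<alpha> < a i \<and> a i \<le> 1" "0 < \<epsilon>" "\<epsilon> < a 0 - \<alpha>"
    using assms(1) unfolding wall_assumption_def by blast+
  have mono: "a j \<le> a k" if "j \<le> k" "k \<le> n" for j k
    using a(1) that by (cases "j = k") (auto simp: strict_mono_on_def less_imp_le)
  show "\<alpha> < a i" "a i \<le> 1" "0 < \<epsilon>" "a 0 \<le> a i" "a i \<le> a n" using a mono assms(2) by auto
  then show "\<epsilon> < a i - \<alpha>" using a(4) by linarith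
qed

text \<open>At \<tau> = 0 the wall is inspected at the contact time itself; the convergent g
  contributes a term of order T^(1/3), which vanishes on the scale T.\<close>

lemma wall_limit:
  assumes w: "wall_assumption f \<alpha> \<xi> n a \<epsilon>" and \<alpha>: "0 < \<alpha>" and i: "i \<le> n"
  shows "((\<lambda>T. f T ((1 - a i) * T) / T) \<longlongrightarrow> \<xi> - step_shape \<alpha> (a i)) at_top"
proof -
  note D = wall_assumptionD[OF w i]
  define S :: "real set" where "S = (if i = n \<and> a n = 1 then {0..} else UNIV)"
  have "\<exists>g. \<forall>C. compact C \<and> C \<subseteq> S \<longrightarrow> uniform_limit C (\<lambda>T. g_resc f \<alpha> \<xi> (a i) T) g at_top"
    using w i unfolding wall_assumption_def Let_def S_def by blast
  then obtain g where "\<And>C. compact C \<Longrightarrow> C \<subseteq> S \<Longrightarrow> uniform_limit C (\<lambda>T. g_resc f \<alpha> \<xi> (a i) T) g at_top"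
    by blast
  from this[of "{0}"] have "uniform_limit {0} (\<lambda>T. g_resc f \<alpha> \<xi> (a i) T) g at_top" by (auto simp: S_def)
  then have lim: "((\<lambda>T. g_resc f \<alpha> \<xi> (a i) T 0) \<longlongrightarrow> g 0) at_top"
    by (rule tendsto_uniform_limitI) simp
  have "((\<lambda>T :: real. T powr (- 2/3)) \<longlongrightarrow> 0) at_top" by real_asymp
  from tendsto_mult[OF lim tendsto_mult[OF tendsto_const[of "c1 \<alpha> (a i)"] this]]
  have "((\<lambda>T. \<xi> - step_shape \<alpha> (a i) + g_resc f \<alpha> \<xi> (a i) T 0 * (c1 \<alpha> (a i) * T powr (- 2/3))) \<longlongrightarrow> \<xi> - step_shape \<alpha> (a i) + g 0 * (c1 \<alpha> (a i) * 0)) at_top"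
    by (intro tendsto_add tendsto_const)
  then have "((\<lambda>T. \<xi> - step_shape \<alpha> (a i) + g_resc f \<alpha> \<xi> (a i) T 0 * (c1 \<alpha> (a i) * T powr (- 2/3))) \<longlongrightarrow> \<xi> - step_shape \<alpha> (a i)) at_top"
    by simp
  then show ?thesis
  proof (rule Lim_transform_eventually)
    show "\<forall>\<^sub>F T in at_top. \<xi> - step_shape \<alpha> (a i) + g_resc f \<alpha> \<xi> (a i) T 0 * (c1 \<alpha> (a i) * T powr (- 2/3)) = f T ((1 - a i) * T) / T"
      using eventually_gt_at_top[of 0]
    proof eventually_elim
      case (elim T)
      have wt: "wall_time \<alpha> (a i) 0 T = (1 - a i) * T" by (simp add: wall_time_def)
      have mu: "mu \<alpha> (a i) 0 T = step_shape \<alpha> (a i) * T"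
        using \<alpha> D(1) by (simp add: mu_def step_shape_def algebra_simps real_sqrt_mult)
      have c1: "c1 \<alpha> (a i) > 0" by (rule c1_pos) (use \<alpha> D in auto)
      have pw: "T powr (- 2/3) = T powr (1/3) / T"
      proof -
        have "T powr (- 2/3) = T powr (1/3 - 1)" by simp
        also have "\<dots> = T powr (1/3) / T" using elim by (simp only: powr_diff) simp
        finally show ?thesis .
      qed
      have "f T ((1 - a i) * T) = \<xi> * T - mu \<alpha> (a i) 0 T - c1 \<alpha> (a i) * (0\<^sup>2 - g_resc f \<alpha> \<xi> (a i) T 0) * T powr (1/3)"
        using g_resc_iff[OF \<alpha> D(1) elim, of f 0 \<xi> "g_resc f \<alpha> \<xi> (a i) T 0"] wt by simp
      then show ?case using elim unfolding mu pw by (simp add: field_simps)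
    qed
  qed
qed

text \<open>Outside the contact windows part (a) gives the gain K. Inside, part (b) lets the wall
  fall by only half of the parabola, up to order T^(1/3), and \<open>step_shape_taylor\<close> turns
  the rest into the quadratic gain. The limit F is a hypothesis, as the wall need not converge at a
  general b.\<close>

lemma wall_lower:
  assumes w: "wall_assumption f \<alpha> \<xi> n a \<epsilon>" and \<alpha>: "0 < \<alpha>"
  obtains K where "K > 0"
    "\<And>b F. 0 \<le> b \<Longrightarrow> b \<le> 1 \<Longrightarrow> ((\<lambda>T. f T ((1 - b) * T) / T) \<longlongrightarrow> F) at_top \<Longrightarrow>
      F \<ge> \<xi> - step_shape \<alpha> b + K \<or> (\<exists>i\<le>n. F \<ge> \<xi> - step_shape \<alpha> b + sqrt \<alpha> / 24 * (b - a i)\<^sup>2)"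
proof -
  obtain K where K: "K > 0" and ev: "\<forall>\<^sub>F T in at_top. \<forall>t\<in>{0..T}. (\<forall>i\<le>n. \<bar>t - a i * T\<bar> > \<epsilon> * T) \<longrightarrow>
        f T (T - t) \<ge> f0 \<alpha> \<xi> ((T - t) / T) * T + K * T"
    using w unfolding wall_assumption_def by blast
  have main: "F \<ge> \<xi> - step_shape \<alpha> b + K \<or> (\<exists>i\<le>n. F \<ge> \<xi> - step_shape \<alpha> b + sqrt \<alpha> / 24 * (b - a i)\<^sup>2)"
    if b: "0 \<le> b" "b \<le> 1" and lim: "((\<lambda>T. f T ((1 - b) * T) / T) \<longlongrightarrow> F) at_top" for b F
  proof (cases "\<forall>i\<le>n. \<bar>b - a i\<bar> > \<epsilon>")
    case True
    have "\<forall>\<^sub>F T in at_top. \<xi> - step_shape \<alpha> b + K \<le> f T ((1 - b) * T) / T"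
      using ev eventually_gt_at_top[of 0]
    proof eventually_elim
      case (elim T)
      have "\<bar>b * T - a i * T\<bar> > \<epsilon> * T" if "i \<le> n" for i
      proof -
        have "\<bar>b * T - a i * T\<bar> = \<bar>b - a i\<bar> * T" using elim(2) by (simp add: abs_mult flip: left_diff_distrib)
        then show ?thesis using True that elim(2) by simp
      qed
      moreover have "b * T \<in> {0..T}" using b elim(2) by (simp add: mult_left_le_one_le)
      ultimately have "f T (T - b * T) \<ge> f0 \<alpha> \<xi> ((T - b * T) / T) * T + K * T" using elim(1) by blast
      moreover have "(T - b * T) / T = 1 - b" using elim(2) by (simp add: field_simps)
      moreover have "T - b * T = (1 - b) * T" by (simp add: algebra_simps)
      ultimately have "f T ((1 - b) * T) \<ge> (\<xi> - step_shape \<alpha> b + K) * T"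
        using f0_eq[OF b(1), of \<alpha> \<xi>] by (simp add: distrib_right)
      then show ?case using elim(2) by (simp add: pos_le_divide_eq)
    qed
    then have "\<xi> - step_shape \<alpha> b + K \<le> F"
      by (rule tendsto_lowerbound[OF lim]) simp
    then show ?thesis by simp
  next
    case False
    then obtain i where i: "i \<le> n" "\<bar>b - a i\<bar> \<le> \<epsilon>" by (auto simp: not_less)
    note D = wall_assumptionD[OF w i(1)]
    \<comment> \<open>Both follow from \<epsilon> < a i - \<alpha>: the contact window stays inside
      the range of the Taylor bound.\<close>
    have b\<alpha>: "\<alpha> < b" and b2: "b \<le> 2 * a i" using i(2) D \<alpha> by linarith+
    define c where "c = c2 \<alpha> (a i)"
    have c: "c > 0" unfolding c_def by (rule c2_pos) (use \<alpha> D in auto)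
    have c1: "c1 \<alpha> (a i) > 0" by (rule c1_pos) (use \<alpha> D in auto)
    define S :: "real set" where "S = (if i = n \<and> a n = 1 then {0..} else UNIV)"
    have "\<exists>B. \<forall>\<^sub>F T in at_top. \<forall>\<tau>\<in>S. \<bar>\<tau>\<bar> \<le> \<epsilon> * inverse (c2 \<alpha> (a i)) * T powr (1/3) \<and> wall_time \<alpha> (a i) \<tau> T \<ge> 0 \<longrightarrow>
           g_resc f \<alpha> \<xi> (a i) T \<tau> \<ge> - B + \<tau>\<^sup>2 / 2"
      using w i unfolding wall_assumption_def Let_def S_def by blast
    then obtain B where B: "\<forall>\<^sub>F T in at_top. \<forall>\<tau>\<in>S. \<bar>\<tau>\<bar> \<le> \<epsilon> * inverse (c2 \<alpha> (a i)) * T powr (1/3) \<and> wall_time \<alpha> (a i) \<tau> T \<ge> 0 \<longrightarrow>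
           g_resc f \<alpha> \<xi> (a i) T \<tau> \<ge> - B + \<tau>\<^sup>2 / 2" by blast
    have ev: "\<forall>\<^sub>F T in at_top. \<xi> - step_shape \<alpha> b + sqrt \<alpha> / 24 * (b - a i)\<^sup>2 - c1 \<alpha> (a i) * B * T powr (- 2/3) \<le> f T ((1 - b) * T) / T"
      using B eventually_gt_at_top[of 0]
    proof eventually_elim
      case (elim T)
      define \<tau> where "\<tau> = (a i - b) / c * T powr (1/3)"
      have wt: "wall_time \<alpha> (a i) \<tau> T = (1 - b) * T"
        unfolding \<tau>_def c_def by (rule wall_time_eq) (use \<alpha> D elim in auto)
      have "\<bar>a i - b\<bar> \<le> \<epsilon>" using i(2) by linarith
      then have "\<bar>a i - b\<bar> / c * T powr (1/3) \<le> \<epsilon> / c * T powr (1/3)"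
        using c by (intro mult_right_mono divide_right_mono) auto
      moreover have "\<bar>\<tau>\<bar> = \<bar>a i - b\<bar> / c * T powr (1/3)"
        using c by (simp add: \<tau>_def abs_mult)
      ultimately have 1: "\<bar>\<tau>\<bar> \<le> \<epsilon> * inverse c * T powr (1/3)" by (simp only: divide_inverse)
      have 2: "\<tau> \<in> S" using b c by (auto simp: S_def \<tau>_def)
      have 3: "(1 - b) * T \<ge> 0" using b elim by simp
      define g where "g = g_resc f \<alpha> \<xi> (a i) T \<tau>"
      have g: "g \<ge> - B + \<tau>\<^sup>2 / 2" using elim(1) 1 2 3 wt unfolding g_def c_def by metis
      have T1: "T powr (1/3) > 0" using elim by simp
      have f: "f T ((1 - b) * T) = \<xi> * T - mu \<alpha> (a i) \<tau> T - c1 \<alpha> (a i) * (\<tau>\<^sup>2 - g) * T powr (1/3)"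
        using g_resc_iff[OF \<alpha> D(1) elim(2), of f \<tau> \<xi> g] wt by (simp add: g_def)
      have mu: "mu \<alpha> (a i) \<tau> T = (a i - 2 * sqrt (a i * \<alpha>) - (a i - b) * (1 - sqrt \<alpha> / sqrt (a i))) * T"
        unfolding \<tau>_def c_def by (rule mu_eq) (use \<alpha> D elim in auto)
      have "\<tau>\<^sup>2 - g \<le> B + \<tau>\<^sup>2 / 2" using g by simp
      then have "c1 \<alpha> (a i) * (\<tau>\<^sup>2 - g) * T powr (1/3) \<le> c1 \<alpha> (a i) * (B + \<tau>\<^sup>2 / 2) * T powr (1/3)"
        using c1 T1 by simp
      also have "\<dots> = c1 \<alpha> (a i) * B * T powr (1/3) + sqrt \<alpha> / (8 * a i * sqrt (a i)) * (b - a i)\<^sup>2 * T"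
      proof -
        have "c1 \<alpha> (a i) / c\<^sup>2 = sqrt \<alpha> / (4 * a i * sqrt (a i))"
          using c1_c2_sqrt[OF \<alpha> D(1)] c \<alpha> D(1) unfolding c_def[symmetric] by (simp add: field_simps)
        note ratio = this
        define X P where "X = (a i - b) / c" and "P = T powr (1/3)"
        have "c1 \<alpha> (a i) * (X\<^sup>2 / 2) = c1 \<alpha> (a i) / c\<^sup>2 * ((b - a i)\<^sup>2 / 2)"
          by (simp add: X_def power_divide power2_commute[of "a i" b])
        also have "\<dots> = sqrt \<alpha> / (8 * a i * sqrt (a i)) * (b - a i)\<^sup>2" unfolding ratio by simp
        finally have X: "c1 \<alpha> (a i) * (X\<^sup>2 / 2) = sqrt \<alpha> / (8 * a i * sqrt (a i)) * (b - a i)\<^sup>2" .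
        have P: "P * P * P = T" using elim unfolding P_def by (simp flip: powr_add)
        have "c1 \<alpha> (a i) * (\<tau>\<^sup>2 / 2) * T powr (1/3) = (c1 \<alpha> (a i) * (X\<^sup>2 / 2)) * (P * P * P)"
          unfolding \<tau>_def X_def[symmetric] P_def[symmetric] by (simp add: power2_eq_square)
        also have "\<dots> = sqrt \<alpha> / (8 * a i * sqrt (a i)) * (b - a i)\<^sup>2 * T" by (simp only: X P)
        finally have "c1 \<alpha> (a i) * (\<tau>\<^sup>2 / 2) * T powr (1/3) = sqrt \<alpha> / (8 * a i * sqrt (a i)) * (b - a i)\<^sup>2 * T" .
        then show ?thesis by (simp add: algebra_simps)
      qed
      finally have "f T ((1 - b) * T) \<ge> \<xi> * T - (a i - 2 * sqrt (a i * \<alpha>) - (a i - b) * (1 - sqrt \<alpha> / sqrt (a i))) * T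
          - c1 \<alpha> (a i) * B * T powr (1/3) - sqrt \<alpha> / (8 * a i * sqrt (a i)) * (b - a i)\<^sup>2 * T"
        unfolding f mu by linarith
      also have "\<xi> * T - (a i - 2 * sqrt (a i * \<alpha>) - (a i - b) * (1 - sqrt \<alpha> / sqrt (a i))) * T
          - c1 \<alpha> (a i) * B * T powr (1/3) - sqrt \<alpha> / (8 * a i * sqrt (a i)) * (b - a i)\<^sup>2 * T
        = (\<xi> - (a i - 2 * sqrt (a i * \<alpha>) + (b - a i) * (1 - sqrt \<alpha> / sqrt (a i)) + sqrt \<alpha> / (8 * a i * sqrt (a i)) * (b - a i)\<^sup>2)) * T
          - c1 \<alpha> (a i) * B * T powr (1/3)"
        by (simp only: left_diff_distrib right_diff_distrib distrib_right distrib_left)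
      finally have le: "(\<xi> - (a i - 2 * sqrt (a i * \<alpha>) + (b - a i) * (1 - sqrt \<alpha> / sqrt (a i)) + sqrt \<alpha> / (8 * a i * sqrt (a i)) * (b - a i)\<^sup>2)) * T
          - c1 \<alpha> (a i) * B * T powr (1/3) \<le> f T ((1 - b) * T)" .
      have ss: "step_shape \<alpha> b = b - 2 * sqrt (b * \<alpha>)" using b\<alpha> by (simp add: step_shape_def)
      have "\<xi> - step_shape \<alpha> b + sqrt \<alpha> / 24 * (b - a i)\<^sup>2
         \<le> \<xi> - (a i - 2 * sqrt (a i * \<alpha>) + (b - a i) * (1 - sqrt \<alpha> / sqrt (a i)) + sqrt \<alpha> / (8 * a i * sqrt (a i)) * (b - a i)\<^sup>2)"
        using step_shape_taylor[OF \<alpha> D(1) b\<alpha> D(2) b2] unfolding ss by linarith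
      then have "(\<xi> - step_shape \<alpha> b + sqrt \<alpha> / 24 * (b - a i)\<^sup>2) * T
         \<le> (\<xi> - (a i - 2 * sqrt (a i * \<alpha>) + (b - a i) * (1 - sqrt \<alpha> / sqrt (a i)) + sqrt \<alpha> / (8 * a i * sqrt (a i)) * (b - a i)\<^sup>2)) * T"
        using elim by (intro mult_right_mono) auto
      with le have "(\<xi> - step_shape \<alpha> b + sqrt \<alpha> / 24 * (b - a i)\<^sup>2) * T - c1 \<alpha> (a i) * B * T powr (1/3) \<le> f T ((1 - b) * T)"
        by linarith
      moreover have "T powr (- 2/3) * T = T powr (1/3)"
      proof -
        have "T powr (- 2/3) * T powr 1 = T powr (1/3)" by (simp only: powr_add[symmetric]) simp
        then show ?thesis using elim by simp
      qed
      ultimately have "(\<xi> - step_shape \<alpha> b + sqrt \<alpha> / 24 * (b - a i)\<^sup>2 - c1 \<alpha> (a i) * B * T powr (- 2/3)) * T \<le> f T ((1 - b) * T)"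
        by (simp only: left_diff_distrib mult.assoc)
      then show ?case using elim by (simp only: pos_le_divide_eq)
    qed
    have lim': "((\<lambda>T. \<xi> - step_shape \<alpha> b + sqrt \<alpha> / 24 * (b - a i)\<^sup>2 - c1 \<alpha> (a i) * B * T powr (- 2/3)) \<longlongrightarrow>
        \<xi> - step_shape \<alpha> b + sqrt \<alpha> / 24 * (b - a i)\<^sup>2 - c1 \<alpha> (a i) * B * 0) at_top"
      by (intro tendsto_intros) real_asymp
    have "\<xi> - step_shape \<alpha> b + sqrt \<alpha> / 24 * (b - a i)\<^sup>2 - c1 \<alpha> (a i) * B * 0 \<le> F"
      by (rule tendsto_le[OF trivial_limit_at_top_linorder lim lim' ev])
    then show ?thesis using i(1) by auto
  qed
  show thesis by (rule that[OF K]) (use main in blast)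
qed

subsection \<open>Macroscopic positions\<close>

lemma sqrt_diff_eq:
  assumes "0 < u" "0 < v"
  shows "sqrt u - sqrt v = (u - v) / (sqrt u + sqrt v)"
proof -
  have "(sqrt u - sqrt v) * (sqrt u + sqrt v) = u - v" using assms by (simp add: algebra_simps)
  moreover have "sqrt u + sqrt v > 0" using assms by (simp add: add_pos_pos)
  ultimately show ?thesis by (simp add: field_simps)
qed

locale wall_setting = clocks M W for M :: "'w measure" and W :: "nat \<Rightarrow> nat \<Rightarrow> 'w \<Rightarrow> real" +
  fixes f :: "real \<Rightarrow> real \<Rightarrow> real" and x0 :: "nat \<Rightarrow> int" and xi :: "real \<Rightarrow> real"
    and \<alpha> \<xi> \<epsilon> :: real and n :: nat and a :: "nat \<Rightarrow> real"
  assumes wall: "\<And>T. T > 0 \<Longrightarrow> is_wall (f T)"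
    and initial: "admissible_initial x0"
    and alpha: "0 < \<alpha>" "\<alpha> < 1"
    and standing: "\<forall>\<^sub>F \<beta> in nhds \<alpha>.
          scales_like M (wall_position W f x0 \<beta>) (xi \<beta>) \<and>
          (affected f \<beta> (xi \<beta>) \<or> not_affected M W f x0 \<beta> (xi \<beta>))"
    and scaling: "scales_like M (wall_position W f x0 \<alpha>) \<xi>"
    and wall_assm: "wall_assumption f \<alpha> \<xi> n a \<epsilon>"
begin

abbreviation "xf \<equiv> wall_position W f x0"

abbreviation "lim_r \<eta> \<equiv> lim_in_prob M (ratio_r W f x0 \<alpha> \<eta>)"

abbreviation "lim_l \<eta> \<equiv> lim_in_prob M (ratio_l W f x0 \<alpha> \<eta>)"

lemma wall_measurable: "T > 0 \<Longrightarrow> xf \<beta> T \<in> borel_measurable M"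
  by (rule wall_position_measurable) (rule wall)

lemma wall_position_over_T_measurable: "T > 0 \<Longrightarrow> (\<lambda>\<omega>. xf \<beta> T \<omega> / T) \<in> borel_measurable M"
  by (intro borel_measurable_divide wall_measurable) simp_all

lemma whp_wall_position:
  assumes "scales_like M (xf \<beta>) u" "e > 0"
  shows "whp M (\<lambda>T \<omega>. \<bar>xf \<beta> T \<omega> / T - u\<bar> \<le> e)"
proof (rule tendsto_in_probD)
  show "tendsto_in_prob M (\<lambda>T \<omega>. xf \<beta> T \<omega> / T) u"
    using assms(1) by (simp only: scales_like_def)
qed (rule wall_position_over_T_measurable, assumption, rule assms(2))

lemma ratio_tendsto:
  assumes "scales_like M (xf \<beta>\<^sub>1) u" "scales_like M (xf \<beta>\<^sub>2) v" "u \<noteq> v"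
  shows "tendsto_in_prob M (\<lambda>T \<omega>. \<eta> * T / (xf \<beta>\<^sub>1 T \<omega> - xf \<beta>\<^sub>2 T \<omega>)) (\<eta> / (u - v))"
proof (rule tendsto_in_probI)
  fix e :: real assume e: "e > 0"
  have "continuous (at (u - v)) (\<lambda>x. \<eta> / x)" using assms(3) by (intro continuous_intros) auto
  then obtain d where d: "d > 0" "\<And>x. \<bar>x - (u - v)\<bar> < d \<Longrightarrow> \<bar>\<eta> / x - \<eta> / (u - v)\<bar> < e"
    using e unfolding continuous_at_eps_delta by (auto simp: dist_real_def abs_minus_commute)
  have d3: "d / 3 > 0" using d by simp
  from whp_conj[OF whp_wall_position[OF assms(1) d3] whp_wall_position[OF assms(2) d3]]
  show "whp M (\<lambda>T \<omega>. \<bar>\<eta> * T / (xf \<beta>\<^sub>1 T \<omega> - xf \<beta>\<^sub>2 T \<omega>) - \<eta> / (u - v)\<bar> \<le> e)"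
  proof (rule whp_monoI[where c=0])
    fix T \<omega>
    define p q where "p = xf \<beta>\<^sub>1 T \<omega>" and "q = xf \<beta>\<^sub>2 T \<omega>"
    assume T: "(0 :: real) < T" and "\<bar>xf \<beta>\<^sub>1 T \<omega> / T - u\<bar> \<le> d / 3 \<and> \<bar>xf \<beta>\<^sub>2 T \<omega> / T - v\<bar> \<le> d / 3"
    then have "\<bar>(p / T - q / T) - (u - v)\<bar> < d" using d(1) unfolding p_def[symmetric] q_def[symmetric] by linarith
    then have "\<bar>\<eta> / (p / T - q / T) - \<eta> / (u - v)\<bar> < e" by (rule d(2))
    moreover have "\<eta> / (p / T - q / T) = \<eta> * T / (p - q)" using T by (simp flip: diff_divide_distrib)
    ultimately show "\<bar>\<eta> * T / (xf \<beta>\<^sub>1 T \<omega> - xf \<beta>\<^sub>2 T \<omega>) - \<eta> / (u - v)\<bar> \<le> e"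
      unfolding p_def[symmetric] q_def[symmetric] by linarith
  qed
qed

lemma ratio_measurable:
  "T > 0 \<Longrightarrow> (\<lambda>\<omega>. \<eta> * T / (xf \<beta>\<^sub>1 T \<omega> - xf \<beta>\<^sub>2 T \<omega>)) \<in> borel_measurable M"
  by (intro borel_measurable_divide borel_measurable_diff wall_measurable) simp_all

text \<open>Evaluated at the contact time a i of \<alpha>, where the wall value is known. An
  affected \<beta> bounds this value from below by its own Wall Assumption; for an unaffected one,
  the step particle at time a i T lies above \<xi>_\<beta> T minus the wall, and
  \<open>step_upper\<close> bounds its position.\<close>

lemma xi_upper:
  assumes good: "scales_like M (xf \<beta>) (xi \<beta>)" "affected f \<beta> (xi \<beta>) \<or> not_affected M W f x0 \<beta> (xi \<beta>)"
    and \<beta>: "0 < \<beta>" "\<beta> < a i" and i: "i \<le> n"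
  shows "xi \<beta> - \<xi> \<le> step_shape \<beta> (a i) - step_shape \<alpha> (a i)"
proof -
  note D = wall_assumptionD[OF wall_assm i]
  note lim = wall_limit[OF wall_assm alpha(1) i]
  have "xi \<beta> - step_shape \<beta> (a i) \<le> \<xi> - step_shape \<alpha> (a i)"
    using good(2)
  proof
    assume "affected f \<beta> (xi \<beta>)"
    then obtain n' a' \<epsilon>' where w: "wall_assumption f \<beta> (xi \<beta>) n' a' \<epsilon>'" by (auto simp: affected_def)
    obtain K where K: "K > 0" "\<And>b F. 0 \<le> b \<Longrightarrow> b \<le> 1 \<Longrightarrow> ((\<lambda>T. f T ((1 - b) * T) / T) \<longlongrightarrow> F) at_top \<Longrightarrow>
      F \<ge> xi \<beta> - step_shape \<beta> b + K \<or> (\<exists>i\<le>n'. F \<ge> xi \<beta> - step_shape \<beta> b + sqrt \<beta> / 24 * (b - a' i)\<^sup>2)"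
      using wall_lower[OF w \<beta>(1)] by blast
    have "sqrt \<beta> / 24 * (a i - a' j)\<^sup>2 \<ge> 0" for j using \<beta> by simp
    then show ?thesis using K(2)[OF _ D(2) lim] K(1) D(1) alpha by (smt (verit))
  next
    assume na: "not_affected M W f x0 \<beta> (xi \<beta>)"
    have "((\<lambda>T. prob {\<omega> \<in> space M. \<forall>t\<in>{0..T}.
          step_position (label \<beta> T) t \<omega> > xi \<beta> * T - f T (T - t) - 0 * T powr (1/3)}) \<longlongrightarrow> 1) at_top"
      using na unfolding not_affected_def by blast
    then have 1: "whp M (\<lambda>T \<omega>. \<forall>t\<in>{0..T}. step_position (label \<beta> T) t \<omega> > xi \<beta> * T - f T (T - t) - 0 * T powr (1/3))"
      by (rule whp_tendsto_1)
    have "xi \<beta> - (\<xi> - step_shape \<alpha> (a i)) \<le> step_shape \<beta> (a i) + \<delta>" if \<delta>: "\<delta> > 0" for \<delta>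
    proof -
      have ss: "step_shape \<beta> (a i) = a i - 2 * sqrt (a i * \<beta>)" using \<beta> by (simp add: step_shape_def)
      have "\<forall>\<^sub>F T in at_top. xi \<beta> - f T ((1 - a i) * T) / T \<le> step_shape \<beta> (a i) + \<delta>"
        using whp_ex[OF whp_conj[OF 1 step_upper[OF \<beta> \<delta>]]] eventually_gt_at_top[of 0]
      proof eventually_elim
        case (elim T)
        then obtain \<omega> where \<omega>: "\<forall>t\<in>{0..T}. step_position (label \<beta> T) t \<omega> > xi \<beta> * T - f T (T - t) - 0 * T powr (1/3)"
          "step_position (label \<beta> T) (a i * T) \<omega> \<le> (a i - 2 * sqrt (a i * \<beta>) + \<delta>) * T" by blast
        have "a i * T \<in> {0..T}" using D alpha elim by (simp add: mult_left_le_one_le)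
        then have "xi \<beta> * T - f T (T - a i * T) < (step_shape \<beta> (a i) + \<delta>) * T" using \<omega> unfolding ss by fastforce
        moreover have "T - a i * T = (1 - a i) * T" by (simp add: algebra_simps)
        ultimately show ?case using elim by (simp add: field_simps)
      qed
      then show ?thesis
        using tendsto_upperbound[OF tendsto_diff[OF tendsto_const lim]] by (meson trivial_limit_at_top_linorder)
    qed
    then have "xi \<beta> - (\<xi> - step_shape \<alpha> (a i)) \<le> step_shape \<beta> (a i)" by (rule field_le_epsilon)
    then show ?thesis by simp
  qed
  then show ?thesis by simp
qed

text \<open>b stands for a contact time of \<beta>. There the wall value is known, and the Wall
  Assumption of \<alpha> bounds it with either the fixed gain K or the quadratic gain around some a
  i.\<close>

definition has_gain :: "real \<Rightarrow> real \<Rightarrow> real \<Rightarrow> bool" where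
  "has_gain K \<beta> b \<longleftrightarrow> \<beta> < b \<and> b \<le> 1 \<and>
     (step_shape \<beta> b - step_shape \<alpha> b + K \<le> xi \<beta> - \<xi> \<or>
      (\<exists>i\<le>n. step_shape \<beta> b - step_shape \<alpha> b + sqrt \<alpha> / 24 * (b - a i)\<^sup>2 \<le> xi \<beta> - \<xi>))"

text \<open>The roles are exchanged: the first contact time of \<beta> is inserted into the lower
  bound that the Wall Assumption of \<alpha> provides. K belongs to \<alpha>, so it is uniform in
  \<beta>.\<close>

lemma xi_lower_affected:
  obtains K where "K > 0"
    "\<And>\<beta>. 0 < \<beta> \<Longrightarrow> affected f \<beta> (xi \<beta>) \<Longrightarrow> \<exists>b. has_gain K \<beta> b"
proof -
  obtain K where K: "K > 0" "\<And>b F. 0 \<le> b \<Longrightarrow> b \<le> 1 \<Longrightarrow> ((\<lambda>T. f T ((1 - b) * T) / T) \<longlongrightarrow> F) at_top \<Longrightarrow>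
      F \<ge> \<xi> - step_shape \<alpha> b + K \<or> (\<exists>i\<le>n. F \<ge> \<xi> - step_shape \<alpha> b + sqrt \<alpha> / 24 * (b - a i)\<^sup>2)"
    using wall_lower[OF wall_assm alpha(1)] by blast
  have main: "\<exists>b. has_gain K \<beta> b"
    if \<beta>: "0 < \<beta>" and aff: "affected f \<beta> (xi \<beta>)" for \<beta>
  proof -
    obtain n' a' \<epsilon>' where w: "wall_assumption f \<beta> (xi \<beta>) n' a' \<epsilon>'" using aff by (auto simp: affected_def)
    note D = wall_assumptionD[OF w le0]
    have "xi \<beta> - step_shape \<beta> (a' 0) \<ge> \<xi> - step_shape \<alpha> (a' 0) + K \<or>
      (\<exists>i\<le>n. xi \<beta> - step_shape \<beta> (a' 0) \<ge> \<xi> - step_shape \<alpha> (a' 0) + sqrt \<alpha> / 24 * (a' 0 - a i)\<^sup>2)"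
      by (rule K(2)[OF _ D(2) wall_limit[OF w \<beta> le0]]) (use \<beta> D in simp)
    then show ?thesis using D(1,2) by (intro exI[of _ "a' 0"]) (auto simp: has_gain_def algebra_simps)
  qed
  show thesis by (rule that[OF K(1) main])
qed

text \<open>With the same clocks the free gap between labels \<beta> T and \<alpha> T is at least
  the step gap, about 2 (sqrt \<alpha> - sqrt \<beta>) T. An unaffected particle sits at its free
  position on the scale T, and the wall can only hold particle \<alpha> T back, which widens the
  gap.\<close>

lemma xi_lower_not_affected:
  assumes good: "scales_like M (xf \<beta>) (xi \<beta>)" "not_affected M W f x0 \<beta> (xi \<beta>)"
    and \<beta>: "0 < \<beta>" "\<beta> < \<alpha>"
  shows "xi \<beta> - \<xi> \<ge> 2 * (sqrt \<alpha> - sqrt \<beta>)"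
proof -
  have free: "tendsto_in_prob M (\<lambda>T \<omega>. free_position W x0 \<beta> T \<omega> / T) (xi \<beta>)"
    using good(2) by (auto simp: not_affected_def scales_like_def)
  have y: "strict_antimono_on {1..} x0" using initial by (simp add: admissible_initial_def)
  have "2 * (sqrt \<alpha> - sqrt \<beta>) \<le> xi \<beta> - \<xi> + 4 * e" if e: "e > 0" for e
  proof -
    have f: "whp M (\<lambda>T \<omega>. \<bar>free_position W x0 \<beta> T \<omega> / T - xi \<beta>\<bar> \<le> e)"
      by (rule tendsto_in_probD[OF free _ e]) measurable
    have low: "whp M (\<lambda>T \<omega>. step_position (label \<beta> T) (1 * T) \<omega> \<ge> (1 - 2 * sqrt (1 * \<beta>) - e) * T)"
      using \<beta> alpha e by (intro step_lower) auto
    have up: "whp M (\<lambda>T \<omega>. step_position (label \<alpha> T) (1 * T) \<omega> \<le> (1 - 2 * sqrt (1 * \<alpha>) + e) * T)"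
      using alpha e by (intro step_upper) auto
    \<comment> \<open>The claim concerns constants only, so a single outcome at one large T, on
      which all four events hold, suffices.\<close>
    have "\<forall>\<^sub>F T :: real in at_top. 2 * (sqrt \<alpha> - sqrt \<beta>) \<le> xi \<beta> - \<xi> + 4 * e"
      using whp_ex[OF whp_conj[OF whp_conj[OF f whp_wall_position[OF scaling e]] whp_conj[OF low up]]]
        eventually_gt_at_top[of 0] eventually_gt_at_top[of "1 / \<beta>"]
    proof eventually_elim
      case (elim T)
      then obtain \<omega> where \<omega>: "\<omega> \<in> space M" "\<bar>free_position W x0 \<beta> T \<omega> / T - xi \<beta>\<bar> \<le> e"
        "\<bar>xf \<alpha> T \<omega> / T - \<xi>\<bar> \<le> e"
        "step_position (label \<beta> T) T \<omega> \<ge> (1 - 2 * sqrt \<beta> - e) * T"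
        "step_position (label \<alpha> T) T \<omega> \<le> (1 - 2 * sqrt \<alpha> + e) * T" by auto
      let ?\<sigma> = "ring_time W \<omega>"
      have \<sigma>: "\<forall>n\<ge>1. clock_times (?\<sigma> n)" using clock_times_ring[OF \<omega>(1)] by blast
      have "\<beta> * T > 1" using elim \<beta> by (simp add: field_simps)
      then have l: "1 \<le> label \<beta> T" unfolding label_def by linarith
      have "\<beta> * T \<le> \<alpha> * T" using \<beta> elim by simp
      then have ll: "label \<beta> T \<le> label \<alpha> T" unfolding label_def by (intro nat_mono floor_mono)
      have "tasep ?\<sigma> no_wall step_initial (label \<beta> T) T - tasep ?\<sigma> no_wall step_initial (label \<alpha> T) T
         \<le> tasep ?\<sigma> no_wall x0 (label \<beta> T) T - tasep ?\<sigma> no_wall x0 (label \<alpha> T) T"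
      proof (rule tasep_free_gap_mono[OF \<sigma> _ l ll])
        fix k :: nat assume "1 \<le> k"
        then have "x0 (Suc k) < x0 k" using y by (auto simp: monotone_on_def)
        then show "step_initial k - step_initial (Suc k) \<le> x0 k - x0 (Suc k)" by (simp add: step_initial_def)
      qed
      then have 1: "step_position (label \<beta> T) T \<omega> - step_position (label \<alpha> T) T \<omega>
         \<le> free_position W x0 \<beta> T \<omega> - free_position W x0 \<alpha> T \<omega>"
        unfolding position_def free_position_def by linarith
      have 2: "xf \<alpha> T \<omega> \<le> free_position W x0 \<alpha> T \<omega>"
        unfolding position_def free_position_def wall_position_def of_int_le_iff by (rule tasep_wall_le_free[OF \<sigma>])
      have 3: "free_position W x0 \<beta> T \<omega> \<le> (xi \<beta> + e) * T" "(\<xi> - e) * T \<le> xf \<alpha> T \<omega>"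
        using \<omega>(2,3) elim(2) by (simp_all add: pos_le_divide_eq[symmetric] pos_divide_le_eq[symmetric] abs_le_iff)
      have "(1 - 2 * sqrt \<beta> - e) * T - (1 - 2 * sqrt \<alpha> + e) * T \<le> (xi \<beta> + e) * T - (\<xi> - e) * T"
        using 1 2 3 \<omega>(4,5) by linarith
      then have "((1 - 2 * sqrt \<beta> - e) - (1 - 2 * sqrt \<alpha> + e)) * T \<le> ((xi \<beta> + e) - (\<xi> - e)) * T"
        by (simp only: left_diff_distrib)
      then have "(1 - 2 * sqrt \<beta> - e) - (1 - 2 * sqrt \<alpha> + e) \<le> (xi \<beta> + e) - (\<xi> - e)"
        using elim(2) by (simp only: mult_le_cancel_right_pos)
      then show ?case by (simp add: algebra_simps)
    qed
    then show ?thesis by simp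
  qed
  from this[of "_ / 4"] have "2 * (sqrt \<alpha> - sqrt \<beta>) \<le> xi \<beta> - \<xi> + e" if "e > 0" for e
    using that by fastforce
  then show ?thesis by (rule field_le_epsilon)
qed

subsection \<open>Densities\<close>

text \<open>The solution r of sqrt \<alpha> / 24 r^2 = 2 \<eta> / sqrt \<alpha>: the quadratic gain
  cannot exceed the largest possible displacement, which is 2 \<eta> / sqrt \<alpha>.\<close>

definition spread :: "real \<Rightarrow> real" where
  "spread \<eta> = sqrt (48 * \<eta> / \<alpha>)"

lemma spread_bound:
  assumes "\<eta> > 0" "sqrt \<alpha> / 24 * (b - c)\<^sup>2 \<le> 2 * \<eta> / sqrt \<alpha>"
  shows "\<bar>b - c\<bar> \<le> spread \<eta>"
proof -
  have "(b - c)\<^sup>2 \<le> 48 * \<eta> / \<alpha>"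
  proof -
    have "sqrt \<alpha> * sqrt \<alpha> = \<alpha>" "sqrt \<alpha> > 0" using alpha by simp_all
    moreover have "sqrt \<alpha> * (sqrt \<alpha> / 24 * (b - c)\<^sup>2) \<le> sqrt \<alpha> * (2 * \<eta> / sqrt \<alpha>)"
      using assms(2) alpha by (intro mult_left_mono) auto
    ultimately have "\<alpha> / 24 * (b - c)\<^sup>2 \<le> 2 * \<eta>" by (simp add: mult.assoc[symmetric])
    then show ?thesis using alpha by (simp add: field_simps)
  qed
  then show ?thesis unfolding spread_def by (metis real_sqrt_abs real_sqrt_le_mono)
qed

lemma sqrt_diff_bound:
  assumes "0 < \<beta>" "\<eta> > 0" "\<beta> = \<alpha> - \<eta> \<or> \<beta> = \<alpha> + \<eta>"
  shows "\<bar>sqrt \<alpha> - sqrt \<beta>\<bar> = \<eta> / (sqrt \<alpha> + sqrt \<beta>)" "\<bar>sqrt \<alpha> - sqrt \<beta>\<bar> \<le> \<eta> / sqrt \<alpha>"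
proof -
  have pos: "sqrt \<alpha> + sqrt \<beta> > 0" "sqrt \<alpha> > 0" using assms alpha by (auto intro: add_pos_pos)
  show 1: "\<bar>sqrt \<alpha> - sqrt \<beta>\<bar> = \<eta> / (sqrt \<alpha> + sqrt \<beta>)"
    unfolding sqrt_diff_eq[OF alpha(1) assms(1)] using pos(1) assms(2,3) by auto
  show "\<bar>sqrt \<alpha> - sqrt \<beta>\<bar> \<le> \<eta> / sqrt \<alpha>" unfolding 1 using pos assms by (intro divide_left_mono) auto
qed

lemma eventually_spread_less: "c > 0 \<Longrightarrow> \<forall>\<^sub>F \<eta> in at_right 0. spread \<eta> < c"
proof -
  assume c: "c > 0"
  have "((\<lambda>\<eta>. sqrt (48 * \<eta> / \<alpha>)) \<longlongrightarrow> sqrt (48 * 0 / \<alpha>)) (at_right 0)"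
    using alpha by (intro tendsto_intros) auto
  then have "(spread \<longlongrightarrow> 0) (at_right 0)" by (simp add: spread_def[abs_def])
  then show ?thesis using c by (rule order_tendstoD)
qed

lemma eventually_good_right:
  "\<forall>\<^sub>F \<eta> in at_right 0. scales_like M (xf (\<alpha> - \<eta>)) (xi (\<alpha> - \<eta>)) \<and>
     (affected f (\<alpha> - \<eta>) (xi (\<alpha> - \<eta>)) \<or> not_affected M W f x0 (\<alpha> - \<eta>) (xi (\<alpha> - \<eta>)))"
proof -
  have "((\<lambda>\<eta>. \<alpha> - \<eta>) \<longlongrightarrow> \<alpha> - 0) (at_right 0)" by (intro tendsto_intros)
  then show ?thesis using eventually_compose_filterlim[OF standing] by simp
qed

lemma eventually_good_left:
  "\<forall>\<^sub>F \<eta> in at_right 0. scales_like M (xf (\<alpha> + \<eta>)) (xi (\<alpha> + \<eta>)) \<and>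
     (affected f (\<alpha> + \<eta>) (xi (\<alpha> + \<eta>)) \<or> not_affected M W f x0 (\<alpha> + \<eta>) (xi (\<alpha> + \<eta>)))"
proof -
  have "((\<lambda>\<eta>. \<alpha> + \<eta>) \<longlongrightarrow> \<alpha> + 0) (at_right 0)" by (intro tendsto_intros)
  then show ?thesis using eventually_compose_filterlim[OF standing] by simp
qed

lemma eventually_lt_right: "c > 0 \<Longrightarrow> \<forall>\<^sub>F \<eta> in at_right (0::real). 0 < \<eta> \<and> \<eta> < c"
  by (subst eventually_at_right[of 0 c]) auto

text \<open>A crude upper bound of order \<eta> on the displacement rules out the fixed gain K and,
  through the quadratic gain, confines the contact time of an affected \<alpha> - \<eta> to within
  \<open>spread\<close> of some a i, hence above a 0 minus \<open>spread\<close>.\<close>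

lemma right_bounds:
  "\<forall>\<^sub>F \<eta> in at_right 0. 2 * sqrt (a 0 - spread \<eta>) * (\<eta> / (sqrt \<alpha> + sqrt (\<alpha> - \<eta>))) \<le> xi (\<alpha> - \<eta>) - \<xi> \<and>
     xi (\<alpha> - \<eta>) - \<xi> \<le> 2 * sqrt (a 0) * (\<eta> / (sqrt \<alpha> + sqrt (\<alpha> - \<eta>))) \<and> \<alpha> < a 0 - spread \<eta>"
proof -
  note D = wall_assumptionD[OF wall_assm le0]
  obtain K where K: "K > 0" "\<And>\<beta>. 0 < \<beta> \<Longrightarrow> affected f \<beta> (xi \<beta>) \<Longrightarrow> \<exists>b. has_gain K \<beta> b"
    using xi_lower_affected by blast
  \<comment> \<open>Thresholds: \<eta> below the first makes 2 \<eta> / sqrt \<alpha> smaller than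
    K, and \<open>spread\<close> below the second keeps the contact time above \<alpha>.\<close>
  have "K * sqrt \<alpha> / 2 > 0" "a 0 - \<alpha> > 0" using K alpha D by simp_all
  note ev = eventually_lt_right[OF alpha(1)] eventually_lt_right[OF this(1)] eventually_spread_less[OF this(2)] eventually_good_right
  show ?thesis
    using ev
  proof eventually_elim
    case (elim \<eta>)
    define \<beta> where "\<beta> = \<alpha> - \<eta>"
    define \<Delta> where "\<Delta> = sqrt \<alpha> - sqrt \<beta>"
    have \<beta>: "0 < \<beta>" "\<beta> < \<alpha>" using elim by (simp_all add: \<beta>_def)
    have \<eta>: "\<eta> > 0" and sp: "\<alpha> < a 0 - spread \<eta>" "spread \<eta> \<ge> 0" using elim alpha by (auto simp: spread_def)
    have \<Delta>: "\<Delta> > 0" using \<beta> by (simp add: \<Delta>_def)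
    then have abs: "\<bar>sqrt \<alpha> - sqrt \<beta>\<bar> = \<Delta>" unfolding \<Delta>_def by linarith
    have alt\<beta>: "\<beta> = \<alpha> - \<eta> \<or> \<beta> = \<alpha> + \<eta>" by (simp add: \<beta>_def)
    note \<Delta>1 = sqrt_diff_bound(1)[OF \<beta>(1) \<eta> alt\<beta>, unfolded abs]
    note \<Delta>2 = sqrt_diff_bound(2)[OF \<beta>(1) \<eta> alt\<beta>, unfolded abs]
    have shape: "step_shape \<beta> b - step_shape \<alpha> b = 2 * sqrt b * \<Delta>" if "b > \<alpha>" for b
      using that \<beta> by (simp add: step_shape_def \<Delta>_def real_sqrt_mult algebra_simps)
    have good: "scales_like M (xf \<beta>) (xi \<beta>)" "affected f \<beta> (xi \<beta>) \<or> not_affected M W f x0 \<beta> (xi \<beta>)"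
      using elim by (simp_all add: \<beta>_def)
    have up: "xi \<beta> - \<xi> \<le> 2 * sqrt (a 0) * \<Delta>"
      using xi_upper[OF good \<beta>(1) _ le0] shape[OF D(1)] \<beta> D by simp
    also have "\<dots> \<le> 2 * 1 * (\<eta> / sqrt \<alpha>)"
      using D \<Delta> \<Delta>2 alpha by (intro mult_mono) auto
    finally have up': "xi \<beta> - \<xi> \<le> 2 * \<eta> / sqrt \<alpha>" by simp
    have "2 * sqrt (a 0 - spread \<eta>) * \<Delta> \<le> xi \<beta> - \<xi>"
      using good(2)
    proof
      assume "not_affected M W f x0 \<beta> (xi \<beta>)"
      from xi_lower_not_affected[OF good(1) this \<beta>] have "2 * 1 * \<Delta> \<le> xi \<beta> - \<xi>" by (simp add: \<Delta>_def)
      moreover have "2 * sqrt (a 0 - spread \<eta>) * \<Delta> \<le> 2 * 1 * \<Delta>"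
        using \<Delta> sp D by (intro mult_right_mono mult_left_mono) auto
      ultimately show ?thesis by linarith
    next
      assume "affected f \<beta> (xi \<beta>)"
      then obtain b where b: "b > \<beta>" "b \<le> 1" and alt: "xi \<beta> - \<xi> \<ge> step_shape \<beta> b - step_shape \<alpha> b + K \<or>
       (\<exists>i\<le>n. xi \<beta> - \<xi> \<ge> step_shape \<beta> b - step_shape \<alpha> b + sqrt \<alpha> / 24 * (b - a i)\<^sup>2)"
        using K(2)[OF \<beta>(1)] unfolding has_gain_def by blast
      \<comment> \<open>The contact time is so far known only to exceed \<beta>; for b <= \<alpha>
        the step particle \<alpha> still rests at - \<alpha>.\<close>
      have nonneg: "step_shape \<beta> b - step_shape \<alpha> b \<ge> 0"
      proof (cases "b > \<alpha>")
        case True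
        then show ?thesis using shape[OF True] \<Delta> alpha by simp
      next
        case False
        have "b - 2 * sqrt (b * \<beta>) + \<beta> = (sqrt b - sqrt \<beta>)\<^sup>2"
          using b \<beta> by (simp add: power2_eq_square algebra_simps real_sqrt_mult)
        then have "b - 2 * sqrt (b * \<beta>) + \<beta> \<ge> 0" by simp
        then show ?thesis using False b \<beta> by (simp add: step_shape_def)
      qed
      have "2 * \<eta> / sqrt \<alpha> < K" using elim alpha by (simp add: field_simps)
      with alt nonneg up' obtain i where i: "i \<le> n" "xi \<beta> - \<xi> \<ge> step_shape \<beta> b - step_shape \<alpha> b + sqrt \<alpha> / 24 * (b - a i)\<^sup>2"
        by fastforce
      have "\<bar>b - a i\<bar> \<le> spread \<eta>" by (rule spread_bound[OF \<eta>]) (use i(2) nonneg up' in linarith)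
      then have b': "a 0 - spread \<eta> \<le> b" using wall_assumptionD(5)[OF wall_assm i(1)] by linarith
      then have "2 * sqrt (a 0 - spread \<eta>) * \<Delta> \<le> 2 * sqrt b * \<Delta>"
        using \<Delta> by (intro mult_right_mono mult_left_mono) auto
      also have "\<dots> = step_shape \<beta> b - step_shape \<alpha> b" using shape b' sp by simp
      also have "\<dots> \<le> xi \<beta> - \<xi>"
      proof -
        have "sqrt \<alpha> / 24 * (b - a i)\<^sup>2 \<ge> 0" using alpha by simp
        then show ?thesis using i(2) by linarith
      qed
      finally show ?thesis .
    qed
    then show ?case using up sp unfolding \<Delta>1 by (simp add: \<beta>_def)
  qed
qed

text \<open>Each contact time a i bounds the displacement by a multiple of sqrt (a i); hence the
  last contact time gives the strongest bound to the left and the first one to the right.\<close>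

lemma left_upper:
  "\<forall>\<^sub>F \<eta> in at_right 0. 2 * sqrt (a n) * (\<eta> / (sqrt \<alpha> + sqrt (\<alpha> + \<eta>))) \<le> \<xi> - xi (\<alpha> + \<eta>)"
proof -
  note D = wall_assumptionD[OF wall_assm order_refl]
  have "a n - \<alpha> > 0" using D by simp
  note ev = eventually_lt_right[OF this] eventually_good_left
  show ?thesis
    using ev
  proof eventually_elim
    case (elim \<eta>)
    define \<beta> where "\<beta> = \<alpha> + \<eta>"
    have \<beta>: "0 < \<beta>" "\<alpha> < \<beta>" "\<beta> < a n" and \<eta>: "\<eta> > 0" using elim alpha by (simp_all add: \<beta>_def)
    have \<Delta>: "sqrt \<beta> - sqrt \<alpha> = \<eta> / (sqrt \<alpha> + sqrt \<beta>)"
    proof -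
      have "\<beta> = \<alpha> - \<eta> \<or> \<beta> = \<alpha> + \<eta>" by (simp add: \<beta>_def)
      moreover have "\<bar>sqrt \<alpha> - sqrt \<beta>\<bar> = sqrt \<beta> - sqrt \<alpha>" using \<beta> by simp
      ultimately show ?thesis using sqrt_diff_bound(1)[OF \<beta>(1) \<eta>] by simp
    qed
    have "xi \<beta> - \<xi> \<le> step_shape \<beta> (a n) - step_shape \<alpha> (a n)"
      using elim by (intro xi_upper[OF _ _ \<beta>(1,3)]) (simp_all add: \<beta>_def)
    also have "\<dots> = - (2 * sqrt (a n) * (sqrt \<beta> - sqrt \<alpha>))"
      using \<beta> D by (simp add: step_shape_def real_sqrt_mult algebra_simps)
    finally show ?case unfolding \<Delta> by (simp add: \<beta>_def)
  qed
qed

text \<open>In the interior every nearby \<beta> > \<alpha> is affected and so has a contact time b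
  > \<beta>. By \<open>left_upper\<close> the position decreases, so the gain is at most 2 sqrt b
  (sqrt \<beta> - sqrt \<alpha>). This is of order \<eta> and confines b below a n plus
  \<open>spread\<close>.\<close>

lemma left_lower:
  assumes "interior_affected f xi \<alpha>"
  shows "\<forall>\<^sub>F \<eta> in at_right 0. \<xi> - xi (\<alpha> + \<eta>) \<le> 2 * sqrt (a n + spread \<eta>) * (\<eta> / (sqrt \<alpha> + sqrt (\<alpha> + \<eta>)))"
proof -
  obtain \<delta> where \<delta>: "\<delta> > 0" "\<And>\<beta>. \<alpha> \<le> \<beta> \<Longrightarrow> \<beta> < \<alpha> + \<delta> \<Longrightarrow> affected f \<beta> (xi \<beta>)"
    using assms by (auto simp: interior_affected_def)
  obtain K where K: "K > 0" "\<And>\<beta>. 0 < \<beta> \<Longrightarrow> affected f \<beta> (xi \<beta>) \<Longrightarrow> \<exists>b. has_gain K \<beta> b"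
    using xi_lower_affected by blast
  have "K * sqrt \<alpha> / 2 > 0" using K alpha by simp
  note ev = eventually_lt_right[OF \<delta>(1)] eventually_lt_right[OF this] left_upper
  show ?thesis
    using ev
  proof eventually_elim
    case (elim \<eta>)
    define \<beta> where "\<beta> = \<alpha> + \<eta>"
    define \<Delta> where "\<Delta> = sqrt \<beta> - sqrt \<alpha>"
    have \<beta>: "0 < \<beta>" "\<alpha> < \<beta>" "\<beta> < \<alpha> + \<delta>" and \<eta>: "\<eta> > 0" using elim alpha by (simp_all add: \<beta>_def)
    have \<Delta>: "\<Delta> > 0" using \<beta> by (simp add: \<Delta>_def)
    then have abs: "\<bar>sqrt \<alpha> - sqrt \<beta>\<bar> = \<Delta>" unfolding \<Delta>_def by linarith
    have alt\<beta>: "\<beta> = \<alpha> - \<eta> \<or> \<beta> = \<alpha> + \<eta>" by (simp add: \<beta>_def)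
    note \<Delta>1 = sqrt_diff_bound(1)[OF \<beta>(1) \<eta> alt\<beta>, unfolded abs]
    note \<Delta>2 = sqrt_diff_bound(2)[OF \<beta>(1) \<eta> alt\<beta>, unfolded abs]
    have "2 * sqrt (a n) * \<Delta> \<ge> 0" using \<Delta> wall_assumptionD(1)[OF wall_assm order_refl] alpha by simp
    then have le: "xi \<beta> \<le> \<xi>" using elim(3) unfolding \<Delta>1 by (simp add: \<beta>_def)
    obtain b where b: "b > \<beta>" "b \<le> 1" and alt: "xi \<beta> - \<xi> \<ge> step_shape \<beta> b - step_shape \<alpha> b + K \<or>
       (\<exists>i\<le>n. xi \<beta> - \<xi> \<ge> step_shape \<beta> b - step_shape \<alpha> b + sqrt \<alpha> / 24 * (b - a i)\<^sup>2)"
      using K(2)[OF \<beta>(1) \<delta>(2)[OF less_imp_le[OF \<beta>(2)] \<beta>(3)]] unfolding has_gain_def by blast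
    have shape: "step_shape \<beta> b - step_shape \<alpha> b = - (2 * sqrt b * \<Delta>)"
      using b \<beta> by (simp add: step_shape_def \<Delta>_def real_sqrt_mult algebra_simps)
    have "2 * sqrt b * \<Delta> \<le> 2 * 1 * (\<eta> / sqrt \<alpha>)"
      using b \<beta> \<Delta> \<Delta>2 alpha by (intro mult_mono) auto
    then have s: "2 * sqrt b * \<Delta> \<le> 2 * \<eta> / sqrt \<alpha>" by simp
    have "2 * \<eta> / sqrt \<alpha> < K" using elim alpha by (simp add: field_simps)
    with alt s le shape obtain i where i: "i \<le> n" "xi \<beta> - \<xi> \<ge> - (2 * sqrt b * \<Delta>) + sqrt \<alpha> / 24 * (b - a i)\<^sup>2"
      by fastforce
    have "\<bar>b - a i\<bar> \<le> spread \<eta>" by (rule spread_bound[OF \<eta>]) (use i(2) s le in linarith)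
    then have b': "b \<le> a n + spread \<eta>" using wall_assumptionD(6)[OF wall_assm i(1)] by linarith
    have "sqrt \<alpha> / 24 * (b - a i)\<^sup>2 \<ge> 0" using alpha by simp
    then have "\<xi> - xi \<beta> \<le> 2 * sqrt b * \<Delta>" using i(2) by linarith
    also have "\<dots> \<le> 2 * sqrt (a n + spread \<eta>) * \<Delta>"
      using \<Delta> b' by (intro mult_right_mono mult_left_mono) auto
    finally show ?case unfolding \<Delta>1 by (simp add: \<beta>_def)
  qed
qed

section \<open>From displacements to densities\<close>

lemma quotient_upper:
  fixes d s \<sigma> \<eta> :: real
  assumes "2 * s * (\<eta> / \<sigma>) \<le> d" "s > 0" "\<sigma> > 0" "\<eta> > 0"
  shows "\<eta> / d \<le> \<sigma> / (2 * s)" "d > 0"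
proof -
  have p: "2 * s * (\<eta> / \<sigma>) > 0" using assms by simp
  then show "d > 0" using assms(1) by linarith
  have "\<eta> / d \<le> \<eta> / (2 * s * (\<eta> / \<sigma>))" using assms p \<open>d > 0\<close> by (intro divide_left_mono) auto
  also have "\<dots> = \<sigma> / (2 * s)" using assms by (simp add: field_simps)
  finally show "\<eta> / d \<le> \<sigma> / (2 * s)" .
qed

lemma quotient_lower:
  fixes d s \<sigma> \<eta> :: real
  assumes "d \<le> 2 * s * (\<eta> / \<sigma>)" "s > 0" "\<sigma> > 0" "\<eta> > 0" "d > 0"
  shows "\<sigma> / (2 * s) \<le> \<eta> / d"
proof -
  have "\<sigma> / (2 * s) = \<eta> / (2 * s * (\<eta> / \<sigma>))" using assms by (simp add: field_simps)
  also have "\<dots> \<le> \<eta> / d" using assms by (intro divide_left_mono) auto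
  finally show ?thesis .
qed

lemma ratio_r_lim:
  "\<forall>\<^sub>F \<eta> in at_right 0. tendsto_in_prob M (ratio_r W f x0 \<alpha> \<eta>) (\<eta> / (xi (\<alpha> - \<eta>) - \<xi>)) \<and>
     lim_r \<eta> = \<eta> / (xi (\<alpha> - \<eta>) - \<xi>)"
  using eventually_good_right right_bounds eventually_lt_right[OF alpha(1)]
proof eventually_elim
  case (elim \<eta>)
  have lo: "2 * sqrt (a 0 - spread \<eta>) * (\<eta> / (sqrt \<alpha> + sqrt (\<alpha> - \<eta>))) \<le> xi (\<alpha> - \<eta>) - \<xi>"
    and good: "scales_like M (xf (\<alpha> - \<eta>)) (xi (\<alpha> - \<eta>))"
    and small: "\<alpha> < a 0 - spread \<eta>" "0 < \<eta>" "\<eta> < \<alpha>" using elim by blast+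
  have "sqrt (a 0 - spread \<eta>) > 0" "sqrt \<alpha> + sqrt (\<alpha> - \<eta>) > 0"
    using small alpha by (simp_all add: add_pos_pos)
  then have "xi (\<alpha> - \<eta>) - \<xi> > 0" by (rule quotient_upper(2)[OF lo _ _ small(2)])
  then have "tendsto_in_prob M (ratio_r W f x0 \<alpha> \<eta>) (\<eta> / (xi (\<alpha> - \<eta>) - \<xi>))"
    unfolding ratio_r_def[abs_def] by (intro ratio_tendsto[OF good scaling]) simp
  moreover from this have "lim_r \<eta> = \<eta> / (xi (\<alpha> - \<eta>) - \<xi>)"
    unfolding ratio_r_def[abs_def] by (rule lim_in_prob_eq[OF _ ratio_measurable])
  ultimately show ?case ..
qed

lemma ratio_l_lim:
  "\<forall>\<^sub>F \<eta> in at_right 0. tendsto_in_prob M (ratio_l W f x0 \<alpha> \<eta>) (\<eta> / (\<xi> - xi (\<alpha> + \<eta>))) \<and>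
     lim_l \<eta> = \<eta> / (\<xi> - xi (\<alpha> + \<eta>)) \<and> \<xi> - xi (\<alpha> + \<eta>) > 0"
  using eventually_good_left left_upper eventually_lt_right[OF alpha(1)]
proof eventually_elim
  case (elim \<eta>)
  have lo: "2 * sqrt (a n) * (\<eta> / (sqrt \<alpha> + sqrt (\<alpha> + \<eta>))) \<le> \<xi> - xi (\<alpha> + \<eta>)"
    and good: "scales_like M (xf (\<alpha> + \<eta>)) (xi (\<alpha> + \<eta>))"
    and small: "0 < \<eta>" using elim by blast+
  have "sqrt (a n) > 0" "sqrt \<alpha> + sqrt (\<alpha> + \<eta>) > 0"
    using small alpha wall_assumptionD(1)[OF wall_assm order_refl] by (simp_all add: add_pos_pos)
  then have pos: "\<xi> - xi (\<alpha> + \<eta>) > 0" by (rule quotient_upper(2)[OF lo _ _ small])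
  then have "tendsto_in_prob M (ratio_l W f x0 \<alpha> \<eta>) (\<eta> / (\<xi> - xi (\<alpha> + \<eta>)))"
    unfolding ratio_l_def[abs_def] by (intro ratio_tendsto[OF scaling good]) simp
  moreover from this have "lim_l \<eta> = \<eta> / (\<xi> - xi (\<alpha> + \<eta>))"
    unfolding ratio_l_def[abs_def] by (rule lim_in_prob_eq[OF _ ratio_measurable])
  ultimately show ?case using pos by blast
qed

lemma limit_shape:
  assumes "c > 0" and "(s \<longlongrightarrow> c) (at_right 0)" and "(g \<longlongrightarrow> \<alpha>) (at_right 0)"
  shows "((\<lambda>\<eta>. (sqrt \<alpha> + sqrt (g \<eta>)) / (2 * sqrt (s \<eta>))) \<longlongrightarrow> sqrt (\<alpha> / c)) (at_right (0::real))"
proof -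
  have "((\<lambda>\<eta>. (sqrt \<alpha> + sqrt (g \<eta>)) / (2 * sqrt (s \<eta>))) \<longlongrightarrow> (sqrt \<alpha> + sqrt \<alpha>) / (2 * sqrt c)) (at_right 0)"
    using assms by (intro tendsto_intros) auto
  moreover have "(sqrt \<alpha> + sqrt \<alpha>) / (2 * sqrt c) = sqrt (\<alpha> / c)" by (simp add: real_sqrt_divide)
  ultimately show ?thesis by simp
qed

lemma spread_tendsto: "(spread \<longlongrightarrow> 0) (at_right 0)"
proof -
  have "((\<lambda>\<eta>. sqrt (48 * \<eta> / \<alpha>)) \<longlongrightarrow> sqrt (48 * 0 / \<alpha>)) (at_right 0)"
    using alpha by (intro tendsto_intros) auto
  then show ?thesis by (simp add: spread_def[abs_def])
qed

lemma rho_r_tendsto: "((\<lambda>\<eta>. lim_r \<eta>) \<longlongrightarrow> sqrt (\<alpha> / a 0)) (at_right 0)"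
proof (rule tendsto_sandwich)
  note D = wall_assumptionD[OF wall_assm le0]
  have g: "((\<lambda>\<eta>. \<alpha> - \<eta>) \<longlongrightarrow> \<alpha>) (at_right 0)" using tendsto_diff[OF tendsto_const[of \<alpha>] tendsto_ident_at[of 0 "{0<..}"]] by simp
  show "((\<lambda>\<eta>. (sqrt \<alpha> + sqrt (\<alpha> - \<eta>)) / (2 * sqrt (a 0))) \<longlongrightarrow> sqrt (\<alpha> / a 0)) (at_right 0)"
    by (rule limit_shape[OF _ tendsto_const g]) (use D alpha in linarith)
  have "((\<lambda>\<eta>. a 0 - spread \<eta>) \<longlongrightarrow> a 0) (at_right 0)" using tendsto_diff[OF tendsto_const[of "a 0"] spread_tendsto] by simp
  then show "((\<lambda>\<eta>. (sqrt \<alpha> + sqrt (\<alpha> - \<eta>)) / (2 * sqrt (a 0 - spread \<eta>))) \<longlongrightarrow> sqrt (\<alpha> / a 0)) (at_right 0)"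
    by (rule limit_shape[OF _ _ g, rotated]) (use D alpha in linarith)
  have both: "\<forall>\<^sub>F \<eta> in at_right 0. (sqrt \<alpha> + sqrt (\<alpha> - \<eta>)) / (2 * sqrt (a 0)) \<le> lim_r \<eta> \<and>
     lim_r \<eta> \<le> (sqrt \<alpha> + sqrt (\<alpha> - \<eta>)) / (2 * sqrt (a 0 - spread \<eta>))"
    using ratio_r_lim right_bounds eventually_lt_right[OF alpha(1)]
  proof eventually_elim
    case (elim \<eta>)
    have pos: "sqrt \<alpha> + sqrt (\<alpha> - \<eta>) > 0" "sqrt (a 0 - spread \<eta>) > 0" "sqrt (a 0) > 0" "\<eta> > 0"
      using elim alpha D by (auto intro: add_pos_pos)
    have lo: "2 * sqrt (a 0 - spread \<eta>) * (\<eta> / (sqrt \<alpha> + sqrt (\<alpha> - \<eta>))) \<le> xi (\<alpha> - \<eta>) - \<xi>"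
      and hi: "xi (\<alpha> - \<eta>) - \<xi> \<le> 2 * sqrt (a 0) * (\<eta> / (sqrt \<alpha> + sqrt (\<alpha> - \<eta>)))" using elim by auto
    show ?case
      using quotient_upper[OF lo pos(2,1,4)] quotient_lower[OF hi pos(3,1,4)] elim(1) by simp
  qed
  show "\<forall>\<^sub>F \<eta> in at_right 0. (sqrt \<alpha> + sqrt (\<alpha> - \<eta>)) / (2 * sqrt (a 0)) \<le> lim_r \<eta>"
    "\<forall>\<^sub>F \<eta> in at_right 0. lim_r \<eta> \<le> (sqrt \<alpha> + sqrt (\<alpha> - \<eta>)) / (2 * sqrt (a 0 - spread \<eta>))"
    using both by (rule eventually_mono, simp)+
qed

lemma left_upper_limit:
  "\<forall>\<^sub>F \<eta> in at_right 0. lim_l \<eta> \<le> (sqrt \<alpha> + sqrt (\<alpha> + \<eta>)) / (2 * sqrt (a n))"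
  "((\<lambda>\<eta>. (sqrt \<alpha> + sqrt (\<alpha> + \<eta>)) / (2 * sqrt (a n))) \<longlongrightarrow> sqrt (\<alpha> / a n)) (at_right 0)"
proof -
  note D = wall_assumptionD[OF wall_assm order_refl]
  have g: "((\<lambda>\<eta>. \<alpha> + \<eta>) \<longlongrightarrow> \<alpha>) (at_right 0)" using tendsto_add[OF tendsto_const[of \<alpha>] tendsto_ident_at[of 0 "{0<..}"]] by simp
  show "((\<lambda>\<eta>. (sqrt \<alpha> + sqrt (\<alpha> + \<eta>)) / (2 * sqrt (a n))) \<longlongrightarrow> sqrt (\<alpha> / a n)) (at_right 0)"
    by (rule limit_shape[OF _ tendsto_const g]) (use D alpha in linarith)
  show "\<forall>\<^sub>F \<eta> in at_right 0. lim_l \<eta> \<le> (sqrt \<alpha> + sqrt (\<alpha> + \<eta>)) / (2 * sqrt (a n))"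
    using ratio_l_lim left_upper eventually_lt_right[OF alpha(1)]
  proof eventually_elim
    case (elim \<eta>)
    have pos: "sqrt \<alpha> + sqrt (\<alpha> + \<eta>) > 0" "sqrt (a n) > 0" "\<eta> > 0"
      using elim alpha D by (auto intro: add_pos_pos)
    show ?case using quotient_upper(1)[OF elim(2) pos(2,1,3)] elim(1) by simp
  qed
qed

lemma rho_l_le: "rho_l M W f x0 \<alpha> \<le> ereal (sqrt (\<alpha> / a n))"
proof -
  have "rho_l M W f x0 \<alpha> \<le> Limsup (at_right 0) (\<lambda>\<eta>. ereal ((sqrt \<alpha> + sqrt (\<alpha> + \<eta>)) / (2 * sqrt (a n))))"
    unfolding rho_l_def by (rule Limsup_mono) (use left_upper_limit(1) in \<open>simp only: ereal_less_eq\<close>)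
  also have "\<dots> = ereal (sqrt (\<alpha> / a n))"
    by (rule lim_imp_Limsup) (use left_upper_limit(2) in \<open>simp_all only: lim_ereal trivial_limit_at_right_real not_False_eq_True\<close>)
  finally show ?thesis .
qed

lemma rho_l_tendsto:
  assumes "interior_affected f xi \<alpha>"
  shows "((\<lambda>\<eta>. lim_l \<eta>) \<longlongrightarrow> sqrt (\<alpha> / a n)) (at_right 0)"
proof (rule tendsto_sandwich[OF _ left_upper_limit(1) _ left_upper_limit(2)])
  note D = wall_assumptionD[OF wall_assm order_refl]
  have g: "((\<lambda>\<eta>. \<alpha> + \<eta>) \<longlongrightarrow> \<alpha>) (at_right 0)" using tendsto_add[OF tendsto_const[of \<alpha>] tendsto_ident_at[of 0 "{0<..}"]] by simp
  have "((\<lambda>\<eta>. a n + spread \<eta>) \<longlongrightarrow> a n) (at_right 0)" using tendsto_add[OF tendsto_const[of "a n"] spread_tendsto] by simp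
  then show "((\<lambda>\<eta>. (sqrt \<alpha> + sqrt (\<alpha> + \<eta>)) / (2 * sqrt (a n + spread \<eta>))) \<longlongrightarrow> sqrt (\<alpha> / a n)) (at_right 0)"
    by (rule limit_shape[OF _ _ g, rotated]) (use D alpha in linarith)
  show "\<forall>\<^sub>F \<eta> in at_right 0. (sqrt \<alpha> + sqrt (\<alpha> + \<eta>)) / (2 * sqrt (a n + spread \<eta>)) \<le> lim_l \<eta>"
    using ratio_l_lim left_lower[OF assms] eventually_lt_right[OF alpha(1)]
  proof eventually_elim
    case (elim \<eta>)
    have sp: "spread \<eta> \<ge> 0" using elim alpha by (simp add: spread_def)
    have pos: "sqrt \<alpha> + sqrt (\<alpha> + \<eta>) > 0" "sqrt (a n + spread \<eta>) > 0" "\<eta> > 0"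
      using elim alpha D sp by (auto intro: add_pos_pos)
    show ?case using quotient_lower[OF elim(2) pos(2,1,3)] elim(1) by simp
  qed
qed

end

theorem lemma2p15:
  fixes M :: "'w measure"
    and W :: "nat \<Rightarrow> nat \<Rightarrow> 'w \<Rightarrow> real"
    and f :: "real \<Rightarrow> real \<Rightarrow> real"
    and x0 :: "nat \<Rightarrow> int"
    and xi :: "real \<Rightarrow> real"
    and \<alpha> \<xi> \<epsilon> :: real
    and n :: nat
    and a :: "nat \<Rightarrow> real"
  assumes clocks: "poisson_clocks M W"
    and wall: "\<And>T. T > 0 \<Longrightarrow> is_wall (f T)"
    and initial: "admissible_initial x0"
    and alpha: "0 < \<alpha>" "\<alpha> < 1"
    and standing: "\<forall>\<^sub>F \<beta> in nhds \<alpha>.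
          scales_like M (wall_position W f x0 \<beta>) (xi \<beta>) \<and>
          (affected f \<beta> (xi \<beta>) \<or> not_affected M W f x0 \<beta> (xi \<beta>))"
    and scaling: "scales_like M (wall_position W f x0 \<alpha>) \<xi>"
    and wall_assm: "wall_assumption f \<alpha> \<xi> n a \<epsilon>"
  shows "(\<forall>\<^sub>F \<eta> in at_right 0. \<exists>c. tendsto_in_prob M (ratio_r W f x0 \<alpha> \<eta>) c) \<and>
         (\<forall>\<^sub>F \<eta> in at_right 0. \<exists>c. tendsto_in_prob M (ratio_l W f x0 \<alpha> \<eta>) c) \<and>
         rho_r M W f x0 \<alpha> = ereal (sqrt (\<alpha> / a 0)) \<and>
         ((\<lambda>\<eta>. lim_in_prob M (ratio_r W f x0 \<alpha> \<eta>)) \<longlongrightarrow> sqrt (\<alpha> / a 0)) (at_right 0) \<and>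
         rho_l M W f x0 \<alpha> \<le> ereal (sqrt (\<alpha> / a n)) \<and>
         (interior_affected f xi \<alpha> \<and> \<epsilon> \<le> a n \<longrightarrow>
            rho_l M W f x0 \<alpha> = ereal (sqrt (\<alpha> / a n)) \<and>
            ((\<lambda>\<eta>. lim_in_prob M (ratio_l W f x0 \<alpha> \<eta>)) \<longlongrightarrow> sqrt (\<alpha> / a n)) (at_right 0))"
proof -
  interpret wall_setting M W f x0 xi \<alpha> \<xi> \<epsilon> n a
    by unfold_locales (fact assms)+
  have "((\<lambda>\<eta>. ereal (lim_in_prob M (ratio_r W f x0 \<alpha> \<eta>))) \<longlongrightarrow> ereal (sqrt (\<alpha> / a 0))) (at_right 0)"
    using rho_r_tendsto by (simp only: lim_ereal)
  then have r: "rho_r M W f x0 \<alpha> = ereal (sqrt (\<alpha> / a 0))"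
    unfolding rho_r_def by (intro lim_imp_Liminf trivial_limit_at_right_real)
  have l: "rho_l M W f x0 \<alpha> = ereal (sqrt (\<alpha> / a n))" if "interior_affected f xi \<alpha>"
  proof -
    have "((\<lambda>\<eta>. ereal (lim_in_prob M (ratio_l W f x0 \<alpha> \<eta>))) \<longlongrightarrow> ereal (sqrt (\<alpha> / a n))) (at_right 0)"
      using rho_l_tendsto[OF that] by (simp only: lim_ereal)
    then show ?thesis unfolding rho_l_def by (intro lim_imp_Limsup trivial_limit_at_right_real)
  qed
  have "\<forall>\<^sub>F \<eta> in at_right 0. \<exists>c. tendsto_in_prob M (ratio_r W f x0 \<alpha> \<eta>) c"
    using ratio_r_lim by (rule eventually_mono) blast
  moreover have "\<forall>\<^sub>F \<eta> in at_right 0. \<exists>c. tendsto_in_prob M (ratio_l W f x0 \<alpha> \<eta>) c"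
    using ratio_l_lim by (rule eventually_mono) blast
  ultimately show ?thesis
    using r rho_r_tendsto rho_l_le l rho_l_tendsto by blast
qed

end
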